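(* Let $\mathrm{d}+A$ be an $\mathfrak{sl}_2$-connection on the formal punctured disc that is irregular of Poisson order $1$ with diagonalizable irregular term, i.e. $A_k=0$ for $k>1$, $A_1=\mathrm{diag}(\xi,-\xi)$ with $\xi\neq 0$, $A_0=\begin{pmatrix}\varepsilon&\tau^-\\-\tau^+&-\varepsilon\end{pmatrix}$, and $A_k\in\mathfrak{sl}_2$ arbitrary for $k<0$. Then the simple induced module $\mathcal{SF}_{\mathrm{d}+A}^{\leq 0}$ is, as a representation of the Virasoro algebra acting through the operators $L_n^{\mathrm{d}+A}$ (central charge $c=-2$), the direct sum of Whittaker modules with generators $w_k$, $k\in\mathbb{Z}$, where $$L_n^{\mathrm{d}+A}w_k=0\ \ (n\geq 3),\qquad L_2^{\mathrm{d}+A}w_k=\tfrac12\xi^2\cdot w_k,\qquad L_1^{\mathrm{d}+A}w_k=\xi\,(k+\tfrac12\varepsilon)\cdot w_k .$$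
   Context: All algebras are over $\mathbb{C}$. Indices $a,b\in\{+,-\}$; $\mathbb{C}^2$ has basis $e^+,e^-$ and symplectic form $(e^+,e^-)=1=-(e^-,e^+)$, $(e^\pm,e^\pm)=0$. Connection: $\mathrm{d}+A$ with $A(z)=\sum_{k}A_kz^{-k-1}$, $A_k\in\mathfrak{sl}_2(\mathbb{C})$. Put $C_k=\begin{pmatrix}0&-1\\1&0\end{pmatrix}A_k$ (rows and columns indexed by $+,-$ in this order), a symmetric matrix with entries $C_k^{ab}$. Thus $C_1=\begin{pmatrix}0&\xi\\\xi&0\end{pmatrix}$, $C_0=\begin{pmatrix}\tau^+&\varepsilon\\\varepsilon&\tau^-\end{pmatrix}$, $C_k=0$ for $k>1$. Algebra: $\mathcal{SF}_{\mathrm{d}+A}$ is the unital associative (Clifford) algebra with generators $\psi^\pm_n$, $n\in\mathbb{Z}$, and relations $\{\psi^a_m,\psi^b_n\}=m\,(e^a,e^b)\,\delta_{m+n,0}+C_{m+n}^{ab}$, where $\{x,y\}=xy+yx$. Superscripts $\leq 0$, $\geq 0$, $0$ denote the subalgebras generated by the $\psi_n^\pm$ with $n\leq0$, $n\geq 0$, $n=0$ respectively. Induced module: Let $V^{01}=\mathcal{SF}^{0}_{\mathrm{d}+A}$ with $\psi_0^\pm$ acting by left multiplication and $\psi_1^\pm$ acting by the anti-derivation $\xi\,\partial/\partial\psi_0^\mp$ (killing $1$); let $\psi_n^\pm$, $n\ge 2$, act on $V^{01}$ by zero. The induced module is $\mathcal{SF}_{\mathrm{d}+A}\otimes_{\mathcal{SF}_{\mathrm{d}+A}^{\geq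 0}}V^{01}$. As a left $\mathcal{SF}^{\le0}_{\mathrm{d}+A}$-module it is identified with $\mathcal{SF}_{\mathrm{d}+A}^{\leq 0}$; the element $1$ is annihilated by all $\psi_n^\pm$, $n\geq 1$. Virasoro operators: the normally ordered product is $:\psi_i^a\psi_j^b:\;=\psi_i^a\psi_j^b$ if $i<j$, $-\psi_j^b\psi_i^a$ if $i>j$, and $\frac12(\psi_i^a\psi_j^b-\psi_j^b\psi_i^a)$ if $i=j$. The Virasoro action on the induced module is given by $$L_n^{\mathrm{d}+A}=\sum_{i+j=n}:\psi_i^-\psi_j^+:\;+\;c_n1,\qquad c_n=\tfrac12\sum_{i+j=n}\big(C_i^{-+}C_j^{+-}+C_i^{++}C_j^{--}\big).$$ A Whittaker vector of type $(a_1,a_2)$ in a Virasoro module is a nonzero vector $w$ with $L_1w=a_1w$, $L_2w=a_2w$, $L_nw=0$ for $n\geq 3$; a Whittaker module is a Virasoro module generated by a Whittaker vector. The universal one at central charge $-2$ is the module induced from the one-dimensional representation of the subalgebra spanned by $L_n$, $n\ge1$, with underlying space $\mathbb{C}[L_0,L_{-1},\dots]w$.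
   Formalization: The L_1 eigenvalue is ξ(k+ε), not ξ(k+ε/2): the definitions give L_1·1=ξε·1, so the printed value fails e.g. for ε=1. In c_n the term C_i^{++}C_j^{--} carries a minus sign, since with plus [L_1,L_{-1}]=2L_0 fails when τ⁺τ⁻≠0 and A_k=0 for k<0. *)

theory Defs
  imports
    "HOL-Library.Groups_Big_Fun"
    "HOL-Analysis.Determinants"
    "HOL-Algebra.Free_Abelian_Groups"
    "HOL-Algebra.Generated_Rings"
    "HOL-Algebra.QuotRing"
    "HOL-Algebra.Algebraic_Closure_Type"
    "HOL-Algebra.Module"
begin

section \<open>Connections\<close>

datatype sign = Plus | Minus

lemma UNIV_sign: "UNIV = {Plus, Minus}"
  using sign.exhaust by auto

instance sign :: finite
  by standard (simp add: UNIV_sign)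

fun opp :: "sign \<Rightarrow> sign" where
  "opp Plus = Minus"
| "opp Minus = Plus"

text \<open>The type argument order is columns, then rows, so \<open>X $ a $ b\<close> is the entry in row
  \<open>a\<close> and column \<open>b\<close>.\<close>

type_synonym mat_pm = "complex ^ sign ^ sign"

definition mat_pm :: "complex \<Rightarrow> complex \<Rightarrow> complex \<Rightarrow> complex \<Rightarrow> mat_pm" where
  "mat_pm p q r s =
     (\<chi> a b. case a of Plus \<Rightarrow> (case b of Plus \<Rightarrow> p | Minus \<Rightarrow> q)
                     | Minus \<Rightarrow> (case b of Plus \<Rightarrow> r | Minus \<Rightarrow> s))"

text \<open>A connection \<open>d + A\<close> is given by its coefficients \<open>A k\<close>, where
  \<open>A(z) = \<Sum>k. A k z^(-k-1)\<close>.\<close>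

definition Cmat :: "(int \<Rightarrow> mat_pm) \<Rightarrow> int \<Rightarrow> mat_pm" where
  "Cmat A k = mat_pm 0 (-1) 1 0 ** A k"

fun symp :: "sign \<Rightarrow> sign \<Rightarrow> complex" where
  "symp Plus Minus = 1"
| "symp Minus Plus = -1"
| "symp Plus Plus = 0"
| "symp Minus Minus = 0"


section \<open>The Clifford algebra by generators and relations\<close>

text \<open>Words form a monoid under concatenation; finitely supported functions on words with the
  convolution product of \<open>Poly_Mapping\<close> are then the free associative algebra.\<close>

instantiation list :: (type) monoid_add
begin

definition zero_list :: "'a list" where "zero_list = []"

definition plus_list :: "'a list \<Rightarrow> 'a list \<Rightarrow> 'a list" where "plus_list xs ys = xs @ ys"

instance
  by standard (simp_all add: zero_list_def plus_list_def)

end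

type_synonym free_alg = "(sign \<times> int) list \<Rightarrow>\<^sub>0 complex"

definition gen :: "sign \<Rightarrow> int \<Rightarrow> free_alg" where
  "gen a n = Poly_Mapping.single [(a, n)] 1"

definition scal :: "complex \<Rightarrow> free_alg" where
  "scal c = Poly_Mapping.single [] c"

definition Free :: "free_alg ring" where
  "Free = ring_of_type_algebra"

definition clifford_relators :: "(int \<Rightarrow> mat_pm) \<Rightarrow> free_alg set" where
  "clifford_relators A =
     {gen a m * gen b n + gen b n * gen a m
        - scal ((if m + n = 0 then of_int m * symp a b else 0) + Cmat A (m + n) $ a $ b)
      | a b m n. True}"

definition clifford_ideal :: "(int \<Rightarrow> mat_pm) \<Rightarrow> free_alg set" where
  "clifford_ideal A = genideal Free (clifford_relators A)"

type_synonym sf = "free_alg set"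

definition SF :: "(int \<Rightarrow> mat_pm) \<Rightarrow> sf ring" where
  "SF A = Free Quot clifford_ideal A"

definition psi :: "(int \<Rightarrow> mat_pm) \<Rightarrow> sign \<Rightarrow> int \<Rightarrow> sf" where
  "psi A a n = clifford_ideal A +>\<^bsub>Free\<^esub> gen a n"

text \<open>The structure map of the \<open>\<complex>\<close>-algebra \<open>SF A\<close>.\<close>

definition sc :: "(int \<Rightarrow> mat_pm) \<Rightarrow> complex \<Rightarrow> sf" where
  "sc A c = clifford_ideal A +>\<^bsub>Free\<^esub> scal c"

text \<open>The (unital, complex) subalgebra generated by the modes with index in \<open>N\<close>.\<close>

definition SF_sub :: "(int \<Rightarrow> mat_pm) \<Rightarrow> int set \<Rightarrow> sf set" where
  "SF_sub A N = generate_ring (SF A) (range (sc A) \<union> {psi A a n | a n. n \<in> N})"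


section \<open>The inducing module\<close>

text \<open>The anti-derivation \<open>\<partial>/\<partial>\<psi>\<close> of \<open>SF_sub A {0}\<close>, for \<open>\<psi> = psi A a 0\<close>. The sign rule is only
  imposed for an (odd) generator as left factor; as the generators generate, this determines the
  map and gives the sign rule for all products.\<close>

definition is_antider :: "(int \<Rightarrow> mat_pm) \<Rightarrow> sign \<Rightarrow> (sf \<Rightarrow> sf) \<Rightarrow> bool" where
  "is_antider A a D \<longleftrightarrow>
     (\<forall>x\<in>SF_sub A {0}. D x \<in> SF_sub A {0}) \<and>
     (\<forall>x\<in>SF_sub A {0}. \<forall>y\<in>SF_sub A {0}. D (x \<oplus>\<^bsub>SF A\<^esub> y) = D x \<oplus>\<^bsub>SF A\<^esub> D y) \<and>
     (\<forall>c. \<forall>x\<in>SF_sub A {0}. D (sc A c \<otimes>\<^bsub>SF A\<^esub> x) = sc A c \<otimes>\<^bsub>SF A\<^esub> D x) \<and>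
     D \<one>\<^bsub>SF A\<^esub> = \<zero>\<^bsub>SF A\<^esub> \<and>
     (\<forall>b. \<forall>x\<in>SF_sub A {0}. D (psi A b 0 \<otimes>\<^bsub>SF A\<^esub> x) =
        (if b = a then x else \<zero>\<^bsub>SF A\<^esub>) \<ominus>\<^bsub>SF A\<^esub> psi A b 0 \<otimes>\<^bsub>SF A\<^esub> D x)"

definition antider :: "(int \<Rightarrow> mat_pm) \<Rightarrow> sign \<Rightarrow> sf \<Rightarrow> sf" where
  "antider A a = (SOME D. is_antider A a D)"

text \<open>The action of \<open>SF_sub A {0..}\<close> on \<open>SF_sub A {0}\<close>, determined by its values on generators.
  The constant called \<open>\<xi>\<close> is the entry \<open>+-\<close> of \<open>Cmat A 1\<close>.\<close>

definition is_V01_action :: "(int \<Rightarrow> mat_pm) \<Rightarrow> (sf \<Rightarrow> sf \<Rightarrow> sf) \<Rightarrow> bool" where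
  "is_V01_action A \<rho> \<longleftrightarrow>
     (\<forall>x\<in>SF_sub A {0..}. \<forall>v\<in>SF_sub A {0}. \<rho> x v \<in> SF_sub A {0}) \<and>
     (\<forall>x\<in>SF_sub A {0..}. \<forall>v\<in>SF_sub A {0}. \<forall>u\<in>SF_sub A {0}.
        \<rho> x (v \<oplus>\<^bsub>SF A\<^esub> u) = \<rho> x v \<oplus>\<^bsub>SF A\<^esub> \<rho> x u) \<and>
     (\<forall>x\<in>SF_sub A {0..}. \<forall>y\<in>SF_sub A {0..}. \<forall>v\<in>SF_sub A {0}.
        \<rho> (x \<oplus>\<^bsub>SF A\<^esub> y) v = \<rho> x v \<oplus>\<^bsub>SF A\<^esub> \<rho> y v \<and>
        \<rho> (x \<otimes>\<^bsub>SF A\<^esub> y) v = \<rho> x (\<rho> y v)) \<and>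
     (\<forall>v\<in>SF_sub A {0}.
        (\<forall>c. \<rho> (sc A c) v = sc A c \<otimes>\<^bsub>SF A\<^esub> v) \<and>
        (\<forall>a. \<rho> (psi A a 0) v = psi A a 0 \<otimes>\<^bsub>SF A\<^esub> v) \<and>
        (\<forall>a. \<rho> (psi A a 1) v =
           sc A (Cmat A 1 $ Plus $ Minus) \<otimes>\<^bsub>SF A\<^esub> antider A (opp a) v) \<and>
        (\<forall>a. \<forall>n\<ge>2. \<rho> (psi A a n) v = \<zero>\<^bsub>SF A\<^esub>))"

definition V01 :: "(int \<Rightarrow> mat_pm) \<Rightarrow> (sf, sf) module" where
  "V01 A = \<lparr>carrier = SF_sub A {0}, mult = mult (SF A), one = \<one>\<^bsub>SF A\<^esub>,
     zero = \<zero>\<^bsub>SF A\<^esub>, add = add (SF A), module.smult = (SOME \<rho>. is_V01_action A \<rho>)\<rparr>"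


section \<open>Induction along a subring\<close>

text \<open>\<open>HOL-Algebra\<close> has modules over commutative rings only. Here \<open>R\<close> is a ring, \<open>S\<close> a subring and
  \<open>M\<close> a left \<open>S\<close>-module, all given by the library's record types; \<open>R \<otimes>\<^sub>S M\<close> is the free
  abelian group on pairs modulo the bi-additive and \<open>S\<close>-balanced relations.\<close>

definition tensor_relators ::
  "'r ring \<Rightarrow> 'r set \<Rightarrow> ('r, 'm) module \<Rightarrow> ('r \<times> 'm \<Rightarrow>\<^sub>0 int) set" where
  "tensor_relators R S M =
     {frag_of (x \<oplus>\<^bsub>R\<^esub> y, v) - frag_of (x, v) - frag_of (y, v)
        | x y v. x \<in> carrier R \<and> y \<in> carrier R \<and> v \<in> carrier M} \<union>
     {frag_of (x, v \<oplus>\<^bsub>M\<^esub> u) - frag_of (x, v) - frag_of (x, u)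
        | x v u. x \<in> carrier R \<and> v \<in> carrier M \<and> u \<in> carrier M} \<union>
     {frag_of (x \<otimes>\<^bsub>R\<^esub> s, v) - frag_of (x, s \<odot>\<^bsub>M\<^esub> v)
        | x s v. x \<in> carrier R \<and> s \<in> S \<and> v \<in> carrier M}"

definition tensor_free :: "'r ring \<Rightarrow> ('r, 'm) module \<Rightarrow> ('r \<times> 'm \<Rightarrow>\<^sub>0 int) monoid" where
  "tensor_free R M = free_Abelian_group (carrier R \<times> carrier M)"

definition tensor_null ::
  "'r ring \<Rightarrow> 'r set \<Rightarrow> ('r, 'm) module \<Rightarrow> ('r \<times> 'm \<Rightarrow>\<^sub>0 int) set" where
  "tensor_null R S M = generate (tensor_free R M) (tensor_relators R S M)"

text \<open>The action is \<open>r (x \<otimes> v) = r x \<otimes> v\<close>; the union below is over cosets that all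
  coincide. The fields \<open>mult\<close> and \<open>one\<close> play no role in a module.\<close>

definition induced ::
  "'r ring \<Rightarrow> 'r set \<Rightarrow> ('r, 'm) module \<Rightarrow> ('r, ('r \<times> 'm \<Rightarrow>\<^sub>0 int) set) module" where
  "induced R S M =
     \<lparr>carrier = carrier (tensor_free R M Mod tensor_null R S M),
      mult = undefined, one = undefined,
      zero = \<one>\<^bsub>tensor_free R M Mod tensor_null R S M\<^esub>,
      add = mult (tensor_free R M Mod tensor_null R S M),
      module.smult = (\<lambda>r T. \<Union>z\<in>T. tensor_null R S M #>\<^bsub>tensor_free R M\<^esub>
                 frag_extend (\<lambda>(x, v). frag_of (r \<otimes>\<^bsub>R\<^esub> x, v)) z)\<rparr>"

definition simple_module :: "'r ring \<Rightarrow> ('r, 'm) module \<Rightarrow> bool" where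
  "simple_module R M \<longleftrightarrow>
     carrier M \<noteq> {\<zero>\<^bsub>M\<^esub>} \<and>
     (\<forall>U. subgroup U (add_monoid M) \<and> (\<forall>r\<in>carrier R. \<forall>u\<in>U. r \<odot>\<^bsub>M\<^esub> u \<in> U)
        \<longrightarrow> U = {\<zero>\<^bsub>M\<^esub>} \<or> U = carrier M)"

definition restrict_scalars :: "('k \<Rightarrow> 'r) \<Rightarrow> ('r, 'm) module \<Rightarrow> ('k, 'm) module" where
  "restrict_scalars f M =
     \<lparr>carrier = carrier M, mult = mult M, one = one M, zero = zero M, add = add M,
      module.smult = (\<lambda>c. module.smult M (f c))\<rparr>"

type_synonym ind = "(sf \<times> sf \<Rightarrow>\<^sub>0 int) set"

definition Ind :: "(int \<Rightarrow> mat_pm) \<Rightarrow> (sf, ind) module" where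
  "Ind A = induced (SF A) (SF_sub A {0..}) (V01 A)"

definition Ind_complex :: "(int \<Rightarrow> mat_pm) \<Rightarrow> (complex, ind) module" where
  "Ind_complex A = restrict_scalars (sc A) (Ind A)"


section \<open>Virasoro operators on the induced module\<close>

definition nprod :: "(int \<Rightarrow> mat_pm) \<Rightarrow> sign \<Rightarrow> int \<Rightarrow> sign \<Rightarrow> int \<Rightarrow> sf" where
  "nprod A a i b j =
     (if i < j then psi A a i \<otimes>\<^bsub>SF A\<^esub> psi A b j
      else if i > j then \<ominus>\<^bsub>SF A\<^esub> (psi A b j \<otimes>\<^bsub>SF A\<^esub> psi A a i)
      else sc A (1/2) \<otimes>\<^bsub>SF A\<^esub>
             (psi A a i \<otimes>\<^bsub>SF A\<^esub> psi A b j \<ominus>\<^bsub>SF A\<^esub> psi A b j \<otimes>\<^bsub>SF A\<^esub> psi A a i))"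

text \<open>This is \<open>1/4\<close> times the sum of \<open>trace (A i ** A (n - i))\<close>. The sign of the \<open>++\<close>, \<open>--\<close> term
  is forced by the Virasoro relations: \<open>[L 1, L (-1)] = 2 L 0\<close>, evaluated on the vector \<open>1\<close>,
  determines the constant in \<open>L 0\<close>.\<close>

definition vir_const :: "(int \<Rightarrow> mat_pm) \<Rightarrow> int \<Rightarrow> complex" where
  "vir_const A n = 1/2 * Sum_any (\<lambda>i.
     Cmat A i $ Minus $ Plus * Cmat A (n - i) $ Plus $ Minus
     - Cmat A i $ Plus $ Plus * Cmat A (n - i) $ Minus $ Minus)"

text \<open>On each vector only finitely many normally ordered products act nontrivially.\<close>

definition vir :: "(int \<Rightarrow> mat_pm) \<Rightarrow> int \<Rightarrow> ind \<Rightarrow> ind" where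
  "vir A n v =
     finsum (Ind A) (\<lambda>i. nprod A Minus i Plus (n - i) \<odot>\<^bsub>Ind A\<^esub> v)
       {i. nprod A Minus i Plus (n - i) \<odot>\<^bsub>Ind A\<^esub> v \<noteq> \<zero>\<^bsub>Ind A\<^esub>}
     \<oplus>\<^bsub>Ind A\<^esub> sc A (vir_const A n) \<odot>\<^bsub>Ind A\<^esub> v"


section \<open>Virasoro modules\<close>

definition CC :: "complex ring" where
  "CC = ring_of_type_algebra"

definition virasoro_module :: "complex \<Rightarrow> (complex, 'v) module \<Rightarrow> (int \<Rightarrow> 'v \<Rightarrow> 'v) \<Rightarrow> bool" where
  "virasoro_module c V L \<longleftrightarrow>
     module CC V \<and>
     (\<forall>n. \<forall>v\<in>carrier V. L n v \<in> carrier V) \<and>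
     (\<forall>n. \<forall>v\<in>carrier V. \<forall>u\<in>carrier V. L n (v \<oplus>\<^bsub>V\<^esub> u) = L n v \<oplus>\<^bsub>V\<^esub> L n u) \<and>
     (\<forall>n t. \<forall>v\<in>carrier V. L n (t \<odot>\<^bsub>V\<^esub> v) = t \<odot>\<^bsub>V\<^esub> L n v) \<and>
     (\<forall>m n. \<forall>v\<in>carrier V.
        L m (L n v) \<ominus>\<^bsub>V\<^esub> L n (L m v) =
        of_int (m - n) \<odot>\<^bsub>V\<^esub> L (m + n) v
        \<oplus>\<^bsub>V\<^esub> (if m + n = 0 then c / 12 * of_int (m ^ 3 - m) else 0) \<odot>\<^bsub>V\<^esub> v)"

definition vir_submodule ::
  "(complex, 'v) module \<Rightarrow> (int \<Rightarrow> 'v \<Rightarrow> 'v) \<Rightarrow> 'v set \<Rightarrow> bool" where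
  "vir_submodule V L U \<longleftrightarrow> submodule U CC V \<and> (\<forall>n. \<forall>u\<in>U. L n u \<in> U)"

definition whittaker_vector ::
  "(complex, 'v) module \<Rightarrow> (int \<Rightarrow> 'v \<Rightarrow> 'v) \<Rightarrow> complex \<Rightarrow> complex \<Rightarrow> 'v \<Rightarrow> bool" where
  "whittaker_vector V L a1 a2 w \<longleftrightarrow>
     w \<in> carrier V \<and> w \<noteq> \<zero>\<^bsub>V\<^esub> \<and>
     L 1 w = a1 \<odot>\<^bsub>V\<^esub> w \<and> L 2 w = a2 \<odot>\<^bsub>V\<^esub> w \<and> (\<forall>n\<ge>3. L n w = \<zero>\<^bsub>V\<^esub>)"

definition whittaker_module ::
  "complex \<Rightarrow> (complex, 'v) module \<Rightarrow> (int \<Rightarrow> 'v \<Rightarrow> 'v) \<Rightarrow> complex \<Rightarrow> complex \<Rightarrow> 'v \<Rightarrow> bool" where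
  "whittaker_module c V L a1 a2 w \<longleftrightarrow>
     virasoro_module c V L \<and> whittaker_vector V L a1 a2 w \<and>
     \<Inter>{U. vir_submodule V L U \<and> w \<in> U} = carrier V"

definition vir_direct_sum ::
  "(complex, 'v) module \<Rightarrow> (int \<Rightarrow> 'v \<Rightarrow> 'v) \<Rightarrow> ('k \<Rightarrow> 'v set) \<Rightarrow> bool" where
  "vir_direct_sum V L W \<longleftrightarrow>
     (\<forall>k. vir_submodule V L (W k)) \<and>
     (\<forall>v\<in>carrier V. \<exists>!u. (\<forall>k. u k \<in> W k) \<and> finite {k. u k \<noteq> \<zero>\<^bsub>V\<^esub>} \<and>
        v = finsum V u {k. u k \<noteq> \<zero>\<^bsub>V\<^esub>})"

end

theory Submission
  imports Defs "HOL-Computational_Algebra.Formal_Laurent_Series"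
begin

text \<open>A formal gauge transformation diagonalizes the connection, and the fields \<open>\<psi>\<close> integrated against
  its horizontal sections are free fermions \<open>b\<close>, \<open>c\<close> on which the Virasoro operators act by first-order
  differential operators. The \<open>w k\<close> are the vacua of these fermions for the charges \<open>k\<close>. By an
  antisymmetry argument the Virasoro span of the \<open>w k\<close> contains all \<open>c j (w k)\<close> and \<open>b j (w k)\<close>; therefore
  it is stable under the fermions and is everything. The sum is direct because \<open>L 1\<close> has only the
  generalized eigenvalue \<open>\<xi> (k + \<epsilon>)\<close> on the summand of \<open>w k\<close>. The Virasoro relations hold up to
  scalars by Schur's lemma, and the scalars are vacuum expectation values. To know that the induced
  module is not too small, it is mapped isomorphically onto a Fock space with a basis of ordered
  monomials, on which the Clifford algebra acts by straightening.\<close>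

unbundle no vec_syntax
unbundle fps_syntax

text \<open>The double pole is what makes the charge visible to the Virasoro operators. Moving
  \<open>L m\<close> past a mode \<open>C j\<close> produces \<open>\<xi>\<close> times a mode
  shifted by \<open>m - 1\<close> and a second term shifted by \<open>m\<close>. For
  \<open>m = 1\<close> the first term is diagonal, so \<open>L 1\<close> is triangular on monomials:
  every \<open>C\<close> adds \<open>\<xi>\<close> to the eigenvalue, every \<open>E\<close> removes
  it. Thus \<open>L 1\<close> measures the charge up to nilpotents, and
  \<open>\<xi> \<noteq> 0\<close> separates the charges. The values at charge 0 come from the
  constants in the operators: the index pairs (0, 1) and (1, 0) contribute half of
  \<open>\<xi> \<epsilon>\<close> each, whence \<open>\<xi> (k + \<epsilon>)\<close>, and (1, 1)
  contributes \<open>\<xi>^2 / 2\<close>. The coefficients \<open>A k\<close> with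
  \<open>k < 0\<close> are arbitrary, so in general no grading by modes is respected and neither
  characters nor dimension counts are available. Spanning and directness therefore rest on closure
  arguments, and the scalars in the Virasoro relations are computed by an explicit functional. The
  central charge -2 appears there as \<open>- (m^3 - m) / 6\<close>, a sum over products of two
  contractions.\<close>

locale complex_space = vector_space scale
  for scale :: "complex \<Rightarrow> 'v :: ab_group_add \<Rightarrow> 'v" (infixr \<open>\<cdot>\<close> 75)
begin

definition lin :: "('v \<Rightarrow> 'v) \<Rightarrow> bool" where
  "lin f \<longleftrightarrow> (\<forall>x y. f (x + y) = f x + f y) \<and> (\<forall>c x. f (c \<cdot> x) = c \<cdot> f x)"

lemma linI: "(\<And>x y. f (x + y) = f x + f y) \<Longrightarrow> (\<And>c x. f (c \<cdot> x) = c \<cdot> f x) \<Longrightarrow> lin f"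
  by (simp add: lin_def)

lemma lin_add: "lin f \<Longrightarrow> f (x + y) = f x + f y"
  and lin_scale: "lin f \<Longrightarrow> f (c \<cdot> x) = c \<cdot> f x"
  by (simp_all add: lin_def)

lemma lin_zero: "lin f \<Longrightarrow> f 0 = 0"
  by (metis lin_scale scale_zero_left)

lemma lin_neg: "lin f \<Longrightarrow> f (- x) = - f x"
  by (metis add_eq_0_iff lin_add lin_zero)

lemma lin_diff: "lin f \<Longrightarrow> f (x - y) = f x - f y"
  by (metis add_uminus_conv_diff lin_add lin_neg)

lemma lin_sum: "lin f \<Longrightarrow> f (sum g A) = (\<Sum>i\<in>A. f (g i))"
  by (induction A rule: infinite_finite_induct) (simp_all add: lin_zero lin_add)

lemmas lin_simps = lin_add lin_scale lin_zero lin_neg lin_diff lin_sum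

end

section \<open>Free fermions\<close>

text \<open>Fermions with \<open>w\<close> as a vacuum: the modes \<open>C j\<close> with \<open>j \<ge> k\<close> and \<open>E j\<close> with \<open>j < k\<close> create,
  and the conjugate ones annihilate \<open>w\<close>.\<close>

locale fermions = complex_space scale
  for scale :: "complex \<Rightarrow> 'v :: ab_group_add \<Rightarrow> 'v" (infixr \<open>\<cdot>\<close> 75) +
  fixes C E :: "int \<Rightarrow> 'v \<Rightarrow> 'v" and k :: int and w :: 'v
  assumes lin_C: "\<And>j. lin (C j)" and lin_E: "\<And>j. lin (E j)"
    and CC: "\<And>i j v. C i (C j v) = - C j (C i v)"
    and EE: "\<And>i j v. E i (E j v) = - E j (E i v)"
    and EC: "\<And>i j v. E i (C j v) = (if i = j then v else 0) - C j (E i v)"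
    and C_w: "\<And>j. j < k \<Longrightarrow> C j w = 0" and E_w: "\<And>j. k \<le> j \<Longrightarrow> E j w = 0"
    and cyclic: "\<And>S. \<lbrakk>subspace S; w \<in> S; \<And>j v. v \<in> S \<Longrightarrow> C j v \<in> S; \<And>j v. v \<in> S \<Longrightarrow> E j v \<in> S\<rbrakk> \<Longrightarrow> S = UNIV"
begin

text \<open>Cutting both species at \<open>k\<close> leaves one creation and one annihilation
  operator for each mode, conjugate to each other. From here on it does not matter to which species
  a mode belongs.\<close>

definition cre :: "int \<Rightarrow> 'v \<Rightarrow> 'v" where "cre j = (if k \<le> j then C j else E j)"
definition ann :: "int \<Rightarrow> 'v \<Rightarrow> 'v" where "ann j = (if k \<le> j then E j else C j)"

lemma lin_cre: "lin (cre j)" and lin_ann: "lin (ann j)"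
  by (auto simp: cre_def ann_def lin_C lin_E)

lemma CE: "C j (E i v) = (if i = j then v else 0) - E i (C j v)"
  using EC[of i j v] by (simp add: algebra_simps)

lemma cre_cre: "cre i (cre j v) = - cre j (cre i v)"
  by (simp add: cre_def CC[of i j] EE[of i j] CE[of j i] CE[of i j])

lemma ann_cre: "ann i (cre j v) = (if i = j then v else 0) - cre j (ann i v)"
  by (simp add: cre_def ann_def CC[of i j] EE[of i j] EC[of i j] CE[of i j])

lemma ann_w: "ann j w = 0"
  by (simp add: ann_def C_w E_w)

lemma self_neg_zero: "v = - v \<Longrightarrow> v = 0" for v :: 'v
proof -
  assume "v = - v"
  then have "(2::complex) \<cdot> v = 0"
    by (metis add.commute add.right_inverse one_add_one scale_left_distrib scale_one)
  then show "v = 0" by simp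
qed

lemma cre_sq: "cre i (cre i v) = 0"
  by (rule self_neg_zero) (rule cre_cre)

text \<open>The exterior algebra on the modes in the list, applied to \<open>w\<close>. The
  recursive form \<open>a + cre j b\<close> replaces a choice of ordered basis: a repeated mode does
  no harm, and for a fresh \<open>j\<close> the part \<open>b\<close> is recovered by
  \<open>ann j\<close>.\<close>

fun mons :: "int list \<Rightarrow> 'v set" where
  "mons [] = {c \<cdot> w | c. True}"
| "mons (j # l) = {a + cre j b | a b. a \<in> mons l \<and> b \<in> mons l}"

declare mons.simps(2) [simp del]

lemma mons_ConsI: "a \<in> mons l \<Longrightarrow> b \<in> mons l \<Longrightarrow> v = a + cre j b \<Longrightarrow> v \<in> mons (j # l)"
  by (auto simp: mons.simps(2))

lemma mons_ConsE:
  assumes "v \<in> mons (j # l)"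
  obtains a b where "v = a + cre j b" "a \<in> mons l" "b \<in> mons l"
  using assms by (auto simp: mons.simps(2))

lemma subspace_mons: "subspace (mons l)"
proof (induction l)
  case Nil
  show ?case
  proof (rule subspaceI)
    show "0 \<in> mons []" by (auto intro!: exI[of _ 0])
    fix x y c assume "x \<in> mons []"
    then obtain a where a: "x = a \<cdot> w" by auto
    then show "c \<cdot> x \<in> mons []" by auto
    assume "y \<in> mons []"
    then obtain b where "y = b \<cdot> w" by auto
    with a have "x + y = (a + b) \<cdot> w" by (simp add: scale_left_distrib)
    then show "x + y \<in> mons []" by auto
  qed
next
  case (Cons j l)
  show ?case
  proof (rule subspaceI)
    show "0 \<in> mons (j # l)"
      using subspace_0[OF Cons.IH] by (auto intro: mons_ConsI simp: lin_zero[OF lin_cre])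
    fix x y c assume "x \<in> mons (j # l)"
    then obtain a b where a: "x = a + cre j b" "a \<in> mons l" "b \<in> mons l" by (rule mons_ConsE)
    then have "c \<cdot> x = c \<cdot> a + cre j (c \<cdot> b)"
      by (simp add: scale_right_distrib lin_scale[OF lin_cre])
    then show "c \<cdot> x \<in> mons (j # l)"
      using subspace_scale[OF Cons.IH] a by (auto intro: mons_ConsI)
    assume "y \<in> mons (j # l)"
    then obtain a' b' where a': "y = a' + cre j b'" "a' \<in> mons l" "b' \<in> mons l" by (rule mons_ConsE)
    with a have "x + y = (a + a') + cre j (b + b')" by (simp add: lin_add[OF lin_cre])
    then show "x + y \<in> mons (j # l)"
      using subspace_add[OF Cons.IH a(2) a'(2)] subspace_add[OF Cons.IH a(3) a'(3)] mons_ConsI by blast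
  qed
qed

lemma mons_Cons: "mons l \<subseteq> mons (j # l)"
  using subspace_0[OF subspace_mons[of l]] by (auto intro: mons_ConsI simp: lin_zero[OF lin_cre])

lemma mons_append2: "mons l \<subseteq> mons (l' @ l)"
proof (induction l')
  case (Cons a l')
  then show ?case using mons_Cons[of "l' @ l" a] by simp
qed simp

lemma mons_append1: "mons l \<subseteq> mons (l @ l')"
proof (induction l)
  case Nil
  then show ?case using mons_append2[of "[]" l'] by simp
next
  case (Cons a l)
  then show ?case by (auto elim!: mons_ConsE intro: mons_ConsI)
qed

lemma cre_mons: "v \<in> mons l \<Longrightarrow> cre j v \<in> mons (j # l)"
  using subspace_0[OF subspace_mons[of l]] by (auto intro: mons_ConsI)

text \<open>Anticommute \<open>cre j\<close> to its own place in the list, where its square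
  vanishes.\<close>

lemma cre_mem_mons: "j \<in> set l \<Longrightarrow> v \<in> mons l \<Longrightarrow> cre j v \<in> mons l"
proof (induction l arbitrary: v)
  case (Cons i l)
  obtain a b where v: "v = a + cre i b" "a \<in> mons l" "b \<in> mons l"
    using Cons.prems by (auto elim: mons_ConsE)
  show ?case
  proof (cases "i = j")
    case True
    then have "cre j v = 0 + cre i a" by (simp add: v lin_add[OF lin_cre] cre_sq)
    then show ?thesis using v subspace_0[OF subspace_mons[of l]] by (blast intro: mons_ConsI)
  next
    case False
    then have *: "cre j a \<in> mons l" "- cre j b \<in> mons l"
      using Cons v subspace_neg[OF subspace_mons] by auto
    have "cre j v = cre j a + cre i (- cre j b)"
      by (simp add: v lin_add[OF lin_cre] lin_neg[OF lin_cre] cre_cre[of i j])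
    then show ?thesis using * by (blast intro: mons_ConsI)
  qed
qed simp

lemma ann_mons: "v \<in> mons l \<Longrightarrow> ann i v \<in> mons l"
proof (induction l arbitrary: v)
  case Nil
  then show ?case using subspace_0[OF subspace_mons[of "[]"]] by (auto simp: lin_scale[OF lin_ann] ann_w)
next
  case (Cons j l)
  obtain a b where v: "v = a + cre j b" "a \<in> mons l" "b \<in> mons l"
    using Cons.prems by (rule mons_ConsE)
  have "ann i v = (ann i a + (if i = j then b else 0)) + cre j (- ann i b)"
    by (simp add: v lin_add[OF lin_ann] ann_cre lin_neg[OF lin_cre])
  moreover have "ann i a + (if i = j then b else 0) \<in> mons l" "- ann i b \<in> mons l"
    using Cons.IH v subspace_mons[of l] subspace_0 subspace_add subspace_neg by auto
  ultimately show ?case by (blast intro: mons_ConsI)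
qed

lemma ann_mons_zero: "i \<notin> set l \<Longrightarrow> v \<in> mons l \<Longrightarrow> ann i v = 0"
proof (induction l arbitrary: v)
  case Nil
  then show ?case by (auto simp: lin_scale[OF lin_ann] ann_w)
next
  case (Cons j l)
  obtain a b where v: "v = a + cre j b" "a \<in> mons l" "b \<in> mons l"
    using Cons.prems by (auto elim: mons_ConsE)
  have "ann i v = ann i a - cre j (ann i b)"
    using Cons.prems by (auto simp add: v lin_add[OF lin_ann] ann_cre)
  then show ?case using Cons v by (simp add: lin_zero[OF lin_cre])
qed

text \<open>The spaces \<open>mons l\<close> form a directed family under concatenation of lists, so
  their union is a subspace; it is stable under all modes, and \<open>w\<close> is cyclic.\<close>

lemma mons_exhaust: "\<exists>l. v \<in> mons l"
proof -
  let ?S = "\<Union>l. mons l"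
  have cr: "cre j u \<in> ?S" if "u \<in> ?S" for j u
    using that cre_mons by blast
  have an: "ann j u \<in> ?S" if "u \<in> ?S" for j u
    using that ann_mons by blast
  have "?S = UNIV"
  proof (rule cyclic)
    show "subspace ?S"
    proof (rule subspaceI)
      show "0 \<in> ?S" using subspace_0[OF subspace_mons] by auto
      show "x + y \<in> ?S" if "x \<in> ?S" "y \<in> ?S" for x y
      proof -
        from that obtain l l' where "x \<in> mons l" "y \<in> mons l'" by auto
        then have "x \<in> mons (l @ l')" "y \<in> mons (l @ l')"
          using mons_append1[of l l'] mons_append2[of l' l] by blast+
        then show ?thesis using subspace_add[OF subspace_mons] by blast
      qed
      show "c \<cdot> x \<in> ?S" if "x \<in> ?S" for c x
        using that subspace_scale[OF subspace_mons] by blast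
    qed
    have "w = 1 \<cdot> w" by simp
    then have "w \<in> mons []" by (simp del: scale_one) blast
    then show "w \<in> ?S" by blast
    show "C j v \<in> ?S" if "v \<in> ?S" for j v
      using cr[of v j] an[of v j] that by (cases "k \<le> j") (auto simp: cre_def ann_def)
    show "E j v \<in> ?S" if "v \<in> ?S" for j v
      using cr[of v j] an[of v j] that by (cases "k \<le> j") (auto simp: cre_def ann_def)
  qed
  then show ?thesis by blast
qed

text \<open>In \<open>a + cre j b\<close> neither \<open>a\<close> nor \<open>b\<close> contains the
  mode \<open>j\<close>, so \<open>ann j\<close> kills both and returns \<open>b\<close>. Stripping
  off modes in this way underlies both theorems that follow.\<close>

lemma mons_reduce:
  assumes "v \<in> mons (j # l)" and "j \<notin> set l"
  shows "ann j v \<in> mons l" and "ann j v = 0 \<Longrightarrow> v \<in> mons l"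
proof -
  obtain a b where v: "v = a + cre j b" "a \<in> mons l" "b \<in> mons l"
    using assms(1) by (rule mons_ConsE)
  have "ann j v = b"
    using assms v by (simp add: lin_add[OF lin_ann] ann_cre ann_mons_zero lin_zero[OF lin_cre])
  then show "ann j v \<in> mons l" "ann j v = 0 \<Longrightarrow> v \<in> mons l"
    using v by (auto simp: lin_zero[OF lin_cre])
qed

lemma mons_Cons_mem: "j \<in> set l \<Longrightarrow> mons (j # l) \<subseteq> mons l"
  using cre_mem_mons subspace_add[OF subspace_mons] by (auto elim!: mons_ConsE)

text \<open>A nonzero vector either does not involve the first mode of its list or stays nonzero
  after \<open>ann\<close> of that mode. Either way the list gets shorter, until a nonzero multiple
  of \<open>w\<close> is left.\<close>

theorem vacuum_mem:
  assumes S: "subspace S" and cl: "\<And>j v. v \<in> S \<Longrightarrow> C j v \<in> S" "\<And>j v. v \<in> S \<Longrightarrow> E j v \<in> S"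
    and v: "v \<in> S" "v \<noteq> 0"
  shows "w \<in> S"
proof -
  have an: "ann j u \<in> S" if "u \<in> S" for j u
    using cl that by (auto simp: ann_def)
  have "v \<in> mons l \<Longrightarrow> v \<in> S \<Longrightarrow> v \<noteq> 0 \<Longrightarrow> w \<in> S" for l v
  proof (induction l arbitrary: v)
    case Nil
    then obtain c where c: "v = c \<cdot> w" "c \<noteq> 0" by auto
    then have "w = inverse c \<cdot> v" by simp
    then show ?case using subspace_scale[OF S] Nil by metis
  next
    case (Cons j l)
    show ?case
    proof (cases "j \<in> set l")
      case True
      then show ?thesis using mons_Cons_mem Cons by blast
    next
      case False
      then show ?thesis using mons_reduce[OF Cons.prems(1)] Cons an by metis
    qed
  qed
  then show ?thesis using mons_exhaust v by blast
qed

text \<open>The same descent, with every \<open>ann j\<close> giving zero. It determines a vector up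
  to a multiple of \<open>w\<close> from the action of the annihilators alone.\<close>

theorem singular_vector:
  assumes "\<And>j. j < k \<Longrightarrow> C j v = 0" and "\<And>j. k \<le> j \<Longrightarrow> E j v = 0"
  shows "\<exists>c. v = c \<cdot> w"
proof -
  have an: "ann j v = 0" for j using assms by (simp add: ann_def)
  have "v \<in> mons l \<Longrightarrow> \<exists>c. v = c \<cdot> w" for l
  proof (induction l)
    case (Cons j l)
    then show ?case using mons_reduce mons_Cons_mem an by (cases "j \<in> set l") blast+
  qed auto
  then show ?thesis using mons_exhaust by blast
qed

end

text \<open>Mode form of first-order operators built from the derivative and
  \<open>x / z^2 + y / z\<close>. The parameters are abstract because the result is used again with
  the two species exchanged, which negates both.\<close>

locale fermions_vir = fermions scale C E k w
  for scale :: "complex \<Rightarrow> 'v :: ab_group_add \<Rightarrow> 'v" (infixr \<open>\<cdot>\<close> 75) and C E k w +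
  fixes L :: "int \<Rightarrow> 'v \<Rightarrow> 'v" and x y :: complex
  assumes lin_L: "\<And>m. lin (L m)"
    and LC: "\<And>m j v. L m (C j v) = C j (L m v) + x \<cdot> C (j + 1 - m) v + (of_int j + y) \<cdot> C (j - m) v"
    and LE: "\<And>m j v. L m (E j v) = E j (L m v) - x \<cdot> E (j + m - 1) v - (of_int (j + m) + y) \<cdot> E (j + m) v"
    and x_nz: "x \<noteq> 0"
begin

text \<open>The normally ordered bilinear by which \<open>L m\<close> acts on the vacuum, up to a
  scalar. The ranges keep exactly the terms in which both factors create: \<open>t < k\<close>, and
  the mode of \<open>C\<close> is at least \<open>k\<close>. They are empty for
  \<open>1 \<le> m\<close>.\<close>

definition quad :: "int \<Rightarrow> 'v" where
  "quad m = (\<Sum>t\<in>{k + m - 1..<k}. x \<cdot> C (t + 1 - m) (E t w))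
          + (\<Sum>t\<in>{k + m..<k}. (of_int t + y) \<cdot> C (t - m) (E t w))"

text \<open>The commutators of \<open>L m\<close> with the modes show that
  \<open>L m w - quad m\<close> is killed by every annihilation operator;
  \<open>singular_vector\<close> then leaves a scalar.\<close>

lemma L_w: "\<exists>c. L m w = c \<cdot> w + quad m"
proof -
  have "\<exists>c. L m w - quad m = c \<cdot> w"
  proof (rule singular_vector)
    fix s assume s: "s < k"
    have CCE: "C s (C i (E t w)) = (if s = t then - C i w else 0)" for i t
      using s by (simp add: CC[of s i] CE[of s t] C_w lin_zero lin_E lin_C)
    have "C s (L m w) = - (x \<cdot> C (s + 1 - m) w + (of_int s + y) \<cdot> C (s - m) w)"
      using LC[of m s w] s by (simp only: C_w lin_zero[OF lin_L] eq_neg_iff_add_eq_0 add.assoc)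
    moreover have "C s (quad m) = - (x \<cdot> C (s + 1 - m) w + (of_int s + y) \<cdot> C (s - m) w)"
      using s by (simp add: quad_def lin_simps[OF lin_C] CCE if_distrib[of "\<lambda>u. _ \<cdot> u"] C_w cong: if_cong)
    ultimately show "C s (L m w - quad m) = 0"
      by (simp add: lin_diff[OF lin_C])
  next
    fix s assume s: "k \<le> s"
    have ECE: "E s (C i (E t w)) = (if s = i then E t w else 0)" for i t
      using s by (simp add: EC[of s i] EE[of s t] E_w lin_zero lin_E lin_C)
    have ECE1: "E s (C (t + 1 - m) (E t w)) = (if t = s + m - 1 then E t w else 0)"
      and ECE2: "E s (C (t - m) (E t w)) = (if t = s + m then E t w else 0)" for t
      by (auto simp: ECE)
    have "E s (L m w) = x \<cdot> E (s + m - 1) w + (of_int (s + m) + y) \<cdot> E (s + m) w"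
      using LE[of m s w] s by (simp add: E_w lin_zero[OF lin_L] algebra_simps)
    moreover have "E s (quad m) = x \<cdot> E (s + m - 1) w + (of_int (s + m) + y) \<cdot> E (s + m) w"
      using s by (simp add: quad_def lin_simps[OF lin_E] ECE1 ECE2 if_distrib[of "\<lambda>u. _ \<cdot> u"] E_w cong: if_cong)
    ultimately show "E s (L m w - quad m) = 0"
      by (simp add: lin_diff[OF lin_E])
  qed
  then show ?thesis by (metis diff_add_cancel)
qed

text \<open>Reversing the order of summation exchanges the two factors, which anticommute.\<close>

lemma antisym_sum: "(\<Sum>l\<in>{0..N}. C (k + l) (C (k + (N - l)) v)) = 0"
proof (rule self_neg_zero)
  have "(\<Sum>l\<in>{0..N}. C (k + l) (C (k + (N - l)) v)) = (\<Sum>l\<in>{0..N}. C (k + (N - l)) (C (k + l) v))"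
    by (rule sum.reindex_bij_witness[of _ "\<lambda>l. N - l" "\<lambda>l. N - l"]) auto
  also have "\<dots> = (\<Sum>l\<in>{0..N}. - C (k + l) (C (k + (N - l)) v))"
    by (intro sum.cong refl CC)
  finally show "(\<Sum>l\<in>{0..N}. C (k + l) (C (k + (N - l)) v)) = - (\<Sum>l\<in>{0..N}. C (k + l) (C (k + (N - l)) v))"
    by (simp add: sum_negf)
qed

text \<open>With \<open>t\<close> as the outer index, the two \<open>C\<close>-modes of a term add
  up to \<open>k + t + j\<close> or \<open>k + t + j - 1\<close>, independently of \<open>l\<close>,
  and \<open>l\<close> runs over all ways to split this into two modes that are at least
  \<open>k\<close>. The coefficient depends on \<open>t\<close> only, so \<open>antisym_sum\<close>
  kills each inner sum.\<close>

lemma C_quad: "(\<Sum>l\<in>{0..<j}. C (k + l) (quad (1 - j + l))) = 0"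
proof -
  have 1: "(\<Sum>l\<in>{0..<j}. \<Sum>t\<in>{k + l - j..<k}. x \<cdot> C (k + l) (C (t + j - l) (E t w)))
      = (\<Sum>t\<in>{k - j..<k}. \<Sum>l\<in>{0..t - k + j}. x \<cdot> C (k + l) (C (t + j - l) (E t w)))"
  proof -
    have "(\<Sum>l\<in>{0..<j}. \<Sum>t\<in>{t \<in> {k - j..<k}. k + l - j \<le> t}. x \<cdot> C (k + l) (C (t + j - l) (E t w)))
        = (\<Sum>t\<in>{k - j..<k}. \<Sum>l\<in>{l \<in> {0..<j}. k + l - j \<le> t}. x \<cdot> C (k + l) (C (t + j - l) (E t w)))"
      by (rule sum.swap_restrict) auto
    also have "\<dots> = (\<Sum>t\<in>{k - j..<k}. \<Sum>l\<in>{0..t - k + j}. x \<cdot> C (k + l) (C (t + j - l) (E t w)))"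
      by (intro sum.cong refl) auto
    moreover have "(\<Sum>l\<in>{0..<j}. \<Sum>t\<in>{t \<in> {k - j..<k}. k + l - j \<le> t}. x \<cdot> C (k + l) (C (t + j - l) (E t w)))
      = (\<Sum>l\<in>{0..<j}. \<Sum>t\<in>{k + l - j..<k}. x \<cdot> C (k + l) (C (t + j - l) (E t w)))"
      by (intro sum.cong refl) auto
    ultimately show ?thesis by simp
  qed
  have 2: "(\<Sum>l\<in>{0..<j}. \<Sum>t\<in>{k + (1 - j + l)..<k}. (of_int t + y) \<cdot> C (k + l) (C (t - (1 - j + l)) (E t w)))
      = (\<Sum>t\<in>{k - j..<k}. \<Sum>l\<in>{0..t - k + j - 1}. (of_int t + y) \<cdot> C (k + l) (C (t - (1 - j + l)) (E t w)))"
  proof -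
    have "(\<Sum>l\<in>{0..<j}. \<Sum>t\<in>{t \<in> {k - j..<k}. k + l - j + 1 \<le> t}. (of_int t + y) \<cdot> C (k + l) (C (t - (1 - j + l)) (E t w)))
        = (\<Sum>t\<in>{k - j..<k}. \<Sum>l\<in>{l \<in> {0..<j}. k + l - j + 1 \<le> t}. (of_int t + y) \<cdot> C (k + l) (C (t - (1 - j + l)) (E t w)))"
      by (rule sum.swap_restrict) auto
    also have "\<dots> = (\<Sum>t\<in>{k - j..<k}. \<Sum>l\<in>{0..t - k + j - 1}. (of_int t + y) \<cdot> C (k + l) (C (t - (1 - j + l)) (E t w)))"
      by (intro sum.cong refl) auto
    moreover have "(\<Sum>l\<in>{0..<j}. \<Sum>t\<in>{t \<in> {k - j..<k}. k + l - j + 1 \<le> t}. (of_int t + y) \<cdot> C (k + l) (C (t - (1 - j + l)) (E t w)))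
      = (\<Sum>l\<in>{0..<j}. \<Sum>t\<in>{k + (1 - j + l)..<k}. (of_int t + y) \<cdot> C (k + l) (C (t - (1 - j + l)) (E t w)))"
      by (intro sum.cong refl) auto
    ultimately show ?thesis by simp
  qed
  have 3: "(\<Sum>l\<in>{0..t - k + j}. x \<cdot> C (k + l) (C (t + j - l) (E t w))) = 0" for t
    using antisym_sum[where N = "t - k + j" and v = "E t w"]
    by (simp add: scale_sum_right[symmetric] algebra_simps)
  have 4: "(\<Sum>l\<in>{0..t - k + j - 1}. (of_int t + y) \<cdot> C (k + l) (C (t - (1 - j + l)) (E t w))) = 0" for t
  proof -
    have "C (k + (t - k + j - 1 - l)) = C (t - (1 - j + l))" for l
      by (simp add: algebra_simps)
    then show ?thesis
      using antisym_sum[where N = "t - k + j - 1" and v = "E t w"]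
      by (simp add: scale_sum_right[symmetric])
  qed
  have "(\<Sum>l\<in>{0..<j}. C (k + l) (quad (1 - j + l)))
     = (\<Sum>l\<in>{0..<j}. \<Sum>t\<in>{k + l - j..<k}. x \<cdot> C (k + l) (C (t + j - l) (E t w)))
     + (\<Sum>l\<in>{0..<j}. \<Sum>t\<in>{k + (1 - j + l)..<k}. (of_int t + y) \<cdot> C (k + l) (C (t - (1 - j + l)) (E t w)))"
    by (simp add: quad_def lin_simps[OF lin_C] sum.distrib algebra_simps)
  then show ?thesis unfolding 1 2 by (simp add: 3 4)
qed

text \<open>Ordering \<open>L\<close> past \<open>C\<close> in \<open>\<Sum>l<j. L (1-j+l) C (k+l) w\<close> produces \<open>j x C (k+j) w\<close> and lower
  modes: the remaining terms, quadratic in \<open>C\<close>, cancel by antisymmetry.\<close>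

theorem C_w_mem:
  assumes U: "subspace U" and UL: "\<And>m v. v \<in> U \<Longrightarrow> L m v \<in> U" and Uk: "C k w \<in> U"
  shows "C j w \<in> U"
proof -
  have "C (k + int n) w \<in> U" for n
  proof (induction n rule: less_induct)
    case (less n)
    show ?case
    proof (cases "n = 0")
      case True
      then show ?thesis using Uk by simp
    next
      case False
      let ?j = "int n"
      have IH: "C (k + l) w \<in> U" if "0 \<le> l" "l < ?j" for l
        using less[of "nat l"] that by simp
      obtain c where c: "\<And>m. L m w = c m \<cdot> w + quad m"
        using L_w by metis
      have S: "(\<Sum>l\<in>{0..<?j}. L (1 - ?j + l) (C (k + l) w)) \<in> U"
        using IH UL by (intro subspace_sum[OF U]) auto
      \<comment> \<open>The index \<open>1 - j + l\<close> is chosen so that the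
        \<open>x\<close>-term of \<open>LC\<close> has the mode \<open>k + j\<close> for every
        \<open>l\<close>. The other linear term then has the mode \<open>k + j - 1\<close>, which
        the induction hypothesis covers.\<close>
      have "(\<Sum>l\<in>{0..<?j}. L (1 - ?j + l) (C (k + l) w))
        = (\<Sum>l\<in>{0..<?j}. c (1 - ?j + l) \<cdot> C (k + l) w + C (k + l) (quad (1 - ?j + l)) + x \<cdot> C (k + ?j) w
             + (of_int (k + l) + y) \<cdot> C (k + (?j - 1)) w)"
        by (intro sum.cong refl) (simp add: LC c lin_simps[OF lin_C] algebra_simps)
      also have "\<dots> = (\<Sum>l\<in>{0..<?j}. c (1 - ?j + l) \<cdot> C (k + l) w) + of_nat n \<cdot> x \<cdot> C (k + ?j) w
             + (\<Sum>l\<in>{0..<?j}. (of_int (k + l) + y) \<cdot> C (k + (?j - 1)) w)"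
        by (simp add: sum.distrib C_quad sum_constant_scale)
      finally have eq: "of_nat n \<cdot> x \<cdot> C (k + ?j) w = (\<Sum>l\<in>{0..<?j}. L (1 - ?j + l) (C (k + l) w))
         - (\<Sum>l\<in>{0..<?j}. c (1 - ?j + l) \<cdot> C (k + l) w)
         - (\<Sum>l\<in>{0..<?j}. (of_int (k + l) + y) \<cdot> C (k + (?j - 1)) w)"
        by (simp add: algebra_simps)
      have "of_nat n \<cdot> x \<cdot> C (k + ?j) w \<in> U"
        unfolding eq using IH False
        by (intro subspace_diff[OF U] S subspace_sum[OF U] subspace_scale[OF U]) auto
      moreover have "C (k + ?j) w = inverse (of_nat n * x) \<cdot> of_nat n \<cdot> x \<cdot> C (k + ?j) w"
        using False x_nz by (simp add: field_simps)
      ultimately show ?thesis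
        using subspace_scale[OF U] by metis
    qed
  qed
  from this[of "nat (j - k)"] show ?thesis
    using C_w[of j] subspace_0[OF U] by (cases "k \<le> j") auto
qed

end

text \<open>The monomial \<open>fls_X_intpow n\<close> is the series \<open>1\<close> shifted by
  \<open>- n\<close>, so these rules read off coefficients of products with monomials.\<close>

lemma fls_shift_one_mult_nth [simp]:
  "(fls_shift i 1 * f) $$ n = f $$ (n + i)" "(f * fls_shift i 1) $$ n = f $$ (n + i)"
  for f :: "complex fls"
  by (simp_all add: fls_shifted_times_simps)

lemma fps_mult_nth_reverse: "(f * g) $ n = (\<Sum>i\<le>n. f $ (n - i) * g $ i)"
  for f g :: "complex fps"
  using fps_mult_nth[of g f n] by (simp add: atLeast0AtMost mult.commute)

lemma fls_mult_low:
  fixes r p :: "complex fls"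
  assumes "\<And>n. n < a \<Longrightarrow> r $$ n = 0" and "\<And>n. n < b \<Longrightarrow> p $$ n = 0" and "n < a + b"
  shows "(r * p) $$ n = 0"
proof (cases "r = 0 \<or> p = 0")
  case False
  then have "a \<le> fls_subdegree r" "b \<le> fls_subdegree p"
    using assms by (meson linorder_not_less nth_fls_subdegree_nonzero)+
  then show ?thesis
    using assms False by (intro fls_eq0_below_subdegree) auto
qed auto

text \<open>Recursion on all earlier values, for functionals determined by them; it yields formal
  solutions of differential equations coefficient by coefficient.\<close>

lemma course_of_values_exists:
  fixes \<Phi> :: "nat \<Rightarrow> (nat \<Rightarrow> 'a) \<Rightarrow> 'a"
  assumes "\<And>n g h. (\<And>i. i < n \<Longrightarrow> g i = h i) \<Longrightarrow> \<Phi> n g = \<Phi> n h"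
  shows "\<exists>f. \<forall>n. f n = \<Phi> n f"
proof -
  define f where "f = wfrec less_than (\<lambda>g n. \<Phi> n g)"
  have "f n = \<Phi> n f" for n
  proof -
    have "f n = \<Phi> n (cut f less_than n)"
      unfolding f_def by (rule wfrec[OF wf_less_than])
    also have "\<dots> = \<Phi> n f"
      by (rule assms) (simp add: cut_apply)
    finally show ?thesis .
  qed
  then show ?thesis by blast
qed

section \<open>Horizontal sections\<close>

text \<open>Polar part of the eigenvalue of the connection. A formal gauge transformation removes
  the regular part, so that only \<open>\<xi>\<close> and \<open>\<epsilon>\<close> survive.\<close>

definition eta :: "complex \<Rightarrow> complex \<Rightarrow> complex fls" where
  "eta \<xi> \<epsilon> = fls_const \<xi> * fls_X_intpow (-2) + fls_const \<epsilon> * fls_X_intpow (-1)"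

lemma eta_mult_nth: "(eta \<xi> \<epsilon> * p) $$ n = \<xi> * p $$ (n + 2) + \<epsilon> * p $$ (n + 1)"
  by (simp add: eta_def distrib_right mult.assoc)

lemma eta_nth: "eta \<xi> \<epsilon> $$ n = (if n = -2 then \<xi> else if n = -1 then \<epsilon> else 0)"
  by (simp add: eta_def)

lemma eta_uminus: "eta (- \<xi>) (- \<epsilon>) = - eta \<xi> \<epsilon>"
  by (simp add: eta_def)

text \<open>The leading coefficient of the connection is invertible, so \<open>p \<mapsto> p' + \<eta> p\<close> is bijective on
  Laurent series, lowering the order by exactly two.\<close>

lemma eta_connection_solve:
  assumes "\<xi> \<noteq> 0"
  shows "\<exists>e. fls_deriv e + eta \<xi> \<epsilon> * e = fls_X_intpow j \<and> (\<forall>n<j + 2. e $$ n = 0)"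
proof -
  define x :: "nat \<Rightarrow> complex" where
    "x = rec_nat (1 / \<xi>) (\<lambda>t r. - (of_int (j + int t + 2) + \<epsilon>) / \<xi> * r)"
  have x0: "x 0 = 1 / \<xi>" and xS: "x (Suc t) = - (of_int (j + int t + 2) + \<epsilon>) / \<xi> * x t" for t
    by (simp_all add: x_def)
  define e where "e = Abs_fls (\<lambda>n. if n < j + 2 then 0 else x (nat (n - j - 2)))"
  have e: "e $$ n = (if n < j + 2 then 0 else x (nat (n - j - 2)))" for n
    unfolding e_def by (rule nth_Abs_fls_lower_bound[of "j + 2"]) auto
  have "(fls_deriv e + eta \<xi> \<epsilon> * e) $$ n = fls_X_intpow j $$ n" for n
  proof (cases "n \<le> j")
    case True
    then show ?thesis using assms by (auto simp: eta_mult_nth e x0)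
  next
    case False
    define t where "t = nat (n - j - 1)"
    have t: "n = j + int t + 1" using False by (simp add: t_def)
    have "nat (n + 2 - j - 2) = Suc t" "nat (n + 1 - j - 2) = t" by (simp_all add: t)
    then show ?thesis using assms by (simp add: distrib_left eta_mult_nth e t xS) (simp add: field_simps)
  qed
  then have "fls_deriv e + eta \<xi> \<epsilon> * e = fls_X_intpow j" by (intro fls_eqI)
  then show ?thesis using e by auto
qed

text \<open>The horizontality equations multiplied by \<open>z\<close> and \<open>z^2\<close>, which
  clears their poles. In degree \<open>n\<close> the second equation gives \<open>2 \<xi>\<close>
  times the coefficient of \<open>f2\<close> from earlier coefficients, and then the first gives
  \<open>n\<close> times that of \<open>f1\<close>. Hence \<open>f2\<close> comes first in the
  recursion, and the constant term of \<open>f1\<close> is a normalization.\<close>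

lemma horizontal_fps_exists:
  fixes a0 b1 g1 :: "complex fps"
  assumes "\<xi> \<noteq> 0"
  shows "\<exists>f1 f2. f1 $ 0 = 1 \<and> f2 $ 0 = 0
    \<and> fps_X * fps_deriv f1 + fps_X * a0 * f1 + b1 * f2 = 0
    \<and> fps_X ^ 2 * fps_deriv f2 - fps_X * g1 * f1
        - (fps_const (2 * \<xi>) + fps_const (2 * \<epsilon>) * fps_X + fps_X ^ 2 * a0) * f2 = 0"
proof -
  define \<Phi>2 :: "nat \<Rightarrow> (nat \<Rightarrow> complex \<times> complex) \<Rightarrow> complex" where "\<Phi>2 n f = (if n = 0 then 0 else
    ((of_nat (n - 1) - 2 * \<epsilon>) * snd (f (n - 1)) - (\<Sum>i\<le>n - 1. g1 $ (n - 1 - i) * fst (f i))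
     - (if n = 1 then 0 else (\<Sum>i\<le>n - 2. a0 $ (n - 2 - i) * snd (f i)))) / (2 * \<xi>))" for n f
  define \<Phi>1 :: "nat \<Rightarrow> (nat \<Rightarrow> complex \<times> complex) \<Rightarrow> complex" where "\<Phi>1 n f = (if n = 0 then 1 else
    - ((\<Sum>i\<le>n - 1. a0 $ (n - 1 - i) * fst (f i)) + (\<Sum>i<n. b1 $ (n - i) * snd (f i)) + b1 $ 0 * \<Phi>2 n f) / of_nat n)" for n f
  have "\<exists>f. \<forall>n. f n = (\<Phi>1 n f, \<Phi>2 n f)"
  proof (rule course_of_values_exists)
    fix n :: nat and g h :: "nat \<Rightarrow> complex \<times> complex"
    assume gh: "\<And>i. i < n \<Longrightarrow> g i = h i"
    have 2: "\<Phi>2 n g = \<Phi>2 n h"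
      unfolding \<Phi>2_def using gh by (auto intro!: arg_cong2[where f = "(-)"] sum.cong arg_cong2[where f = "(/)"])
    moreover have "\<Phi>1 n g = \<Phi>1 n h"
      unfolding \<Phi>1_def using gh 2 by (auto intro!: arg_cong2[where f = "(+)"] sum.cong arg_cong2[where f = "(/)"])
    ultimately show "(\<Phi>1 n g, \<Phi>2 n g) = (\<Phi>1 n h, \<Phi>2 n h)" by simp
  qed
  then obtain f where f: "\<And>n. f n = (\<Phi>1 n f, \<Phi>2 n f)" by blast
  have f1: "fst (f n) = \<Phi>1 n f" and f2: "snd (f n) = \<Phi>2 n f" for n
    using f[of n] by (metis fst_conv, metis snd_conv)
  define F1 where "F1 = Abs_fps (\<lambda>n. fst (f n))"
  define F2 where "F2 = Abs_fps (\<lambda>n. snd (f n))"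
  have F2_0: "F2 $ 0 = 0" by (simp add: F2_def f2 \<Phi>2_def)
  have "(fps_X * fps_deriv F1 + fps_X * a0 * F1 + b1 * F2) $ n = 0" for n
  proof (cases n)
    case 0
    then show ?thesis by (simp add: F2_0 mult.assoc)
  next
    case (Suc m)
    have "(b1 * F2) $ n = (\<Sum>i\<le>n. b1 $ (n - i) * snd (f i))"
      by (simp add: fps_mult_nth_reverse F2_def)
    also have "\<dots> = (\<Sum>i<n. b1 $ (n - i) * snd (f i)) + b1 $ 0 * \<Phi>2 n f"
      using f2 by (simp add: lessThan_Suc_atMost[symmetric])
    finally have 1: "(b1 * F2) $ n = \<dots>" .
    have 2: "(fps_X * a0 * F1) $ n = (\<Sum>i\<le>m. a0 $ (m - i) * fst (f i))"
      by (simp add: Suc mult.assoc) (simp add: fps_mult_nth_reverse F1_def)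
    have 3: "(fps_X * fps_deriv F1) $ n = of_nat n * \<Phi>1 n f"
      by (simp add: Suc F1_def f1)
    show ?thesis
      unfolding fps_add_nth 1 2 3 using of_nat_neq_0[where ?'a = complex, of m]
      by (simp add: \<Phi>1_def Suc)
  qed
  moreover have "(fps_X ^ 2 * fps_deriv F2 - fps_X * g1 * F1
        - (fps_const (2 * \<xi>) + fps_const (2 * \<epsilon>) * fps_X + fps_X ^ 2 * a0) * F2) $ n = 0" for n
  proof (cases n)
    case 0
    then show ?thesis by (simp add: F2_0 mult.assoc distrib_right power2_eq_square)
  next
    case (Suc m)
    have 1: "(fps_X ^ 2 * fps_deriv F2) $ n = of_nat m * snd (f m)"
      by (cases m) (simp_all add: Suc power2_eq_square mult.assoc F2_def)
    have 2: "(fps_X * g1 * F1) $ n = (\<Sum>i\<le>m. g1 $ (m - i) * fst (f i))"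
      by (simp add: Suc mult.assoc) (simp add: fps_mult_nth_reverse F1_def)
    have 3: "(fps_X ^ 2 * a0 * F2) $ n = (if n = 1 then 0 else (\<Sum>i\<le>n - 2. a0 $ (n - 2 - i) * snd (f i)))"
    proof (cases m)
      case 0
      then show ?thesis by (simp add: Suc power2_eq_square mult.assoc)
    next
      case (Suc l)
      have "(a0 * F2) $ l = (\<Sum>i\<le>l. a0 $ (l - i) * snd (f i))"
        by (simp add: fps_mult_nth_reverse F2_def)
      then show ?thesis by (simp add: Suc \<open>n = Suc m\<close> power2_eq_square mult.assoc)
    qed
    have 4: "(fps_const (2 * \<epsilon>) * fps_X * F2) $ n = 2 * \<epsilon> * snd (f m)"
      by (simp add: Suc mult.assoc F2_def)
    have 5: "(fps_const (2 * \<xi>) * F2) $ n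
        = (of_nat m - 2 * \<epsilon>) * snd (f m) - (\<Sum>i\<le>m. g1 $ (m - i) * fst (f i))
          - (if n = 1 then 0 else (\<Sum>i\<le>n - 2. a0 $ (n - 2 - i) * snd (f i)))"
      using assms by (simp add: F2_def f2[of n]) (simp add: \<Phi>2_def Suc)
    show ?thesis
      unfolding distrib_right fps_add_nth fps_sub_nth 1 2 3 4 5
      by (simp add: algebra_simps)
  qed
  moreover have "F1 $ 0 = 1" by (simp add: F1_def f1 \<Phi>1_def)
  ultimately show ?thesis using F2_0 by (metis fps_eq_iff fps_zero_nth)
qed

lemma fls_regular_fps:
  fixes f :: "complex fls"
  assumes "\<And>n. n < 0 \<Longrightarrow> f $$ n = 0"
  shows "fps_to_fls (fls_regpart f) = f"
  using assms by (intro fls_eqI) (auto simp: not_less)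

text \<open>An eigenline of the connection: the coefficients of \<open>f1\<close> and \<open>f2\<close> are determined recursively,
  those of \<open>f2\<close> because the eigenvalues of the leading term differ by \<open>2 \<xi>\<close>.\<close>

lemma horizontal_section_exists:
  fixes al be ga :: "complex fls"
  assumes "\<xi> \<noteq> 0"
    and al: "\<And>n. n < -2 \<Longrightarrow> al $$ n = 0" "al $$ (-2) = \<xi>" "al $$ (-1) = \<epsilon>"
    and be: "\<And>n. n < -1 \<Longrightarrow> be $$ n = 0" and ga: "\<And>n. n < -1 \<Longrightarrow> ga $$ n = 0"
  shows "\<exists>f1 f2. fls_deriv f1 + al * f1 + be * f2 = eta \<xi> \<epsilon> * f1
    \<and> fls_deriv f2 - ga * f1 - al * f2 = eta \<xi> \<epsilon> * f2
    \<and> (\<forall>n<0. f1 $$ n = 0) \<and> f1 $$ 0 = 1 \<and> (\<forall>n\<le>0. f2 $$ n = 0)"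
proof -
  define a0 where "a0 = fls_regpart (al - eta \<xi> \<epsilon>)"
  define b1 where "b1 = fls_regpart (fls_X * be)"
  define g1 where "g1 = fls_regpart (fls_X * ga)"
  have a0: "fps_to_fls a0 = al - eta \<xi> \<epsilon>"
    unfolding a0_def
  proof (rule fls_regular_fps)
    fix n :: int assume "n < 0"
    then consider "n < -2" | "n = -2" | "n = -1" by linarith
    then show "(al - eta \<xi> \<epsilon>) $$ n = 0"
      by cases (use al in \<open>auto simp: eta_nth\<close>)
  qed
  have b1: "fps_to_fls b1 = fls_X * be" unfolding b1_def
    by (rule fls_regular_fps) (auto simp: fls_X_times_conv_shift be)
  have g1: "fps_to_fls g1 = fls_X * ga" unfolding g1_def
    by (rule fls_regular_fps) (auto simp: fls_X_times_conv_shift ga)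
  obtain f1 f2 where f: "f1 $ 0 = 1" "f2 $ 0 = 0"
    "fps_X * fps_deriv f1 + fps_X * a0 * f1 + b1 * f2 = 0"
    "fps_X ^ 2 * fps_deriv f2 - fps_X * g1 * f1
        - (fps_const (2 * \<xi>) + fps_const (2 * \<epsilon>) * fps_X + fps_X ^ 2 * a0) * f2 = 0"
    using horizontal_fps_exists[OF assms(1), of a0 b1 g1 \<epsilon>] by blast
  define h1 where "h1 = fps_to_fls f1"
  define h2 where "h2 = fps_to_fls f2"
  have "fls_X * (fls_deriv h1 + (al - eta \<xi> \<epsilon>) * h1 + be * h2) = 0"
    using arg_cong[OF f(3), of fps_to_fls]
    by (simp add: fps_to_fls_plus fls_times_fps_to_fls a0 b1 h1_def h2_def fls_deriv_fps_to_fls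
        distrib_left mult.assoc)
  then have "fls_deriv h1 + (al - eta \<xi> \<epsilon>) * h1 + be * h2 = 0"
    by simp
  then have 1: "fls_deriv h1 + al * h1 + be * h2 = eta \<xi> \<epsilon> * h1"
    by (simp add: algebra_simps)
  have eta2: "fls_X ^ 2 * eta \<xi> \<epsilon> = fls_const \<xi> + fls_const \<epsilon> * fls_X"
  proof (rule fls_eqI)
    fix n
    have "(fls_X ^ 2 * eta \<xi> \<epsilon>) $$ n = eta \<xi> \<epsilon> $$ (n - 2)"
      by (simp add: fls_X_power_times_conv_shift)
    then show "(fls_X ^ 2 * eta \<xi> \<epsilon>) $$ n = (fls_const \<xi> + fls_const \<epsilon> * fls_X) $$ n"
      by (simp add: eta_nth)
  qed
  have "fls_X ^ 2 * fls_deriv h2 - fls_X * (fls_X * ga) * h1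
        - (fls_const (2 * \<xi>) + fls_const (2 * \<epsilon>) * fls_X + fls_X ^ 2 * (al - eta \<xi> \<epsilon>)) * h2 = 0"
    using arg_cong[OF f(4), of fps_to_fls]
    by (simp add: fps_to_fls_plus fls_times_fps_to_fls fps_to_fls_minus a0 g1 h1_def h2_def
        fls_deriv_fps_to_fls fps_to_fls_power)
  moreover have "fls_const (2 * \<xi>) + fls_const (2 * \<epsilon>) * fls_X = 2 * (fls_X ^ 2 * eta \<xi> \<epsilon>)"
    unfolding eta2 by (simp add: algebra_simps flip: fls_const_mult_const)
  ultimately have "fls_X ^ 2 * fls_deriv h2 - fls_X * (fls_X * ga) * h1
        - (2 * (fls_X ^ 2 * eta \<xi> \<epsilon>) + fls_X ^ 2 * (al - eta \<xi> \<epsilon>)) * h2 = 0"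
    by simp
  then have "fls_X ^ 2 * (fls_deriv h2 - ga * h1 - al * h2 - eta \<xi> \<epsilon> * h2) = 0"
    by (simp add: algebra_simps power2_eq_square)
  then have "fls_deriv h2 - ga * h1 - al * h2 - eta \<xi> \<epsilon> * h2 = 0"
    by simp
  then have 2: "fls_deriv h2 - ga * h1 - al * h2 = eta \<xi> \<epsilon> * h2"
    by (simp add: algebra_simps)
  have "(\<forall>n<0. h1 $$ n = 0) \<and> h1 $$ 0 = 1 \<and> (\<forall>n\<le>0. h2 $$ n = 0)"
    using f by (auto simp: h1_def h2_def order_le_less)
  with 1 2 show ?thesis by blast
qed

section \<open>Fields\<close>

context complex_space
begin

text \<open>Linear maps on Laurent series that are continuous for the adic topology on the source and the
  discrete topology on the target.\<close>

definition cont :: "(complex fls \<Rightarrow> 'v) \<Rightarrow> bool" where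
  "cont G \<longleftrightarrow> (\<forall>p q. G (p + q) = G p + G q) \<and> (\<forall>c p. G (fls_const c * p) = c \<cdot> G p)
    \<and> (\<exists>K. \<forall>p. (\<forall>n<K. p $$ n = 0) \<longrightarrow> G p = 0)"

lemma contI:
  assumes "\<And>p q. G (p + q) = G p + G q" and "\<And>c p. G (fls_const c * p) = c \<cdot> G p"
    and "\<And>p. (\<And>n. n < K \<Longrightarrow> p $$ n = 0) \<Longrightarrow> G p = 0"
  shows "cont G"
  using assms unfolding cont_def by blast

lemma contD:
  assumes "cont G"
  shows "G (p + q) = G p + G q" and "G (fls_const c * p) = c \<cdot> G p"
    and "\<exists>K. \<forall>p. (\<forall>n<K. p $$ n = 0) \<longrightarrow> G p = 0"
  using assms unfolding cont_def by blast+

text \<open>Continuity annihilates all terms of order at least \<open>K\<close>, so only the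
  finitely many coefficients between \<open>d\<close> and \<open>K\<close> count, and they are split
  off one monomial at a time. Identities between fields can thus be checked on monomials.\<close>

lemma cont_mem:
  assumes G: "cont G" and U: "subspace U" and X: "\<And>n. d \<le> n \<Longrightarrow> G (fls_X_intpow n) \<in> U"
    and p: "\<And>n. n < d \<Longrightarrow> p $$ n = 0"
  shows "G p \<in> U"
proof -
  obtain K where K: "\<And>p. (\<And>n. n < K \<Longrightarrow> p $$ n = 0) \<Longrightarrow> G p = 0"
    using contD(3)[OF G] by blast
  have "(\<forall>n<max d (K - int N). p $$ n = 0) \<Longrightarrow> G p \<in> U" for N p
  proof (induction N arbitrary: p)
    case 0
    then show ?case using K[of p] subspace_0[OF U] by simp
  next
    case (Suc N)
    define j where "j = K - int (Suc N)"
    define r where "r = p - fls_const (p $$ j) * fls_X_intpow j"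
    have "G r \<in> U"
    proof (rule Suc.IH, intro allI impI)
      fix n assume "n < max d (K - int N)"
      then show "r $$ n = 0"
        using Suc.prems by (cases "n = j") (auto simp: r_def j_def)
    qed
    moreover have "p = r + fls_const (p $$ j) * fls_X_intpow j" by (simp add: r_def)
    moreover have "(p $$ j) \<cdot> G (fls_X_intpow j) \<in> U"
    proof (cases "d \<le> j")
      case False
      then have "p $$ j = 0" using Suc.prems by auto
      then show ?thesis using subspace_0[OF U] by simp
    qed (use X subspace_scale[OF U] in blast)
    ultimately show ?case
      by (metis contD(1,2)[OF G] subspace_add[OF U])
  qed
  from this[of "nat (K - d)" p] show ?thesis using p by simp
qed

lemma cont_mem': "cont G \<Longrightarrow> subspace U \<Longrightarrow> (\<And>n. G (fls_X_intpow n) \<in> U) \<Longrightarrow> G p \<in> U"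
  by (rule cont_mem[where d = "fls_subdegree p"]) auto

lemma cont_eq_0: "cont G \<Longrightarrow> (\<And>n. G (fls_X_intpow n) = 0) \<Longrightarrow> G p = 0"
  using cont_mem'[of G "{0}" p] by auto

lemma cont_add: "cont G \<Longrightarrow> cont H \<Longrightarrow> cont (\<lambda>p. G p + H p)"
proof -
  assume G: "cont G" and H: "cont H"
  obtain K where K: "\<And>p. (\<And>n. n < K \<Longrightarrow> p $$ n = 0) \<Longrightarrow> G p = 0"
    using contD(3)[OF G] by blast
  obtain K' where K': "\<And>p. (\<And>n. n < K' \<Longrightarrow> p $$ n = 0) \<Longrightarrow> H p = 0"
    using contD(3)[OF H] by blast
  show ?thesis
  proof (rule contI[where K = "max K K'"])
    show "G p + H p = 0" if "\<And>n. n < max K K' \<Longrightarrow> p $$ n = 0" for p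
      using K[of p] K'[of p] that by simp
  qed (simp_all only: contD(1,2)[OF G] contD(1,2)[OF H] scale_right_distrib add_ac)
qed

lemma cont_lin: "lin T \<Longrightarrow> cont G \<Longrightarrow> cont (\<lambda>p. T (G p))"
proof -
  assume T: "lin T" and G: "cont G"
  obtain K where K: "\<And>p. (\<And>n. n < K \<Longrightarrow> p $$ n = 0) \<Longrightarrow> G p = 0"
    using contD(3)[OF G] by blast
  show ?thesis
    by (rule contI[where K = K]) (simp_all add: contD(1,2)[OF G] lin_simps[OF T] K)
qed

lemma cont_uminus: "cont G \<Longrightarrow> cont (\<lambda>p. - G p)"
  by (rule cont_lin[of uminus]) (auto intro: linI)

lemma cont_diff: "cont G \<Longrightarrow> cont H \<Longrightarrow> cont (\<lambda>p. G p - H p)"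
  using cont_add[OF _ cont_uminus, of G H] by simp

lemma cont_eq:
  assumes "cont G" "cont H" "\<And>n. G (fls_X_intpow n) = H (fls_X_intpow n)"
  shows "G p = H p"
  using cont_eq_0[OF cont_diff[OF assms(1,2)]] assms(3) by simp

lemma cont_mult: "cont G \<Longrightarrow> cont (\<lambda>p. G (r * p))"
proof -
  assume G: "cont G"
  obtain K where K: "\<And>p. (\<And>n. n < K \<Longrightarrow> p $$ n = 0) \<Longrightarrow> G p = 0"
    using contD(3)[OF G] by blast
  show ?thesis
  proof (rule contI[where K = "K - fls_subdegree r"])
    show "G (r * p) = 0" if "\<And>n. n < K - fls_subdegree r \<Longrightarrow> p $$ n = 0" for p
      by (rule K, rule fls_mult_low[where a = "fls_subdegree r" and b = "K - fls_subdegree r"])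
        (use that in auto)
  qed (simp_all add: distrib_left contD(1)[OF G] contD(2)[OF G, symmetric] mult.left_commute)
qed

lemma cont_deriv: "cont G \<Longrightarrow> cont (\<lambda>p. G (fls_deriv p))"
proof -
  assume G: "cont G"
  obtain K where K: "\<And>p. (\<And>n. n < K \<Longrightarrow> p $$ n = 0) \<Longrightarrow> G p = 0"
    using contD(3)[OF G] by blast
  show ?thesis
    by (rule contI[where K = "K + 1"])
      (simp_all add: contD(1)[OF G] contD(2)[OF G, symmetric] K)
qed

lemma cont_nth: "cont (\<lambda>p. (p $$ n) \<cdot> v)"
  by (rule contI[where K = "n + 1"]) (simp_all add: scale_left_distrib)

end

section \<open>Clifford modules and their fields\<close>

locale clifford_module = complex_space scale
  for scale :: "complex \<Rightarrow> 'v :: ab_group_add \<Rightarrow> 'v" (infixr \<open>\<cdot>\<close> 75) +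
  fixes psi :: "sign \<Rightarrow> int \<Rightarrow> 'v \<Rightarrow> 'v" and Cf :: "int \<Rightarrow> sign \<Rightarrow> sign \<Rightarrow> complex"
    and vac :: 'v and \<xi> \<epsilon> :: complex
  assumes lin_psi: "\<And>a n. lin (psi a n)"
    and psi_psi: "\<And>a m b n v. psi a m (psi b n v) + psi b n (psi a m v)
          = ((if m + n = 0 then of_int m * symp a b else 0) + Cf (m + n) a b) \<cdot> v"
    and Cf_sym: "\<And>k a b. Cf k a b = Cf k b a"
    and Cf_high: "\<And>k a b. 1 < k \<Longrightarrow> Cf k a b = 0"
    and Cf_1: "Cf 1 Plus Minus = \<xi>" "Cf 1 Plus Plus = 0" "Cf 1 Minus Minus = 0"
    and Cf_0: "Cf 0 Plus Minus = \<epsilon>"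
    and xi_nz: "\<xi> \<noteq> 0"
    and psi_vac: "\<And>a n. 1 \<le> n \<Longrightarrow> psi a n vac = 0"
    and vac_nz: "vac \<noteq> 0"
    and psi_cyclic: "\<And>S. \<lbrakk>subspace S; vac \<in> S; \<And>a n v. v \<in> S \<Longrightarrow> psi a n v \<in> S\<rbrakk> \<Longrightarrow> S = UNIV"
begin

definition pair :: "sign \<Rightarrow> int \<Rightarrow> sign \<Rightarrow> int \<Rightarrow> complex" where
  "pair a m b n = (if m + n = 0 then of_int m * symp a b else 0) + Cf (m + n) a b"

lemma symp_flip: "symp a b = - symp b a"
  by (cases a; cases b) simp_all

lemma pair_sym: "pair a m b n = pair b n a m"
proof -
  have "of_int m * symp a b = of_int n * symp b a" if "m + n = 0"
  proof -
    have "n = - m" using that by simp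
    then show ?thesis using symp_flip[of a b] by simp
  qed
  then show ?thesis
    unfolding pair_def Cf_sym[of _ a b] add.commute[of n m] by simp
qed

lemma psi_swap: "psi a m (psi b n v) = pair a m b n \<cdot> v - psi b n (psi a m v)"
  using psi_psi[of a m b n v] unfolding pair_def by (simp only: eq_diff_eq)

lemma pair_high: "1 < m + n \<Longrightarrow> pair a m b n = 0"
  by (simp add: pair_def Cf_high)

text \<open>The set of such vectors is stable under each \<open>psi b m\<close>, since modes of
  total degree above 1 have zero pairing. The bound makes the sums that define the fields and the
  Virasoro operators finite.\<close>

lemma smooth: "\<exists>K. \<forall>a n. K \<le> n \<longrightarrow> psi a n v = 0"
proof -
  let ?S = "{v. \<exists>K. \<forall>a n. K \<le> n \<longrightarrow> psi a n v = 0}"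
  have "?S = UNIV"
  proof (rule psi_cyclic)
    show "subspace ?S"
    proof (rule subspaceI)
      show "0 \<in> ?S" by (simp add: lin_simps[OF lin_psi])
      show "c \<cdot> x \<in> ?S" if "x \<in> ?S" for c x
        using that by (auto simp: lin_simps[OF lin_psi])
      show "x + y \<in> ?S" if "x \<in> ?S" "y \<in> ?S" for x y
      proof -
        from that obtain K K' where "\<forall>a n. K \<le> n \<longrightarrow> psi a n x = 0" "\<forall>a n. K' \<le> n \<longrightarrow> psi a n y = 0"
          by auto
        then have "\<forall>a n. max K K' \<le> n \<longrightarrow> psi a n (x + y) = 0"
          by (simp add: lin_simps[OF lin_psi])
        then show ?thesis by blast
      qed
    qed
    show "vac \<in> ?S" using psi_vac by blast
    show "psi b m u \<in> ?S" if "u \<in> ?S" for b m u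
    proof -
      from that obtain K where "\<forall>a n. K \<le> n \<longrightarrow> psi a n u = 0" by auto
      then have "\<forall>a n. max K (2 - m) \<le> n \<longrightarrow> psi a n (psi b m u) = 0"
        by (simp add: psi_swap[of _ _ b m] pair_high lin_simps[OF lin_psi])
      then show ?thesis by blast
    qed
  qed
  then show ?thesis by blast
qed

lemma smooth2: "\<exists>K. (\<forall>a n. K \<le> n \<longrightarrow> psi a n v = 0) \<and> (\<forall>a n. K \<le> n \<longrightarrow> psi a n u = 0)"
proof -
  obtain K K' where "\<forall>a n. K \<le> n \<longrightarrow> psi a n v = 0" "\<forall>a n. K' \<le> n \<longrightarrow> psi a n u = 0"
    using smooth by meson
  then show ?thesis by (intro exI[of _ "max K K'"]) auto
qed

text \<open>The residue of \<open>p(z) \<psi>(z)\<close> for the field \<open>\<psi>(z) = \<Sum>n. psi a n z^(-n-1)\<close>.\<close>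

definition S :: "sign \<Rightarrow> complex fls \<Rightarrow> 'v \<Rightarrow> 'v" where
  "S a p v = Sum_any (\<lambda>n. (p $$ n) \<cdot> psi a n v)"

lemma S_eq:
  assumes K: "\<And>n. K \<le> n \<Longrightarrow> psi a n v = 0" and d: "\<And>n. n < d \<Longrightarrow> p $$ n = 0"
  shows "S a p v = (\<Sum>n\<in>{d..<K}. (p $$ n) \<cdot> psi a n v)"
  unfolding S_def
proof (rule Sum_any.expand_superset)
  show "{n. (p $$ n) \<cdot> psi a n v \<noteq> 0} \<subseteq> {d..<K}"
  proof
    fix n assume "n \<in> {n. (p $$ n) \<cdot> psi a n v \<noteq> 0}"
    then have "p $$ n \<noteq> 0" "psi a n v \<noteq> 0" by auto
    then show "n \<in> {d..<K}"
      using K[of n] d[of n] by (metis atLeastLessThan_iff linorder_not_le)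
  qed
qed simp

lemma lin_S: "lin (S a p)"
proof (rule linI)
  fix x y c
  obtain K where K: "\<And>n. K \<le> n \<Longrightarrow> psi a n x = 0" "\<And>n. K \<le> n \<Longrightarrow> psi a n y = 0"
    using smooth2[of x y] by blast
  have *: "S a p v = (\<Sum>n\<in>{fls_subdegree p..<K}. (p $$ n) \<cdot> psi a n v)"
    if "\<And>n. K \<le> n \<Longrightarrow> psi a n v = 0" for v
    using S_eq[of K a v "fls_subdegree p" p] that by simp
  have x: "S a p x = (\<Sum>n\<in>{fls_subdegree p..<K}. (p $$ n) \<cdot> psi a n x)"
    and y: "S a p y = (\<Sum>n\<in>{fls_subdegree p..<K}. (p $$ n) \<cdot> psi a n y)"
    and xy: "S a p (x + y) = (\<Sum>n\<in>{fls_subdegree p..<K}. (p $$ n) \<cdot> psi a n (x + y))"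
    and cx: "S a p (c \<cdot> x) = (\<Sum>n\<in>{fls_subdegree p..<K}. (p $$ n) \<cdot> psi a n (c \<cdot> x))"
    by (rule *, simp add: K lin_simps[OF lin_psi])+
  show "S a p (x + y) = S a p x + S a p y"
    unfolding x y xy by (simp add: lin_add[OF lin_psi] sum.distrib scale_right_distrib)
  show "S a p (c \<cdot> x) = c \<cdot> S a p x"
    unfolding x cx by (simp add: lin_scale[OF lin_psi] scale_sum_right mult.commute)
qed

lemma cont_S: "cont (\<lambda>p. S a p v)"
proof -
  obtain K where K: "\<And>n. K \<le> n \<Longrightarrow> psi a n v = 0"
    using smooth[of v] by blast
  show ?thesis
  proof (rule contI[where K = K])
    fix p q :: "complex fls" and c
    define d where "d = min (fls_subdegree p) (fls_subdegree q)"
    have *: "S a r v = (\<Sum>n\<in>{d..<K}. (r $$ n) \<cdot> psi a n v)" if "\<And>n. n < d \<Longrightarrow> r $$ n = 0" for r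
      using K that by (rule S_eq)
    have p: "S a p v = (\<Sum>n\<in>{d..<K}. (p $$ n) \<cdot> psi a n v)"
      and q: "S a q v = (\<Sum>n\<in>{d..<K}. (q $$ n) \<cdot> psi a n v)"
      and pq: "S a (p + q) v = (\<Sum>n\<in>{d..<K}. ((p + q) $$ n) \<cdot> psi a n v)"
      and cp: "S a (fls_const c * p) v = (\<Sum>n\<in>{d..<K}. ((fls_const c * p) $$ n) \<cdot> psi a n v)"
      by (rule *, simp add: d_def)+
    show "S a (p + q) v = S a p v + S a q v"
      unfolding p q pq by (simp add: sum.distrib scale_left_distrib)
    show "S a (fls_const c * p) v = c \<cdot> S a p v"
      unfolding p cp by (simp add: scale_sum_right)
  next
    show "S a p v = 0" if "\<And>n. n < K \<Longrightarrow> p $$ n = 0" for p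
      using S_eq[of K a v K p] K that by simp
  qed
qed

lemmas S_add = contD(1)[OF cont_S] and S_const = contD(2)[OF cont_S]

lemma S_zero: "S a 0 v = 0"
  by (simp add: S_def)

lemma S_uminus: "S a (- p) v = - S a p v"
  by (metis S_add S_zero add.right_inverse add_eq_0_iff)

lemma S_diff: "S a (p - q) v = S a p v - S a q v"
  by (metis S_add S_uminus add_uminus_conv_diff)

lemma S_X: "S a (fls_X_intpow n) v = psi a n v"
proof -
  have "S a (fls_X_intpow n) v = (\<Sum>i\<in>{n}. (fls_X_intpow n $$ i) \<cdot> psi a i v)"
    unfolding S_def by (rule Sum_any.expand_superset) auto
  then show ?thesis by simp
qed

text \<open>Entry of the matrix series \<open>C(z)\<close>, whose coefficient at
  \<open>z^(-k-1)\<close> is \<open>C_k\<close>; its pole has order at most 2.\<close>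

definition cs :: "sign \<Rightarrow> sign \<Rightarrow> complex fls" where
  "cs a b = Abs_fls (\<lambda>n. Cf (- n - 1) a b)"

lemma cs_nth: "cs a b $$ n = Cf (- n - 1) a b"
  unfolding cs_def by (rule nth_Abs_fls_lower_bound[of "-2"]) (simp add: Cf_high)

lemma cs_sym: "cs a b = cs b a"
  by (simp add: cs_def Cf_sym[of _ a b])

text \<open>The symplectic form applied to a covariant derivative, arranged so that the residue
  against a second series is the anticommutator of the two integrated fields.\<close>

definition nab :: "sign \<Rightarrow> sign \<Rightarrow> complex fls \<Rightarrow> complex fls" where
  "nab a b p = fls_const (symp a b) * fls_deriv p + cs a b * p"

lemma nab_X_nth: "nab a b (fls_X_intpow m) $$ n = pair a m b (- n - 1)"
  by (auto simp: nab_def pair_def cs_nth algebra_simps)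

text \<open>Both sides are continuous in \<open>p\<close> and in \<open>q\<close>, so the relations
  between single modes extend first to all \<open>q\<close> and then to all
  \<open>p\<close>.\<close>

lemma S_S: "S a p (S b q v) + S b q (S a p v) = ((nab a b p * q) $$ (-1)) \<cdot> v"
proof -
  have *: "psi a m (S b q v) + S b q (psi a m v) = ((nab a b (fls_X_intpow m) * q) $$ (-1)) \<cdot> v" for m q
  proof (rule cont_eq[of "\<lambda>q. psi a m (S b q v) + S b q (psi a m v)" "\<lambda>q. ((nab a b (fls_X_intpow m) * q) $$ (-1)) \<cdot> v"])
    show "cont (\<lambda>q. psi a m (S b q v) + S b q (psi a m v))"
      by (intro cont_add cont_lin[OF lin_psi] cont_S)
    show "cont (\<lambda>q. ((nab a b (fls_X_intpow m) * q) $$ (-1)) \<cdot> v)"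
      by (rule cont_mult[OF cont_nth])
    show "psi a m (S b (fls_X_intpow n) v) + S b (fls_X_intpow n) (psi a m v) =
         ((nab a b (fls_X_intpow m) * fls_X_intpow n) $$ (-1)) \<cdot> v" for n
      using psi_psi[of a m b n v] unfolding S_X by (simp add: nab_X_nth pair_def)
  qed
  show ?thesis
  proof (rule cont_eq[of "\<lambda>p. S a p (S b q v) + S b q (S a p v)" "\<lambda>p. ((nab a b p * q) $$ (-1)) \<cdot> v"])
    show "cont (\<lambda>p. S a p (S b q v) + S b q (S a p v))"
      by (intro cont_add cont_lin[OF lin_S] cont_S)
    have "cont (\<lambda>p. ((q * (fls_const (symp a b) * fls_deriv p)) $$ (-1)) \<cdot> v + ((q * (cs a b * p)) $$ (-1)) \<cdot> v)"
      by (intro cont_add cont_mult[where r = q and G = "\<lambda>p. (p $$ (-1)) \<cdot> v", THEN cont_mult, THEN cont_deriv]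
           cont_mult[where r = q and G = "\<lambda>p. (p $$ (-1)) \<cdot> v", THEN cont_mult] cont_nth)
    then show "cont (\<lambda>p. ((nab a b p * q) $$ (-1)) \<cdot> v)"
      by (simp add: nab_def algebra_simps flip: scale_left_distrib)
    show "S a (fls_X_intpow m) (S b q v) + S b q (S a (fls_X_intpow m) v) =
         ((nab a b (fls_X_intpow m) * q) $$ (-1)) \<cdot> v" for m
      unfolding S_X by (rule *)
  qed
qed

end

section \<open>Residues, and pairs of conjugate fields\<close>

lemma fls_residue_by_parts: "(fls_deriv p * q) $$ (-1) = - ((p * fls_deriv q) $$ (-1))"
  for p q :: "complex fls"
proof -
  have "fls_deriv (p * q) $$ (-1) = 0" by (rule fls_deriv_residue)
  then show ?thesis by (simp add: add_eq_0_iff2 algebra_simps)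
qed

lemma eta_connection_inj:
  assumes "\<xi> \<noteq> 0" and "fls_deriv p + eta \<xi> \<epsilon> * p = 0"
  shows "p = 0"
proof (rule ccontr)
  assume "p \<noteq> 0"
  let ?d = "fls_subdegree p"
  have "(fls_deriv p + eta \<xi> \<epsilon> * p) $$ (?d - 2) = \<xi> * p $$ ?d"
    by (simp add: eta_mult_nth)
  then show False using assms \<open>p \<noteq> 0\<close> by simp
qed

text \<open>A pair of fields \<open>b\<close>, \<open>c\<close> (integrated against Laurent series) that are horizontal for the
  diagonal connections \<open>d + \<eta>\<close> and \<open>d - \<eta>\<close>.\<close>

locale dual_fields = complex_space scale
  for scale :: "complex \<Rightarrow> 'v :: ab_group_add \<Rightarrow> 'v" (infixr \<open>\<cdot>\<close> 75) +
  fixes b c :: "complex fls \<Rightarrow> 'v \<Rightarrow> 'v" and L :: "int \<Rightarrow> 'v \<Rightarrow> 'v" and \<xi> \<epsilon> :: complex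
  assumes cont_b: "\<And>v. cont (\<lambda>p. b p v)" and cont_c: "\<And>v. cont (\<lambda>q. c q v)"
    and lin_b: "\<And>p. lin (b p)" and lin_c: "\<And>q. lin (c q)" and lin_L: "\<And>m. lin (L m)"
    and bb: "\<And>p q v. b p (b q v) = - b q (b p v)"
    and cc: "\<And>p q v. c p (c q v) = - c q (c p v)"
    and bc: "\<And>p q v. b p (c q v) = (((fls_deriv p + eta \<xi> \<epsilon> * p) * q) $$ (-1)) \<cdot> v - c q (b p v)"
    and Lb: "\<And>m p v. L m (b p v) = b p (L m v) - b (fls_X_intpow (m + 1) * (fls_deriv p + eta \<xi> \<epsilon> * p)) v"
    and Lc: "\<And>m q v. L m (c q v) = c q (L m v) - c (fls_X_intpow (m + 1) * (fls_deriv q - eta \<xi> \<epsilon> * q)) v"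
    and xi_nz: "\<xi> \<noteq> 0"
begin

text \<open>Integration by parts makes \<open>- (d - \<eta>)\<close> the residue adjoint of
  \<open>d + \<eta>\<close>; the sign is absorbed into \<open>b\<close>. Every statement about
  \<open>c\<close> thereby has a counterpart for \<open>b\<close>.\<close>

lemma swap: "dual_fields scale c (\<lambda>p v. - b p v) L (- \<xi>) (- \<epsilon>)"
proof unfold_locales
  show "cont (\<lambda>q. c q v)" "lin (c q)" "lin (L m)" "c p (c q v) = - c q (c p v)" for v q p m
    by (rule cont_c lin_c lin_L cc)+
  show "cont (\<lambda>p. - b p v)" for v by (rule cont_uminus[OF cont_b])
  show "lin (\<lambda>v. - b q v)" for q by (auto intro!: linI simp: lin_simps[OF lin_b])
  show "- b p (- b q v) = - (- b q (- b p v))" for p q v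
    using bb[of p q v] by (simp add: lin_simps[OF lin_b])
  show "- \<xi> \<noteq> 0" using xi_nz by simp
  show "L m (- b q v) = - b q (L m v) - (- b (fls_X_intpow (m + 1) * (fls_deriv q - eta (- \<xi>) (- \<epsilon>) * q)) v)" for m q v
    by (simp add: lin_simps[OF lin_L] Lb eta_uminus)
  show "L m (c p v) = c p (L m v) - c (fls_X_intpow (m + 1) * (fls_deriv p + eta (- \<xi>) (- \<epsilon>) * p)) v" for m p v
    by (simp add: Lc eta_uminus)
  show "c p (- b q v) = (((fls_deriv p + eta (- \<xi>) (- \<epsilon>) * p) * q) $$ (-1)) \<cdot> v - (- b q (c p v))" for p q v
  proof -
    have "((fls_deriv q + eta \<xi> \<epsilon> * q) * p) $$ (-1) = - (((fls_deriv p - eta \<xi> \<epsilon> * p) * q) $$ (-1))"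
      using fls_residue_by_parts[of q p] by (simp add: algebra_simps)
    with bc[of q p v] have "b q (c p v) = - ((((fls_deriv p - eta \<xi> \<epsilon> * p) * q) $$ (-1)) \<cdot> v) - c p (b q v)"
      by simp
    then show ?thesis
      by (simp add: lin_simps[OF lin_c] eta_uminus)
  qed
qed

text \<open>Chosen so that \<open>E i\<close> is conjugate to \<open>C j\<close>: the residue of
  \<open>z^(i-1) z^(-j)\<close> is 1 for \<open>i = j\<close> and 0 otherwise. The order
  \<open>j + 1\<close> is two above that of \<open>z^(j-1)\<close>, by the double pole of
  \<open>\<eta>\<close>.\<close>

definition e :: "int \<Rightarrow> complex fls" where
  "e j = (SOME f. fls_deriv f + eta \<xi> \<epsilon> * f = fls_X_intpow (j - 1) \<and> (\<forall>n<j + 1. f $$ n = 0))"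

lemma e: "fls_deriv (e j) + eta \<xi> \<epsilon> * e j = fls_X_intpow (j - 1)" "n < j + 1 \<Longrightarrow> e j $$ n = 0"
proof -
  have eq: "j - 1 + 2 = j + 1" by simp
  have "\<exists>f. fls_deriv f + eta \<xi> \<epsilon> * f = fls_X_intpow (j - 1) \<and> (\<forall>n<j + 1. f $$ n = 0)"
    using eta_connection_solve[OF xi_nz, of \<epsilon> "j - 1"] unfolding eq .
  from someI_ex[OF this] have "fls_deriv (e j) + eta \<xi> \<epsilon> * e j = fls_X_intpow (j - 1) \<and> (\<forall>n<j + 1. e j $$ n = 0)"
    unfolding e_def .
  then show "fls_deriv (e j) + eta \<xi> \<epsilon> * e j = fls_X_intpow (j - 1)" "n < j + 1 \<Longrightarrow> e j $$ n = 0"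
    by blast+
qed

definition C :: "int \<Rightarrow> 'v \<Rightarrow> 'v" where "C j = c (fls_X_intpow (- j))"
definition E :: "int \<Rightarrow> 'v \<Rightarrow> 'v" where "E j = b (e j)"

lemma b_lincomb: "b (fls_const s * p + fls_const t * q) v = s \<cdot> b p v + t \<cdot> b q v"
  and c_lincomb: "c (fls_const s * p + fls_const t * q) v = s \<cdot> c p v + t \<cdot> c q v"
  by (simp_all only: contD(1,2)[OF cont_b] contD(1,2)[OF cont_c])

text \<open>Both sides have the image \<open>\<xi> z^(n-2) + (n + \<epsilon>) z^(n-1)\<close> under
  the injective operator \<open>d + \<eta>\<close>. So the modes of \<open>b\<close> are triangular
  combinations of the \<open>E\<close>.\<close>

lemma X_eq_e: "fls_X_intpow n = fls_const \<xi> * e (n - 1) + fls_const (of_int n + \<epsilon>) * e n"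
proof -
  let ?p = "fls_X_intpow n - (fls_const \<xi> * e (n - 1) + fls_const (of_int n + \<epsilon>) * e n) :: complex fls"
  have "fls_deriv ?p + eta \<xi> \<epsilon> * ?p = (fls_deriv (fls_X_intpow n) + eta \<xi> \<epsilon> * fls_X_intpow n)
     - (fls_const \<xi> * (fls_deriv (e (n - 1)) + eta \<xi> \<epsilon> * e (n - 1))
        + fls_const (of_int n + \<epsilon>) * (fls_deriv (e n) + eta \<xi> \<epsilon> * e n))"
    by (simp add: fls_deriv_mult_const_left algebra_simps)
  also have "\<dots> = 0"
    unfolding e by (rule fls_eqI) (auto simp: eta_nth algebra_simps)
  finally have "?p = 0" by (rule eta_connection_inj[OF xi_nz])
  then show ?thesis by simp
qed

lemma b_X: "b (fls_X_intpow n) v = \<xi> \<cdot> E (n - 1) v + (of_int n + \<epsilon>) \<cdot> E n v"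
  by (subst X_eq_e) (simp only: b_lincomb E_def)

lemma EC: "E i (C j v) = (if i = j then v else 0) - C j (E i v)"
  unfolding E_def C_def bc e by simp

lemma LC: "L m (C j v) = C j (L m v) + \<xi> \<cdot> C (j + 1 - m) v + (of_int j + \<epsilon>) \<cdot> C (j - m) v"
proof -
  have "fls_X_intpow (m + 1) * (fls_deriv (fls_X_intpow (- j)) - eta \<xi> \<epsilon> * fls_X_intpow (- j))
      = fls_const (- \<xi>) * fls_X_intpow (- (j + 1 - m)) + fls_const (- (of_int j + \<epsilon>)) * fls_X_intpow (- (j - m))"
    by (rule fls_eqI) (auto simp: eta_nth algebra_simps)
  then show ?thesis
    unfolding C_def Lc by (simp only: c_lincomb scale_minus_left) simp
qed

lemma LE: "L m (E j v) = E j (L m v) - \<xi> \<cdot> E (j + m - 1) v - (of_int (j + m) + \<epsilon>) \<cdot> E (j + m) v"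
proof -
  have "fls_X_intpow (m + 1) * fls_X_intpow (j - 1) = (fls_X_intpow (j + m) :: complex fls)"
    by (rule fls_eqI) auto
  then show ?thesis
    using b_X[of "j + m" v] unfolding E_def Lb e by (simp add: algebra_simps)
qed

definition vacuum :: "int \<Rightarrow> 'v \<Rightarrow> bool" where
  "vacuum k w \<longleftrightarrow> fermions scale C E k w"

lemma vacuumI:
  assumes "\<And>j. j < k \<Longrightarrow> C j w = 0" and "\<And>j. k \<le> j \<Longrightarrow> E j w = 0"
    and "\<And>S. \<lbrakk>subspace S; w \<in> S; \<And>j v. v \<in> S \<Longrightarrow> C j v \<in> S; \<And>j v. v \<in> S \<Longrightarrow> E j v \<in> S\<rbrakk> \<Longrightarrow> S = UNIV"
  shows "vacuum k w"
  unfolding vacuum_def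
proof unfold_locales
  show "lin (C j)" "lin (E j)" for j by (simp_all add: C_def E_def lin_b lin_c)
  show "C i (C j v) = - C j (C i v)" "E i (E j v) = - E j (E i v)" for i j v
    unfolding C_def E_def by (rule cc bb)+
qed (fact EC assms)+

lemma vacuum_vir: "vacuum k w \<Longrightarrow> fermions_vir scale C E k w L \<xi> \<epsilon>"
  unfolding vacuum_def fermions_vir_def fermions_vir_axioms_def
  using lin_L LC LE xi_nz by auto

lemma lin_C: "lin (C j)" and lin_E: "lin (E j)"
  by (simp_all add: C_def E_def lin_b lin_c)

text \<open>Filling the mode \<open>k\<close> makes \<open>C k\<close> an annihilator, since its
  square vanishes; \<open>E k\<close> undoes the step, which also gives cyclicity.\<close>

lemma vacuum_up:
  assumes "vacuum k w"
  shows "vacuum (k + 1) (C k w)" "E k (C k w) = w"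
proof -
  interpret f: fermions scale C E k w using assms by (simp add: vacuum_def)
  show *: "E k (C k w) = w" using f.E_w by (simp add: EC lin_simps[OF lin_C])
  show "vacuum (k + 1) (C k w)"
  proof (rule vacuumI)
    show "C j (C k w) = 0" if "j < k + 1" for j
      using that f.CC[of j k w] f.C_w[of j] f.self_neg_zero
      by (cases "j = k") (auto simp: lin_simps[OF lin_C])
    show "E j (C k w) = 0" if "k + 1 \<le> j" for j
      using that f.E_w[of j] by (simp add: EC lin_simps[OF lin_C])
    show "S = UNIV" if "subspace S" "C k w \<in> S" "\<And>j v. v \<in> S \<Longrightarrow> C j v \<in> S" "\<And>j v. v \<in> S \<Longrightarrow> E j v \<in> S" for S
      using f.cyclic[OF that(1) _ that(3,4)] that(4)[OF that(2), of k] * by simp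
  qed
qed

lemma vacuum_down:
  assumes "vacuum (k + 1) w"
  shows "vacuum k (E k w)" "C k (E k w) = w"
proof -
  interpret f: fermions scale C E "k + 1" w using assms by (simp add: vacuum_def)
  show *: "C k (E k w) = w" using f.C_w by (simp add: f.CE lin_simps[OF lin_E])
  show "vacuum k (E k w)"
  proof (rule vacuumI)
    show "E j (E k w) = 0" if "k \<le> j" for j
      using that f.EE[of j k w] f.E_w[of j] f.self_neg_zero
      by (cases "j = k") (auto simp: lin_simps[OF lin_E])
    show "C j (E k w) = 0" if "j < k" for j
      using that f.C_w[of j] by (simp add: f.CE lin_simps[OF lin_E])
    show "S = UNIV" if "subspace S" "E k w \<in> S" "\<And>j v. v \<in> S \<Longrightarrow> C j v \<in> S" "\<And>j v. v \<in> S \<Longrightarrow> E j v \<in> S" for S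
      using f.cyclic[OF that(1) _ that(3,4)] that(3)[OF that(2), of k] * by simp
  qed
qed

lemma c_low:
  assumes "vacuum k w" "\<And>n. n < 1 - k \<Longrightarrow> q $$ n = 0"
  shows "c q w = 0"
proof -
  interpret f: fermions scale C E k w using assms by (simp add: vacuum_def)
  have "c q w \<in> {0}"
  proof (rule cont_mem[OF cont_c _ _ assms(2)])
    show "c (fls_X_intpow n) w \<in> {0}" if "1 - k \<le> n" for n
      using f.C_w[of "- n"] that by (simp add: C_def)
  qed simp_all
  then show ?thesis by simp
qed

lemma c_mem:
  assumes "vacuum k w" and U: "subspace U" "\<And>m v. v \<in> U \<Longrightarrow> L m v \<in> U" and "C k w \<in> U"
  shows "c q w \<in> U"
proof (rule cont_mem'[OF cont_c U(1)])
  interpret f: fermions_vir scale C E k w L \<xi> \<epsilon> using assms(1) by (rule vacuum_vir)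
  show "c (fls_X_intpow n) w \<in> U" for n
    using f.C_w_mem[OF U assms(4), of "- n"] by (simp add: C_def)
qed

text \<open>On a vacuum of charge \<open>k\<close>, \<open>b (z^n)\<close> gives zero as soon as
  \<open>n > k\<close>, and \<open>c q\<close> does if \<open>q\<close> has order at least
  \<open>1 - k\<close>. In the numbering of the swapped modes both bounds say that the charge is
  \<open>- k\<close>.\<close>

lemma swapped_vacuum:
  assumes "vacuum k w"
  shows "dual_fields.vacuum scale c (\<lambda>p v. - b p v) (- \<xi>) (- \<epsilon>) (- k) w"
proof -
  interpret s: dual_fields scale c "\<lambda>p v. - b p v" L "- \<xi>" "- \<epsilon>" by (rule swap)
  interpret f: fermions scale C E k w using assms by (simp add: vacuum_def)
  show ?thesis
  proof (rule s.vacuumI)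
    show "s.C j w = 0" if "j < - k" for j
    proof -
      have "E (- j - 1) w = 0" "E (- j) w = 0"
        using f.E_w that by simp_all
      then show ?thesis
        by (simp only: s.C_def b_X scale_zero_right add_0_left minus_zero)
    qed
    show "s.E j w = 0" if j: "- k \<le> j" for j
      unfolding s.E_def
    proof (rule c_low[OF assms])
      fix n assume "n < 1 - k"
      with j have "n < j + 1" by linarith
      then show "s.e j $$ n = 0" by (rule s.e(2))
    qed
    fix S assume S: "subspace S" "w \<in> S" "\<And>j v. v \<in> S \<Longrightarrow> s.C j v \<in> S" "\<And>j v. v \<in> S \<Longrightarrow> s.E j v \<in> S"
    show "S = UNIV"
    proof (rule f.cyclic[OF S(1,2)])
      show "C j v \<in> S" if "v \<in> S" for j v
        unfolding C_def s.b_X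
        by (intro subspace_add[OF S(1)] subspace_scale[OF S(1)] S(4)[OF that])
      have b: "b (fls_X_intpow n) v \<in> S" if "v \<in> S" for n v
        using subspace_neg[OF S(1) S(3)[OF that, of "- n"]] by (simp only: s.C_def minus_minus)
      show "E j v \<in> S" if "v \<in> S" for j v
        unfolding E_def using b[OF that] by (rule cont_mem'[OF cont_b S(1)])
    qed
  qed
qed

text \<open>This is \<open>c_mem\<close> for the swapped pair. Its first creation mode takes the
  vacuum to \<open>- \<xi> E (k - 1) w\<close>, because the second term of \<open>b_X\<close>
  vanishes there.\<close>

lemma b_mem:
  assumes "vacuum k w" and U: "subspace U" "\<And>m v. v \<in> U \<Longrightarrow> L m v \<in> U" and "E (k - 1) w \<in> U"
  shows "b p w \<in> U"
proof -
  interpret s: dual_fields scale c "\<lambda>p v. - b p v" L "- \<xi>" "- \<epsilon>" by (rule swap)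
  interpret f: fermions scale C E k w using assms by (simp add: vacuum_def)
  have "s.C (- k) w = - (\<xi> \<cdot> E (k - 1) w)"
    by (simp only: s.C_def minus_minus b_X) (simp add: f.E_w)
  then have "s.C (- k) w \<in> U"
    using subspace_neg[OF U(1) subspace_scale[OF U(1) assms(4)]] by simp
  from s.c_mem[OF swapped_vacuum[OF assms(1)] U this, of p] show ?thesis
    using subspace_neg[OF U(1), of "- b p w"] by simp
qed

end

section \<open>Virasoro operators and their commutators with the fields\<close>

context clifford_module
begin

definition nop :: "int \<Rightarrow> int \<Rightarrow> 'v \<Rightarrow> 'v" where
  "nop i j v = (if i < j then psi Minus i (psi Plus j v)
     else if j < i then - psi Plus j (psi Minus i v)
     else (1 / 2) \<cdot> (psi Minus i (psi Plus j v) - psi Plus j (psi Minus i v)))"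

definition vc :: "int \<Rightarrow> complex" where
  "vc n = 1 / 2 * Sum_any (\<lambda>i. Cf i Minus Plus * Cf (n - i) Plus Minus
     - Cf i Plus Plus * Cf (n - i) Minus Minus)"

definition Vir :: "int \<Rightarrow> 'v \<Rightarrow> 'v" where
  "Vir n v = Sum_any (\<lambda>i. nop i (n - i) v) + vc n \<cdot> v"

text \<open>Coefficient of the contraction that normal ordering subtracts from the product with
  \<open>psi Minus\<close> on the left.\<close>

definition theta :: "int \<Rightarrow> int \<Rightarrow> complex" where
  "theta i j = (if i < j then 0 else if j < i then 1 else 1 / 2)"

lemma nop_eq: "nop i j v = psi Minus i (psi Plus j v) - (theta i j * pair Minus i Plus j) \<cdot> v"
proof -
  have *: "psi Plus j (psi Minus i v) = pair Minus i Plus j \<cdot> v - psi Minus i (psi Plus j v)" for i j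
    using psi_swap[of Plus j Minus i v] pair_sym by simp
  have "(1/2::complex) \<cdot> (x - (y - x)) = x - (1/2) \<cdot> y" for x y :: 'v
  proof -
    have "x - (y - x) = (2::complex) \<cdot> x - y"
      by (metis (no_types, lifting) diff_diff_eq2 one_add_one scale_left_distrib scale_one)
    then have "(1/2::complex) \<cdot> (x - (y - x)) = (1/2::complex) \<cdot> (2::complex) \<cdot> x - (1/2::complex) \<cdot> y"
      by (simp only: scale_right_diff_distrib)
    then show ?thesis by simp
  qed
  then show ?thesis by (simp add: nop_def theta_def *)
qed

lemma lin_nop: "lin (nop i j)"
  unfolding nop_eq by (auto intro!: linI simp: lin_simps[OF lin_psi] algebra_simps)

lemma nop_zero:
  assumes "\<And>a n. K \<le> n \<Longrightarrow> psi a n v = 0" and "K \<le> i \<or> K \<le> j"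
  shows "nop i j v = 0"
  using assms by (auto simp: nop_def lin_simps[OF lin_psi])

lemma Vir_eq:
  assumes "\<And>a n. K \<le> n \<Longrightarrow> psi a n v = 0"
  shows "Vir n v = (\<Sum>i\<in>{n - K<..<K}. nop i (n - i) v) + vc n \<cdot> v"
proof -
  have "Sum_any (\<lambda>i. nop i (n - i) v) = (\<Sum>i\<in>{n - K<..<K}. nop i (n - i) v)"
  proof (rule Sum_any.expand_superset)
    show "{i. nop i (n - i) v \<noteq> 0} \<subseteq> {n - K<..<K}"
    proof
      fix i assume "i \<in> {i. nop i (n - i) v \<noteq> 0}"
      then show "i \<in> {n - K<..<K}"
        using nop_zero[of K v i "n - i"] assms by force
    qed
  qed simp
  then show ?thesis by (simp add: Vir_def)
qed

lemma lin_Vir: "lin (Vir n)"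
proof (rule linI)
  fix x y c
  obtain K where K: "\<And>a n. K \<le> n \<Longrightarrow> psi a n x = 0" "\<And>a n. K \<le> n \<Longrightarrow> psi a n y = 0"
    using smooth2[of x y] by blast
  have xy: "Vir n (x + y) = (\<Sum>i\<in>{n - K<..<K}. nop i (n - i) (x + y)) + vc n \<cdot> (x + y)"
    and cx: "Vir n (c \<cdot> x) = (\<Sum>i\<in>{n - K<..<K}. nop i (n - i) (c \<cdot> x)) + vc n \<cdot> (c \<cdot> x)"
    by (rule Vir_eq, simp add: K lin_simps[OF lin_psi])+
  show "Vir n (x + y) = Vir n x + Vir n y"
    unfolding xy Vir_eq[of K x, OF K(1), simplified] Vir_eq[of K y, OF K(2), simplified]
    by (simp add: lin_add[OF lin_nop] sum.distrib scale_right_distrib)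
  show "Vir n (c \<cdot> x) = c \<cdot> Vir n x"
    unfolding cx Vir_eq[of K x, OF K(1), simplified]
    by (simp add: lin_scale[OF lin_nop] scale_right_distrib scale_sum_right mult.commute)
qed

lemma nop_psi: "nop i j (psi a n v) = psi a n (nop i j v)
    + (pair a n Plus j \<cdot> psi Minus i v - pair a n Minus i \<cdot> psi Plus j v)"
proof -
  have "psi Minus i (psi Plus j (psi a n v))
      = pair a n Plus j \<cdot> psi Minus i v - psi Minus i (psi a n (psi Plus j v))"
    using psi_swap[of Plus j a n v] pair_sym[of a n Plus j] by (simp add: lin_simps[OF lin_psi])
  also have "psi Minus i (psi a n (psi Plus j v)) = pair a n Minus i \<cdot> psi Plus j v - psi a n (psi Minus i (psi Plus j v))"
    using psi_swap[of Minus i a n "psi Plus j v"] pair_sym[of a n Minus i] by simp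
  finally show ?thesis
    by (simp add: nop_eq lin_simps[OF lin_psi])
qed

text \<open>The scalars of normal ordering drop out of the commutator, and the contractions of
  \<open>psi a n\<close> with either factor of the bilinear remain. Over all \<open>i\<close> their
  coefficients are those of \<open>z^(m+1)\<close> times \<open>nab\<close>.\<close>

lemma Vir_psi: "Vir m (psi a n v) = psi a n (Vir m v)
    + (S Minus (fls_X_intpow (m + 1) * nab a Plus (fls_X_intpow n)) v
       - S Plus (fls_X_intpow (m + 1) * nab a Minus (fls_X_intpow n)) v)"
proof -
  obtain K0 where K0: "\<And>a n. K0 \<le> n \<Longrightarrow> psi a n v = 0"
      "\<And>b k. K0 \<le> k \<Longrightarrow> psi b k (psi a n v) = 0"
    using smooth2[of v "psi a n v"] by blast
  \<comment> \<open>By \<open>pair_high\<close>, the bound \<open>2 - n\<close> makes the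
    coefficients of the series vanish below the common range of summation.\<close>
  define K where "K = max K0 (2 - n)"
  have K: "psi b k v = 0" "psi b k (psi a n v) = 0" if "K \<le> k" for b k
    using K0 that by (auto simp: K_def)
  have coeff: "(fls_X_intpow (m + 1) * nab a b (fls_X_intpow n)) $$ i = pair a n b (m - i)" for b i
    by (simp add: nab_X_nth)
  have Ssum: "S b (fls_X_intpow (m + 1) * nab a b' (fls_X_intpow n)) v = (\<Sum>i\<in>{m - K + 1..<K}. pair a n b' (m - i) \<cdot> psi b i v)" for b b'
  proof (subst S_eq[where K = K and d = "m - K + 1"])
    show "(fls_X_intpow (m + 1) * nab a b' (fls_X_intpow n)) $$ i = 0" if "i < m - K + 1" for i
      unfolding coeff by (rule pair_high) (use that in \<open>auto simp: K_def\<close>)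
  qed (auto simp: K simp del: fls_shift_one_mult_nth simp flip: coeff)
  have I: "{m - K<..<K} = {m - K + 1..<K}" by auto
  have "Vir m (psi a n v) - psi a n (Vir m v)
     = (\<Sum>i\<in>{m - K + 1..<K}. nop i (m - i) (psi a n v) - psi a n (nop i (m - i) v))"
    unfolding Vir_eq[of K v, OF K(1), simplified] Vir_eq[of K "psi a n v", OF K(2), simplified] I by (simp add: lin_simps[OF lin_psi] sum_subtractf)
  also have "\<dots> = (\<Sum>i\<in>{m - K + 1..<K}. pair a n Plus (m - i) \<cdot> psi Minus i v)
      - (\<Sum>i\<in>{m - K + 1..<K}. pair a n Minus i \<cdot> psi Plus (m - i) v)"
    by (simp add: nop_psi sum_subtractf)
  also have "(\<Sum>i\<in>{m - K + 1..<K}. pair a n Minus i \<cdot> psi Plus (m - i) v)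
      = (\<Sum>i\<in>{m - K + 1..<K}. pair a n Minus (m - i) \<cdot> psi Plus i v)"
    by (rule sum.reindex_bij_witness[of _ "\<lambda>i. m - i" "\<lambda>i. m - i"]) auto
  finally show ?thesis unfolding Ssum by (simp add: algebra_simps)
qed

lemma cont_nab: "cont G \<Longrightarrow> cont (\<lambda>p. G (nab a b p))"
proof -
  assume G: "cont G"
  have "cont (\<lambda>p. G (fls_const (symp a b) * fls_deriv p) + G (cs a b * p))"
    using cont_add[OF cont_deriv[OF cont_mult[OF G]] cont_mult[OF G]] .
  then show ?thesis by (simp add: nab_def contD(1)[OF G])
qed

lemma Vir_S: "Vir m (S a p v) = S a p (Vir m v)
    + (S Minus (fls_X_intpow (m + 1) * nab a Plus p) v - S Plus (fls_X_intpow (m + 1) * nab a Minus p) v)"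
proof (rule cont_eq[of "\<lambda>p. Vir m (S a p v)" "\<lambda>p. S a p (Vir m v)
    + (S Minus (fls_X_intpow (m + 1) * nab a Plus p) v - S Plus (fls_X_intpow (m + 1) * nab a Minus p) v)"])
  show "cont (\<lambda>p. Vir m (S a p v))" by (rule cont_lin[OF lin_Vir cont_S])
  show "cont (\<lambda>p. S a p (Vir m v) + (S Minus (fls_X_intpow (m + 1) * nab a Plus p) v - S Plus (fls_X_intpow (m + 1) * nab a Minus p) v))"
    by (intro cont_add cont_diff cont_S cont_nab[OF cont_mult[OF cont_S]])
  show "Vir m (S a (fls_X_intpow n) v) = S a (fls_X_intpow n) (Vir m v)
    + (S Minus (fls_X_intpow (m + 1) * nab a Plus (fls_X_intpow n)) v
       - S Plus (fls_X_intpow (m + 1) * nab a Minus (fls_X_intpow n)) v)" for n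
    unfolding S_X by (rule Vir_psi)
qed

definition Psi :: "complex fls \<Rightarrow> complex fls \<Rightarrow> 'v \<Rightarrow> 'v" where
  "Psi p q v = S Plus p v + S Minus q v"

lemma lin_Psi: "lin (Psi p q)"
  unfolding Psi_def by (auto intro!: linI simp: lin_simps[OF lin_S] scale_right_distrib algebra_simps)

text \<open>The covariant derivative along \<open>d + A\<close>.\<close>

definition nabP :: "complex fls \<Rightarrow> complex fls \<Rightarrow> complex fls" where
  "nabP p q = fls_deriv p + cs Plus Minus * p + cs Minus Minus * q"
definition nabM :: "complex fls \<Rightarrow> complex fls \<Rightarrow> complex fls" where
  "nabM p q = fls_deriv q - cs Plus Plus * p - cs Plus Minus * q"

text \<open>A pair \<open>(p, q)\<close> is a section of the rank two bundle, and the anticommutator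
  is the residue of the symplectic form between the derivative of one section and the other. On an
  eigenline the derivative stays on the line, so the line pairs with itself to zero.\<close>

lemma Psi_Psi: "Psi p q (Psi p' q' v) + Psi p' q' (Psi p q v)
    = ((nabP p q * q' - nabM p q * p') $$ (-1)) \<cdot> v"
proof -
  have "Psi p q (Psi p' q' v) + Psi p' q' (Psi p q v)
     = (S Plus p (S Plus p' v) + S Plus p' (S Plus p v)) + (S Plus p (S Minus q' v) + S Minus q' (S Plus p v))
     + ((S Minus q (S Plus p' v) + S Plus p' (S Minus q v)) + (S Minus q (S Minus q' v) + S Minus q' (S Minus q v)))"
    by (simp add: Psi_def lin_simps[OF lin_S])
  also have "\<dots> = ((nab Plus Plus p * p' + nab Plus Minus p * q' + (nab Minus Plus q * p' + nab Minus Minus q * q')) $$ (-1)) \<cdot> v"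
    unfolding S_S by (simp add: scale_left_distrib)
  also have "nab Plus Plus p * p' + nab Plus Minus p * q' + (nab Minus Plus q * p' + nab Minus Minus q * q')
     = nabP p q * q' - nabM p q * p'"
    by (simp add: nab_def nabP_def nabM_def cs_sym[of Minus Plus] algebra_simps)
  finally show ?thesis .
qed

lemma Vir_Psi: "Vir m (Psi p q v) = Psi p q (Vir m v)
    - Psi (fls_X_intpow (m + 1) * nabP p q) (fls_X_intpow (m + 1) * nabM p q) v"
proof -
  have "Vir m (Psi p q v) = Psi p q (Vir m v)
     + (S Minus (fls_X_intpow (m + 1) * (nab Plus Plus p + nab Minus Plus q)) v
       - S Plus (fls_X_intpow (m + 1) * (nab Plus Minus p + nab Minus Minus q)) v)"
    unfolding Psi_def lin_add[OF lin_Vir] Vir_S distrib_left S_add by simp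
  moreover have "nab Plus Plus p + nab Minus Plus q = - nabM p q" "nab Plus Minus p + nab Minus Minus q = nabP p q"
    by (simp_all add: nab_def nabP_def nabM_def cs_sym[of Minus Plus])
  ultimately show ?thesis
    by (simp only: mult_minus_right S_uminus Psi_def) simp
qed

lemma cont_Psi: "cont (\<lambda>p. Psi (p * f) (p * g) v)"
  unfolding Psi_def mult.commute[of _ f] mult.commute[of _ g]
  by (intro cont_add cont_mult[OF cont_S])

end

text \<open>A horizontal frame \<open>f\<close>, \<open>h\<close> of the connection, for the eigenvalues \<open>\<eta>\<close> and \<open>-\<eta>\<close>.\<close>

locale clifford_frame = clifford_module scale psi Cf vac \<xi> \<epsilon>
  for scale :: "complex \<Rightarrow> 'v :: ab_group_add \<Rightarrow> 'v" (infixr \<open>\<cdot>\<close> 75)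
    and psi Cf vac \<xi> \<epsilon> +
  fixes f1 f2 h1 h2 :: "complex fls"
  assumes f: "nabP f1 f2 = eta \<xi> \<epsilon> * f1" "nabM f1 f2 = eta \<xi> \<epsilon> * f2"
    and h: "nabP h1 h2 = - eta \<xi> \<epsilon> * h1" "nabM h1 h2 = - eta \<xi> \<epsilon> * h2"
    and f_low: "\<And>n. n < 0 \<Longrightarrow> f1 $$ n = 0" "f1 $$ 0 = 1" "\<And>n. n \<le> 0 \<Longrightarrow> f2 $$ n = 0"
    and h_low: "\<And>n. n < 0 \<Longrightarrow> h2 $$ n = 0" "h2 $$ 0 = 1" "\<And>n. n \<le> 0 \<Longrightarrow> h1 $$ n = 0"
begin

text \<open>The connection has trace zero and the two eigenvalues are opposite, so the determinant
  of the frame has derivative zero; the normalization makes its constant term 1.\<close>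

lemma wronskian: "f1 * h2 - f2 * h1 = 1"
proof -
  let ?w = "f1 * h2 - f2 * h1"
  have f': "fls_deriv f1 = eta \<xi> \<epsilon> * f1 - cs Plus Minus * f1 - cs Minus Minus * f2"
     "fls_deriv f2 = eta \<xi> \<epsilon> * f2 + cs Plus Plus * f1 + cs Plus Minus * f2"
    using f by (simp_all add: nabP_def nabM_def algebra_simps)
  have h': "fls_deriv h1 = - eta \<xi> \<epsilon> * h1 - cs Plus Minus * h1 - cs Minus Minus * h2"
     "fls_deriv h2 = - eta \<xi> \<epsilon> * h2 + cs Plus Plus * h1 + cs Plus Minus * h2"
    using h by (simp_all add: nabP_def nabM_def algebra_simps)
  have "fls_deriv ?w = 0"
    by (simp add: f' h' algebra_simps)
  then have "of_int n * ?w $$ n = 0" for n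
    using fls_deriv_nth[of ?w "n - 1"] by simp
  then have *: "?w $$ n = 0" if "n \<noteq> 0" for n
    using that by (metis mult_eq_0_iff of_int_eq_0_iff)
  have "(f2 * h1) $$ 0 = 0"
    by (rule fls_mult_low[where a = 1 and b = 1]) (use f_low h_low in auto)
  moreover have "(f1 * h2) $$ 0 = 1"
  proof -
    have "((f1 - 1) * h2) $$ 0 = 0"
      by (rule fls_mult_low[where a = 1 and b = 0]) (use f_low h_low in \<open>auto simp: order_le_less\<close>)
    then show ?thesis using h_low by (simp add: algebra_simps)
  qed
  ultimately have "?w $$ n = 1 $$ n" for n using *[of n] by (cases "n = 0") auto
  then show ?thesis by (rule fls_eqI)
qed

definition b :: "complex fls \<Rightarrow> 'v \<Rightarrow> 'v" where "b p = Psi (p * f1) (p * f2)"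
definition c :: "complex fls \<Rightarrow> 'v \<Rightarrow> 'v" where "c q = Psi (q * h1) (q * h2)"

lemma nab_b: "nabP (p * f1) (p * f2) = (fls_deriv p + eta \<xi> \<epsilon> * p) * f1"
  "nabM (p * f1) (p * f2) = (fls_deriv p + eta \<xi> \<epsilon> * p) * f2"
proof -
  have "nabP (p * f1) (p * f2) = fls_deriv p * f1 + p * nabP f1 f2"
    "nabM (p * f1) (p * f2) = fls_deriv p * f2 + p * nabM f1 f2"
    by (simp_all add: nabP_def nabM_def algebra_simps)
  then show "nabP (p * f1) (p * f2) = (fls_deriv p + eta \<xi> \<epsilon> * p) * f1"
    "nabM (p * f1) (p * f2) = (fls_deriv p + eta \<xi> \<epsilon> * p) * f2"
    unfolding f by (simp_all add: algebra_simps)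
qed

lemma nab_c: "nabP (p * h1) (p * h2) = (fls_deriv p - eta \<xi> \<epsilon> * p) * h1"
  "nabM (p * h1) (p * h2) = (fls_deriv p - eta \<xi> \<epsilon> * p) * h2"
proof -
  have "nabP (p * h1) (p * h2) = fls_deriv p * h1 + p * nabP h1 h2"
    "nabM (p * h1) (p * h2) = fls_deriv p * h2 + p * nabM h1 h2"
    by (simp_all add: nabP_def nabM_def algebra_simps)
  then show "nabP (p * h1) (p * h2) = (fls_deriv p - eta \<xi> \<epsilon> * p) * h1"
    "nabM (p * h1) (p * h2) = (fls_deriv p - eta \<xi> \<epsilon> * p) * h2"
    unfolding h by (simp_all add: algebra_simps)
qed

sublocale dual_fields scale b c Vir \<xi> \<epsilon>
proof unfold_locales
  show "cont (\<lambda>p. b p v)" "cont (\<lambda>q. c q v)" for v unfolding b_def c_def by (rule cont_Psi)+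
  show "lin (b p)" "lin (c p)" "lin (Vir m)" for p m
    unfolding b_def c_def by (rule lin_Psi lin_Vir)+
  show "b p (b q v) = - b q (b p v)" for p q v
    using Psi_Psi[of "p * f1" "p * f2" "q * f1" "q * f2" v] unfolding nab_b b_def
    by (simp add: algebra_simps eq_neg_iff_add_eq_0)
  show "c p (c q v) = - c q (c p v)" for p q v
    using Psi_Psi[of "p * h1" "p * h2" "q * h1" "q * h2" v] unfolding nab_c c_def
    by (simp add: algebra_simps eq_neg_iff_add_eq_0)
  show "b p (c q v) = (((fls_deriv p + eta \<xi> \<epsilon> * p) * q) $$ - 1) \<cdot> v - c q (b p v)" for p q v
  proof -
    let ?d = "fls_deriv p + eta \<xi> \<epsilon> * p"
    have "?d * f1 * (q * h2) - ?d * f2 * (q * h1) = ?d * q * (f1 * h2 - f2 * h1)"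
      by (simp add: algebra_simps)
    then show ?thesis
      using Psi_Psi[of "p * f1" "p * f2" "q * h1" "q * h2" v] unfolding nab_b b_def c_def wronskian
      by (simp only: eq_diff_eq mult_1_right)
  qed
  show "Vir m (b p v) = b p (Vir m v) - b (fls_X_intpow (m + 1) * (fls_deriv p + eta \<xi> \<epsilon> * p)) v" for m p v
    unfolding b_def Vir_Psi nab_b by (simp only: mult.assoc)
  show "Vir m (c p v) = c p (Vir m v) - c (fls_X_intpow (m + 1) * (fls_deriv p - eta \<xi> \<epsilon> * p)) v" for m p v
    unfolding c_def Vir_Psi nab_c by (simp only: mult.assoc)
  show "\<xi> \<noteq> 0" by (rule xi_nz)
qed

text \<open>Cramer's rule for the frame, whose determinant is 1.\<close>

lemma psi_bc: "psi Plus n v = b (fls_X_intpow n * h2) v - c (fls_X_intpow n * f2) v"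
  "psi Minus n v = c (fls_X_intpow n * f1) v - b (fls_X_intpow n * h1) v"
proof -
  let ?X = "fls_X_intpow n :: complex fls"
  have "?X * h2 * f1 - ?X * f2 * h1 = ?X * (f1 * h2 - f2 * h1)"
    "?X * f1 * h2 - ?X * h1 * f2 = ?X * (f1 * h2 - f2 * h1)"
    by (simp_all only: right_diff_distrib mult_ac)
  then have w: "?X * h2 * f1 - ?X * f2 * h1 = ?X" "?X * f1 * h2 - ?X * h1 * f2 = ?X"
    by (simp_all only: wronskian mult_1_right)
  have z: "?X * h2 * f2 - ?X * f2 * h2 = 0" "?X * f1 * h1 - ?X * h1 * f1 = 0"
    by (simp_all only: mult_ac cancel_comm_monoid_add_class.diff_cancel)
  have "b (?X * h2) v - c (?X * f2) v = S Plus (?X * h2 * f1 - ?X * f2 * h1) v + S Minus (?X * h2 * f2 - ?X * f2 * h2) v"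
    by (simp only: b_def c_def Psi_def S_diff add_diff_add)
  then show "psi Plus n v = b (?X * h2) v - c (?X * f2) v"
    unfolding w z S_X S_zero by simp
  have "c (?X * f1) v - b (?X * h1) v = S Plus (?X * f1 * h1 - ?X * h1 * f1) v + S Minus (?X * f1 * h2 - ?X * h1 * f2) v"
    by (simp only: b_def c_def Psi_def S_diff add_diff_add)
  then show "psi Minus n v = c (?X * f1) v - b (?X * h1) v"
    unfolding w z S_X S_zero by simp
qed

end

section \<open>Constants of the Virasoro operators, and existence of a horizontal frame\<close>

context clifford_module
begin

lemma S_mem:
  assumes "subspace U" "\<And>n. psi a n v \<in> U"
  shows "S a p v \<in> U"
  by (rule cont_mem'[OF cont_S assms(1)]) (simp only: S_X assms(2))

lemma S_low:
  assumes "\<And>n. d \<le> n \<Longrightarrow> psi a n v = 0" "\<And>n. n < d \<Longrightarrow> p $$ n = 0"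
  shows "S a p v = 0"
  using S_eq[of d a v d p] assms by simp

lemma Vir_vac: "1 \<le> n \<Longrightarrow> Vir n vac = vc n \<cdot> vac"
proof -
  assume "1 \<le> n"
  then have "{n - 1<..<1} = {}" by auto
  then show ?thesis using Vir_eq[of 1 vac n] psi_vac by simp
qed

lemma vc_eq:
  assumes "finite I" "{n - 1..1} \<subseteq> I"
  shows "vc n = 1 / 2 * (\<Sum>i\<in>I. Cf i Minus Plus * Cf (n - i) Plus Minus - Cf i Plus Plus * Cf (n - i) Minus Minus)"
proof -
  have "{i. Cf i Minus Plus * Cf (n - i) Plus Minus - Cf i Plus Plus * Cf (n - i) Minus Minus \<noteq> 0} \<subseteq> I"
  proof
    fix i assume i: "i \<in> {i. Cf i Minus Plus * Cf (n - i) Plus Minus - Cf i Plus Plus * Cf (n - i) Minus Minus \<noteq> 0}"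
    have "\<not> 1 < i" "\<not> 1 < n - i" using i Cf_high by auto
    then show "i \<in> I" using assms(2) by auto
  qed
  then show ?thesis unfolding vc_def
    by (subst Sum_any.expand_superset[OF assms(1)]) auto
qed

text \<open>Only the off-diagonal entries of \<open>C_1\<close> are nonzero. For
  \<open>n = 1\<close> the index pairs (0, 1) and (1, 0) contribute \<open>\<xi> \<epsilon>\<close>
  each before halving; for \<open>n = 2\<close> only (1, 1) contributes.\<close>

lemma vc_pos: "vc 1 = \<xi> * \<epsilon>" "vc 2 = \<xi>\<^sup>2 / 2" "3 \<le> n \<Longrightarrow> vc n = 0"
proof -
  have s: "{0..1} = {0, 1 :: int}" by auto
  show "vc 1 = \<xi> * \<epsilon>"
    using vc_eq[of "{0..1}" 1] Cf_sym[of _ Minus Plus] by (simp add: s Cf_0 Cf_1)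
  show "vc 2 = \<xi>\<^sup>2 / 2"
    using vc_eq[of "{1}" 2] Cf_sym[of _ Minus Plus] by (simp add: Cf_1 power2_eq_square)
  show "3 \<le> n \<Longrightarrow> vc n = 0"
    using vc_eq[of "{}" n] by simp
qed

text \<open>Exchanging the two components turns the connection into one of the same shape with
  \<open>- \<xi>\<close> and \<open>- \<epsilon>\<close>, so the second eigenline comes from the
  same lemma. The diagonal entries of \<open>C(z)\<close> have at most a simple pole because
  \<open>C_1\<close> is off-diagonal.\<close>

lemma frame_exists: "\<exists>f1 f2 h1 h2. clifford_frame scale psi Cf vac \<xi> \<epsilon> f1 f2 h1 h2"
proof -
  have al: "n < -2 \<Longrightarrow> cs Plus Minus $$ n = 0" "cs Plus Minus $$ (-2) = \<xi>" "cs Plus Minus $$ (-1) = \<epsilon>" for n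
    by (simp_all add: cs_nth Cf_high Cf_1 Cf_0)
  have be: "cs a a $$ n = 0" if "n < -1" for a n
  proof (cases "n = -2")
    case True
    then show ?thesis by (cases a) (simp_all add: cs_nth Cf_1)
  qed (use that in \<open>simp add: cs_nth Cf_high\<close>)
  obtain f1 f2 where f: "fls_deriv f1 + cs Plus Minus * f1 + cs Minus Minus * f2 = eta \<xi> \<epsilon> * f1"
    "fls_deriv f2 - cs Plus Plus * f1 - cs Plus Minus * f2 = eta \<xi> \<epsilon> * f2"
    "\<forall>n<0. f1 $$ n = 0" "f1 $$ 0 = 1" "\<forall>n\<le>0. f2 $$ n = 0"
    using horizontal_section_exists[OF xi_nz al be be] by blast
  obtain h2 h1 where h: "fls_deriv h2 + - cs Plus Minus * h2 + - cs Plus Plus * h1 = eta (- \<xi>) (- \<epsilon>) * h2"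
    "fls_deriv h1 - - cs Minus Minus * h2 - - cs Plus Minus * h1 = eta (- \<xi>) (- \<epsilon>) * h1"
    "\<forall>n<0. h2 $$ n = 0" "h2 $$ 0 = 1" "\<forall>n\<le>0. h1 $$ n = 0"
    using horizontal_section_exists[of "- \<xi>" "- cs Plus Minus" "- \<epsilon>" "- cs Plus Plus" "- cs Minus Minus"]
      xi_nz al be by auto
  have "clifford_frame scale psi Cf vac \<xi> \<epsilon> f1 f2 h1 h2"
  proof (intro clifford_frame.intro clifford_frame_axioms.intro clifford_module_axioms)
    show "nabP f1 f2 = eta \<xi> \<epsilon> * f1" "nabM f1 f2 = eta \<xi> \<epsilon> * f2"
      using f by (simp_all add: nabP_def nabM_def)
    show "nabP h1 h2 = - eta \<xi> \<epsilon> * h1" "nabM h1 h2 = - eta \<xi> \<epsilon> * h2"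
      using h(1,2) unfolding eta_uminus nabP_def nabM_def by (simp_all add: algebra_simps)
  qed (use f h in auto)
  then show ?thesis by blast
qed

end

section \<open>Vacua of every charge and their Virasoro span\<close>

context clifford_frame
begin

text \<open>The frame is regular, so a series of positive order keeps this property after
  multiplication by it, and its field involves only modes that kill \<open>vac\<close>. Both
  \<open>z^(-j)\<close> for \<open>j < 0\<close> and \<open>e j\<close> for \<open>0 \<le> j\<close>
  have positive order.\<close>

lemma vacuum_vac: "vacuum 0 vac"
proof (rule vacuumI)
  have low: "Psi (p * g) (p * g') vac = 0" if "\<And>n. n < 1 \<Longrightarrow> p $$ n = 0"
     "\<And>n. n < 0 \<Longrightarrow> g $$ n = 0" "\<And>n. n < 0 \<Longrightarrow> g' $$ n = 0" for p g g'
  proof -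
    have "S a (p * u) vac = 0" if u: "\<And>n. n < 0 \<Longrightarrow> u $$ n = 0" for a u
    proof (rule S_low[where d = 1])
      show "(p * u) $$ n = 0" if "n < 1" for n
        by (rule fls_mult_low[where a = 1 and b = 0]) (use \<open>\<And>n. n < 1 \<Longrightarrow> p $$ n = 0\<close> u that in auto)
    qed (rule psi_vac)
    then show ?thesis using that by (simp add: Psi_def)
  qed
  show "C j vac = 0" if "j < 0" for j
    unfolding C_def c_def by (rule low) (use that h_low in auto)
  show "E j vac = 0" if "0 \<le> j" for j
    unfolding E_def b_def by (rule low) (use that e(2)[of _ j] f_low in auto)
  fix U assume U: "subspace U" "vac \<in> U" "\<And>j v. v \<in> U \<Longrightarrow> C j v \<in> U" "\<And>j v. v \<in> U \<Longrightarrow> E j v \<in> U"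
  have c: "c q v \<in> U" if "v \<in> U" for q v
  proof (rule cont_mem'[OF cont_c U(1)])
    show "c (fls_X_intpow n) v \<in> U" for n using U(3)[OF that, of "- n"] by (simp add: C_def)
  qed
  have b: "b q v \<in> U" if "v \<in> U" for q v
  proof (rule cont_mem'[OF cont_b U(1)])
    show "b (fls_X_intpow n) v \<in> U" for n
      unfolding b_X by (intro subspace_add[OF U(1)] subspace_scale[OF U(1)] U(4)[OF that])
  qed
  show "U = UNIV"
  proof (rule psi_cyclic[OF U(1,2)])
    show "psi a n v \<in> U" if "v \<in> U" for a n v
      by (cases a) (simp_all only: psi_bc subspace_diff[OF U(1)] b[OF that] c[OF that])
  qed
qed

lemma psi_closed_simple:
  assumes U: "subspace U" "\<And>a n v. v \<in> U \<Longrightarrow> psi a n v \<in> U" and v: "v \<in> U" "v \<noteq> 0"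
  shows "U = UNIV"
proof -
  interpret f: fermions scale C E 0 vac using vacuum_vac by (simp add: vacuum_def)
  have Psi: "Psi p q u \<in> U" if "u \<in> U" for p q u
    unfolding Psi_def by (intro subspace_add[OF U(1)] S_mem[OF U(1)] U(2) that)
  have "vac \<in> U"
    by (rule f.vacuum_mem[OF U(1) _ _ v]) (simp_all add: C_def E_def c_def b_def Psi)
  then show ?thesis by (rule psi_cyclic[OF U(1) _ U(2)])
qed

lemma psi_singular:
  assumes "\<And>a n. 1 \<le> n \<Longrightarrow> psi a n v = 0"
  shows "\<exists>s. v = s \<cdot> vac"
proof -
  interpret f: fermions scale C E 0 vac using vacuum_vac by (simp add: vacuum_def)
  have low: "Psi (p * g) (p * g') v = 0" if "\<And>n. n < 1 \<Longrightarrow> p $$ n = 0"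
     "\<And>n. n < 0 \<Longrightarrow> g $$ n = 0" "\<And>n. n < 0 \<Longrightarrow> g' $$ n = 0" for p g g'
  proof -
    have "S a (p * u) v = 0" if u: "\<And>n. n < 0 \<Longrightarrow> u $$ n = 0" for a u
    proof (rule S_low[where d = 1])
      show "(p * u) $$ n = 0" if "n < 1" for n
        by (rule fls_mult_low[where a = 1 and b = 0]) (use \<open>\<And>n. n < 1 \<Longrightarrow> p $$ n = 0\<close> u that in auto)
    qed (rule assms)
    then show ?thesis using that by (simp add: Psi_def)
  qed
  show ?thesis
  proof (rule f.singular_vector)
    show "C j v = 0" if "j < 0" for j
      unfolding C_def c_def by (rule low) (use that h_low in auto)
    show "E j v = 0" if "0 \<le> j" for j
      unfolding E_def b_def by (rule low) (use that e(2)[of _ j] f_low in auto)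
  qed
qed

text \<open>As in the semi-infinite wedge, start from \<open>vac\<close>, fill the modes 0, 1, ...
  with \<open>C\<close> and empty the modes -1, -2, ... with \<open>E\<close>.\<close>

lemma vacuum_chain_exists:
  "\<exists>w. w 0 = vac \<and> (\<forall>k. vacuum k (w k) \<and> C k (w k) = w (k + 1) \<and> E k (w (k + 1)) = w k)"
proof -
  define u where "u = rec_nat vac (\<lambda>n r. C (int n) r)"
  define d where "d = rec_nat vac (\<lambda>n r. E (- int n - 1) r)"
  have u: "u 0 = vac" "u (Suc n) = C (int n) (u n)" for n by (simp_all add: u_def)
  have d: "d 0 = vac" "d (Suc n) = E (- int n - 1) (d n)" for n by (simp_all add: d_def)
  have vu: "vacuum (int n) (u n)" for n
  proof (induction n)
    case (Suc n)
    then show ?case using vacuum_up(1)[OF Suc] by (simp add: u add.commute)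
  qed (simp add: u vacuum_vac)
  have vd: "vacuum (- int n) (d n)" for n
  proof (induction n)
    case (Suc n)
    have "- int (Suc n) = - int n - 1" by simp
    then show ?case using vacuum_down(1)[of "- int n - 1" "d n"] Suc by (simp only: d) simp
  qed (simp add: d vacuum_vac)
  define w where "w k = (if 0 \<le> k then u (nat k) else d (nat (- k)))" for k
  have "vacuum k (w k)" for k
    using vu[of "nat k"] vd[of "nat (- k)"] by (cases "0 \<le> k") (simp_all add: w_def)
  moreover have "C k (w k) = w (k + 1) \<and> E k (w (k + 1)) = w k" for k
  proof (cases "0 \<le> k")
    case True
    then have "w (k + 1) = C k (w k)"
      by (simp add: w_def nat_add_distrib u)
    then show ?thesis using vacuum_up(2)[of k "w k"] vu[of "nat k"] True by (simp add: w_def)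
  next
    case False
    define n where "n = nat (- k - 1)"
    have k: "k = - int n - 1" "nat (- k) = Suc n" using False by (simp_all add: n_def)
    have "w (k + 1) = d n" by (cases n) (simp_all add: w_def k u d nat_add_distrib)
    moreover have "w k = E k (d n)" using False unfolding w_def k(2) d by (simp flip: k(1))
    moreover have "vacuum (k + 1) (d n)" using vd[of n] by (simp add: k)
    ultimately show ?thesis using vacuum_down(2)[of k "d n"] by simp
  qed
  ultimately show ?thesis by (intro exI[of _ w]) (simp add: w_def u)
qed

text \<open>Of the two extra terms of \<open>LC\<close> only \<open>C (k + 1 - m) v\<close> with
  \<open>m = 1\<close> survives on a vacuum of charge \<open>k\<close>, and similarly for
  \<open>LE\<close>. So among the positive Virasoro modes only \<open>L 1\<close> notices a change
  of charge.\<close>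

lemma eigen_step:
  assumes "vacuum k v" and "Vir m v = t \<cdot> v" and "1 \<le> m"
  shows "Vir m (C k v) = (if m = 1 then t + \<xi> else t) \<cdot> C k v"
    and "Vir m (E (k - 1) v) = (if m = 1 then t - \<xi> else t) \<cdot> E (k - 1) v"
proof -
  interpret f: fermions scale C E k v using assms by (simp add: vacuum_def)
  have "Vir m (C k v) = t \<cdot> C k v + \<xi> \<cdot> C (k + 1 - m) v"
    using assms by (simp add: LC lin_simps[OF lin_C] f.C_w)
  then show "Vir m (C k v) = (if m = 1 then t + \<xi> else t) \<cdot> C k v"
    using assms(3) by (auto simp: scale_left_distrib f.C_w)
  have "Vir m (E (k - 1) v) = t \<cdot> E (k - 1) v - \<xi> \<cdot> E (k - 1 + m - 1) v"
    using assms by (simp add: LE lin_simps[OF lin_E] f.E_w)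
  then show "Vir m (E (k - 1) v) = (if m = 1 then t - \<xi> else t) \<cdot> E (k - 1) v"
    using assms(3) by (auto simp: scale_left_diff_distrib f.E_w)
qed

theorem whittaker_vectors_exist:
  "\<exists>w. (\<forall>k. w k \<noteq> 0 \<and> Vir 1 (w k) = (\<xi> * (of_int k + \<epsilon>)) \<cdot> w k \<and> Vir 2 (w k) = (\<xi>\<^sup>2 / 2) \<cdot> w k
       \<and> (\<forall>n\<ge>3. Vir n (w k) = 0))
     \<and> (\<forall>U. subspace U \<longrightarrow> (\<forall>m. \<forall>v\<in>U. Vir m v \<in> U) \<longrightarrow> (\<forall>k. w k \<in> U) \<longrightarrow> U = UNIV)"
proof -
  obtain w where w: "w 0 = vac" "\<And>k. vacuum k (w k)" "\<And>k. C k (w k) = w (k + 1)" "\<And>k. E k (w (k + 1)) = w k"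
    using vacuum_chain_exists by blast
  have Ew: "E (k - 1) (w k) = w (k - 1)" for k using w(4)[of "k - 1"] by simp
  have nz: "w k \<noteq> 0" for k
  proof
    interpret f: fermions scale C E k "w k" using w(2)[of k] by (simp add: vacuum_def)
    assume "w k = 0"
    then have "{0} = (UNIV :: 'v set)" by (intro f.cyclic) (auto simp: lin_simps[OF lin_C] lin_simps[OF lin_E])
    then show False using vac_nz by blast
  qed
  define t where "t m k = (if m = 1 then \<xi> * (of_int k + \<epsilon>) else vc m)" for m k :: int
  have eig: "Vir m (w k) = t m k \<cdot> w k" if "1 \<le> m" for m k
  proof (induction k rule: int_induct[where k = 0])
    case base
    show ?case using Vir_vac[OF that] by (simp add: w t_def vc_pos)
  next
    case (step1 k)
    then show ?case
      using eigen_step(1)[OF w(2) step1(2) that] unfolding w(3) by (simp add: t_def algebra_simps)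
  next
    case (step2 k)
    then show ?case
      using eigen_step(2)[OF w(2) step2(2) that] unfolding Ew by (simp add: t_def algebra_simps)
  qed
  have gen: "U = UNIV" if U: "subspace U" "\<And>m v. v \<in> U \<Longrightarrow> Vir m v \<in> U" "\<And>k. w k \<in> U" for U
  proof -
    \<comment> \<open>The Virasoro span of all \<open>w k\<close>. As an intersection it is
      contained in every stable subspace that contains the \<open>w k\<close>, which is how its
      elements are studied.\<close>
    define T where "T = {u. \<forall>Z. subspace Z \<and> (\<forall>m. \<forall>v\<in>Z. Vir m v \<in> Z) \<and> (\<forall>k. w k \<in> Z) \<longrightarrow> u \<in> Z}"
    have T: "subspace T"
      by (rule subspaceI) (auto simp: T_def intro: subspace_0 subspace_add subspace_scale)
    have TL: "Vir m v \<in> T" if "v \<in> T" for m v using that by (auto simp: T_def)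
    have Tw: "w k \<in> T" for k by (auto simp: T_def)
    have min: "v \<in> Z" if "v \<in> T" "subspace Z" "\<And>m v. v \<in> Z \<Longrightarrow> Vir m v \<in> Z" "\<And>k. w k \<in> Z" for v Z
      using that by (auto simp: T_def)
    have c: "c q v \<in> T" if "v \<in> T" for q v
    proof -
      \<comment> \<open>The commutator of \<open>Vir m\<close> with \<open>c q\<close> is again a
        field \<open>c\<close>, so the vectors that all \<open>c q\<close> send into
        \<open>T\<close> form a stable subspace; \<open>c_mem\<close> puts every \<open>w k\<close>
        into it.\<close>
      have "v \<in> {v. \<forall>q. c q v \<in> T}"
      proof (rule min[OF that])
        show "subspace {v. \<forall>q. c q v \<in> T}"
          by (rule subspaceI) (auto simp: lin_simps[OF lin_c] subspace_0[OF T] subspace_add[OF T] subspace_scale[OF T])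
        show "Vir m v \<in> {v. \<forall>q. c q v \<in> T}" if "v \<in> {v. \<forall>q. c q v \<in> T}" for m v
        proof (intro CollectI allI)
          fix q
          have "c q (Vir m v) = Vir m (c q v) + c (fls_X_intpow (m + 1) * (fls_deriv q - eta \<xi> \<epsilon> * q)) v"
            by (simp add: Lc)
          then show "c q (Vir m v) \<in> T" using that by (simp add: subspace_add[OF T] TL)
        qed
        show "w k \<in> {v. \<forall>q. c q v \<in> T}" for k
          using c_mem[OF w(2) T TL, of k] by (simp add: w(3) Tw)
      qed
      then show ?thesis by blast
    qed
    have b: "b q v \<in> T" if "v \<in> T" for q v
    proof -
      have "v \<in> {v. \<forall>q. b q v \<in> T}"
      proof (rule min[OF that])
        show "subspace {v. \<forall>q. b q v \<in> T}"
          by (rule subspaceI) (auto simp: lin_simps[OF lin_b] subspace_0[OF T] subspace_add[OF T] subspace_scale[OF T])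
        show "Vir m v \<in> {v. \<forall>q. b q v \<in> T}" if "v \<in> {v. \<forall>q. b q v \<in> T}" for m v
        proof (intro CollectI allI)
          fix q
          have "b q (Vir m v) = Vir m (b q v) + b (fls_X_intpow (m + 1) * (fls_deriv q + eta \<xi> \<epsilon> * q)) v"
            by (simp add: Lb)
          then show "b q (Vir m v) \<in> T" using that by (simp add: subspace_add[OF T] TL)
        qed
        show "w k \<in> {v. \<forall>q. b q v \<in> T}" for k
          using b_mem[OF w(2) T TL, of k] by (simp add: Ew Tw)
      qed
      then show ?thesis by blast
    qed
    have "T = UNIV"
    proof (rule psi_cyclic[OF T])
      show "vac \<in> T" using Tw[of 0] by (simp add: w)
      show "psi a n v \<in> T" if "v \<in> T" for a n v
        by (cases a) (simp_all only: psi_bc subspace_diff[OF T] b[OF that] c[OF that])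
    qed
    then show ?thesis using U by (auto simp: T_def)
  qed
  show ?thesis
    using nz eig gen by (intro exI[of _ w]) (auto simp: t_def vc_pos)
qed

end

section \<open>Lattice point sums for the central term\<close>

lemma sum_diagonals_square:
  fixes F :: "int \<Rightarrow> complex"
  assumes "\<And>t. t < n \<Longrightarrow> F t = 0"
  shows "(\<Sum>i\<in>{n..0}. \<Sum>q\<in>{n..0}. F (i + q)) = (\<Sum>t\<in>{n..0}. of_int (1 - t) * F t)"
proof -
  have "(\<Sum>q\<in>{n..0}. F (i + q)) = (\<Sum>t\<in>{t\<in>{n..0}. t \<le> i}. F t)" if "i \<in> {n..0}" for i
  proof -
    have "(\<Sum>q\<in>{n..0}. F (i + q)) = (\<Sum>t\<in>{n + i..i}. F t)"
      by (rule sum.reindex_bij_witness[of _ "\<lambda>t. t - i" "\<lambda>q. i + q"]) auto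
    also have "\<dots> = (\<Sum>t\<in>{t\<in>{n..0}. t \<le> i}. F t)"
      by (rule sum.mono_neutral_right) (use that assms in \<open>auto intro: leI\<close>)
    finally show ?thesis .
  qed
  then have "(\<Sum>i\<in>{n..0}. \<Sum>q\<in>{n..0}. F (i + q)) = (\<Sum>i\<in>{n..0}. \<Sum>t\<in>{t\<in>{n..0}. t \<le> i}. F t)"
    by (rule sum.cong[OF refl])
  also have "\<dots> = (\<Sum>t\<in>{n..0}. \<Sum>i\<in>{i\<in>{n..0}. t \<le> i}. F t)"
    by (rule sum.swap_restrict) auto
  also have "\<dots> = (\<Sum>t\<in>{n..0}. of_int (1 - t) * F t)"
  proof (rule sum.cong[OF refl])
    fix t assume "t \<in> {n..0}"
    \<comment> \<open>The diagonal \<open>i + q = t\<close> meets the square in \<open>1 - t\<close>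
      points.\<close>
    then have "{i\<in>{n..0}. t \<le> i} = {t..0}" by auto
    then show "(\<Sum>i\<in>{i\<in>{n..0}. t \<le> i}. F t) = of_int (1 - t) * F t"
      using \<open>t \<in> {n..0}\<close> by simp
  qed
  finally show ?thesis .
qed

text \<open>The diagonal \<open>p + j = t\<close> meets the triangle in the \<open>t - n\<close>
  points with \<open>n \<le> j < t\<close>.\<close>

lemma sum_diagonals_triangle:
  fixes F :: "int \<Rightarrow> complex"
  assumes "n \<le> 0"
  shows "(\<Sum>j\<in>{n..0}. \<Sum>p\<in>{1..1 - j}. F (p + j)) = (\<Sum>t\<in>{n..1}. of_int (t - n) * F t)"
proof -
  have "(\<Sum>p\<in>{1..1 - j}. F (p + j)) = (\<Sum>t\<in>{t\<in>{n..1}. j + 1 \<le> t}. F t)" if "j \<in> {n..0}" for j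
    by (rule sum.reindex_bij_witness[of _ "\<lambda>t. t - j" "\<lambda>p. p + j"]) (use that in auto)
  then have "(\<Sum>j\<in>{n..0}. \<Sum>p\<in>{1..1 - j}. F (p + j)) = (\<Sum>j\<in>{n..0}. \<Sum>t\<in>{t\<in>{n..1}. j + 1 \<le> t}. F t)"
    by (rule sum.cong[OF refl])
  also have "\<dots> = (\<Sum>t\<in>{n..1}. \<Sum>j\<in>{j\<in>{n..0}. j + 1 \<le> t}. F t)"
    by (rule sum.swap_restrict) auto
  also have "\<dots> = (\<Sum>t\<in>{n..1}. of_int (t - n) * F t)"
  proof (rule sum.cong[OF refl])
    fix t assume "t \<in> {n..1}"
    then have "{j\<in>{n..0}. j + 1 \<le> t} = {n..t - 1}" by auto
    then show "(\<Sum>j\<in>{j\<in>{n..0}. j + 1 \<le> t}. F t) = of_int (t - n) * F t"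
      using \<open>t \<in> {n..1}\<close> by simp
  qed
  finally show ?thesis .
qed

text \<open>In the variable \<open>s = p - i\<close> the total modes of the two contractions,
  \<open>i + m - p\<close> and \<open>p + n - i\<close>, depend on \<open>s\<close> only;
  \<open>i\<close> then runs from \<open>1 - s\<close> to 0.\<close>

lemma sum_shear:
  fixes H :: "int \<Rightarrow> int \<Rightarrow> complex"
  assumes "n \<le> 0"
  shows "(\<Sum>i\<in>{n..0}. \<Sum>p\<in>{1..1 - (n - i)}. H i (p - i)) = (\<Sum>s\<in>{1..1 - n}. \<Sum>i\<in>{1 - s..0}. H i s)"
proof -
  have "(\<Sum>p\<in>{1..1 - (n - i)}. H i (p - i)) = (\<Sum>s\<in>{s\<in>{1..1 - n}. 1 - i \<le> s}. H i s)" if "i \<in> {n..0}" for i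
    by (rule sum.reindex_bij_witness[of _ "\<lambda>s. s + i" "\<lambda>p. p - i"]) (use that in auto)
  then have "(\<Sum>i\<in>{n..0}. \<Sum>p\<in>{1..1 - (n - i)}. H i (p - i)) = (\<Sum>i\<in>{n..0}. \<Sum>s\<in>{s\<in>{1..1 - n}. 1 - i \<le> s}. H i s)"
    by (rule sum.cong[OF refl])
  also have "\<dots> = (\<Sum>s\<in>{1..1 - n}. \<Sum>i\<in>{i\<in>{n..0}. 1 - i \<le> s}. H i s)"
    by (rule sum.swap_restrict) auto
  also have "\<dots> = (\<Sum>s\<in>{1..1 - n}. \<Sum>i\<in>{1 - s..0}. H i s)"
    by (intro sum.cong refl) auto
  finally show ?thesis .
qed

lemma sum_interval_neg:
  assumes "0 \<le> s"
  shows "(\<Sum>i\<in>{1 - s..0}. of_int i) = - (of_int s * (of_int s - 1) / 2 :: complex)"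
    and "(\<Sum>i\<in>{1 - s..0}. of_int i * of_int i) = (of_int s * (of_int s - 1) * (2 * of_int s - 1) / 6 :: complex)"
proof -
  have ins: "{1 - int (Suc N)..0} = insert (- int N) {1 - int N..0}" for N by auto
  have "(\<Sum>i\<in>{1 - int N..0}. of_int i) = - (of_nat N * (of_nat N - 1) / 2 :: complex) \<and>
    (\<Sum>i\<in>{1 - int N..0}. of_int i * of_int i) = (of_nat N * (of_nat N - 1) * (2 * of_nat N - 1) / 6 :: complex)" for N
  proof (induction N)
    case (Suc N)
    then show ?case unfolding ins by (simp add: field_simps)
  qed simp
  from this[of "nat s"] assms show "(\<Sum>i\<in>{1 - s..0}. of_int i) = - (of_int s * (of_int s - 1) / 2 :: complex)"
    "(\<Sum>i\<in>{1 - s..0}. of_int i * of_int i) = (of_int s * (of_int s - 1) * (2 * of_int s - 1) / 6 :: complex)"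
    by simp_all
qed

text \<open>By reflection the weight \<open>s\<close> may be replaced by the midpoint of the
  interval.\<close>

lemma sum_weight_symmetrize:
  fixes F :: "int \<Rightarrow> complex"
  assumes "\<And>s. F (a + b - s) = F s"
  shows "(\<Sum>s\<in>{a..b}. of_int s * F s) = of_int (a + b) / 2 * (\<Sum>s\<in>{a..b}. F s)"
proof -
  have "(\<Sum>s\<in>{a..b}. of_int s * F s) = (\<Sum>s\<in>{a..b}. of_int (a + b - s) * F (a + b - s))"
    by (rule sum.reindex_bij_witness[of _ "\<lambda>s. a + b - s" "\<lambda>s. a + b - s"]) auto
  also have "\<dots> = (\<Sum>s\<in>{a..b}. of_int (a + b) * F s - of_int s * F s)"
    by (simp add: assms algebra_simps)
  also have "\<dots> = of_int (a + b) * (\<Sum>s\<in>{a..b}. F s) - (\<Sum>s\<in>{a..b}. of_int s * F s)"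
    by (simp only: sum_subtractf sum_distrib_left)
  finally show ?thesis by (simp add: mult.commute)
qed

section \<open>The defect of the Virasoro relations is a scalar\<close>

context clifford_module
begin

lemma S_nab_sum:
  assumes K: "\<And>k. K \<le> k \<Longrightarrow> psi b k v = 0" and d: "d \<le> n + m - 1"
  shows "S b (fls_X_intpow (m + 1) * nab a b' (fls_X_intpow n)) v = (\<Sum>i\<in>{d..<K}. pair a n b' (m - i) \<cdot> psi b i v)"
proof -
  have coeff: "(fls_X_intpow (m + 1) * nab a b' (fls_X_intpow n)) $$ i = pair a n b' (m - i)" for i
    by (simp add: nab_X_nth)
  have "(fls_X_intpow (m + 1) * nab a b' (fls_X_intpow n)) $$ i = 0" if "i < d" for i
    unfolding coeff by (rule pair_high) (use that d in auto)
  from S_eq[of K b v d, OF K this] show ?thesis unfolding coeff by simp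
qed

text \<open>A component of \<open>z^(m+1)\<close> times the covariant derivative of a section; up to
  sign, this is how \<open>Vir m\<close> acts on fields.\<close>

definition DP :: "int \<Rightarrow> complex fls \<Rightarrow> complex fls \<Rightarrow> complex fls" where
  "DP m p q = fls_X_intpow (m + 1) * nabP p q"
definition DM :: "int \<Rightarrow> complex fls \<Rightarrow> complex fls \<Rightarrow> complex fls" where
  "DM m p q = fls_X_intpow (m + 1) * nabM p q"

definition vcomm :: "int \<Rightarrow> int \<Rightarrow> 'v \<Rightarrow> 'v" where
  "vcomm m n v = Vir m (Vir n v) - Vir n (Vir m v) - of_int (m - n) \<cdot> Vir (m + n) v"

lemma lin_vcomm: "lin (vcomm m n)"
  by (rule linI) (simp_all add: vcomm_def lin_simps[OF lin_Vir] scale_right_distrib scale_right_diff_distrib mult.commute)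

lemma Psi_diff: "Psi p q v - Psi p' q' v = Psi (p - p') (q - q') v"
  and Psi_const: "s \<cdot> Psi p q v = Psi (fls_const s * p) (fls_const s * q) v"
  by (simp_all only: Psi_def S_diff S_const scale_right_distrib) simp_all

text \<open>The second-order terms are symmetric in \<open>m\<close> and \<open>n\<close> and
  cancel. The Leibniz terms leave \<open>(n + 1) - (m + 1)\<close> times \<open>z^(m+n+1)\<close>
  times the covariant derivative.\<close>

lemma witt_bracket:
  "DP m (DP n p q) (DM n p q) - DP n (DP m p q) (DM m p q) = - (fls_const (of_int (m - n)) * DP (m + n) p q)"
  "DM m (DP n p q) (DM n p q) - DM n (DP m p q) (DM m p q) = - (fls_const (of_int (m - n)) * DM (m + n) p q)"
proof -
  have X: "fls_X_intpow i * (fls_X_intpow j * r) = fls_X_intpow (i + j) * r" for i j and r :: "complex fls"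
    by (rule fls_eqI) (simp; simp add: algebra_simps)
  have dX: "fls_deriv (fls_X_intpow j) = of_int j * (fls_X_intpow (j - 1) :: complex fls)" for j
  proof (rule fls_eqI)
    show "fls_deriv (fls_X_intpow j) $$ n = (of_int j * (fls_X_intpow (j - 1) :: complex fls)) $$ n" for n
      by (cases "n = j - 1") (auto simp: fls_of_int)
  qed
  have rule: "nabP (r * p) (r * q) = fls_deriv r * p + r * nabP p q"
    "nabM (r * p) (r * q) = fls_deriv r * q + r * nabM p q" for r p q
    by (simp_all add: nabP_def nabM_def algebra_simps)
  have P: "DP m (DP n p q) (DM n p q) = of_int (n + 1) * (fls_X_intpow (m + n + 1) * nabP p q)
      + fls_X_intpow (m + n + 2) * nabP (nabP p q) (nabM p q)" for m n
  proof -
    have "DP m (DP n p q) (DM n p q) = of_int (n + 1) * (fls_X_intpow (m + 1) * (fls_X_intpow n * nabP p q))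
      + fls_X_intpow (m + 1) * (fls_X_intpow (n + 1) * nabP (nabP p q) (nabM p q))"
      unfolding DP_def DM_def rule dX distrib_left by (simp only: mult_ac add_diff_cancel)
    moreover have "m + 1 + n = m + n + 1" "m + 1 + (n + 1) = m + n + 2" by simp_all
    ultimately show ?thesis unfolding X by simp
  qed
  have M: "DM m (DP n p q) (DM n p q) = of_int (n + 1) * (fls_X_intpow (m + n + 1) * nabM p q)
      + fls_X_intpow (m + n + 2) * nabM (nabP p q) (nabM p q)" for m n
  proof -
    have "DM m (DP n p q) (DM n p q) = of_int (n + 1) * (fls_X_intpow (m + 1) * (fls_X_intpow n * nabM p q))
      + fls_X_intpow (m + 1) * (fls_X_intpow (n + 1) * nabM (nabP p q) (nabM p q))"
      unfolding DP_def DM_def rule dX distrib_left by (simp only: mult_ac add_diff_cancel)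
    moreover have "m + 1 + n = m + n + 1" "m + 1 + (n + 1) = m + n + 2" by simp_all
    ultimately show ?thesis unfolding X by simp
  qed
  have comb: "(of_int (n + 1) * a + r) - (of_int (m + 1) * a + r) = - (fls_const (of_int (m - n)) * a)" for a r :: "complex fls"
    by (simp only: fls_of_int[symmetric]) (simp add: algebra_simps)
  show "DP m (DP n p q) (DM n p q) - DP n (DP m p q) (DM m p q) = - (fls_const (of_int (m - n)) * DP (m + n) p q)"
    unfolding P[of m n] P[of n m] add.commute[of n m] comb unfolding DP_def by (rule refl)
  show "DM m (DP n p q) (DM n p q) - DM n (DP m p q) (DM m p q) = - (fls_const (of_int (m - n)) * DM (m + n) p q)"
    unfolding M[of m n] M[of n m] add.commute[of n m] comb unfolding DM_def by (rule refl)
qed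

text \<open>\<open>Vir m\<close> acts on sections by \<open>- z^(m+1)\<close> times the covariant
  derivative, and by \<open>witt_bracket\<close> these operators satisfy the relations without
  centre.\<close>

lemma vcomm_Psi: "vcomm m n (Psi p q v) = Psi p q (vcomm m n v)"
proof -
  have V: "Vir m (Psi p q v) = Psi p q (Vir m v) - Psi (DP m p q) (DM m p q) v" for m p q v
    by (simp only: Vir_Psi DP_def DM_def)
  have W: "Vir m (Vir n (Psi p q v)) = Psi p q (Vir m (Vir n v)) - Psi (DP m p q) (DM m p q) (Vir n v)
     - Psi (DP n p q) (DM n p q) (Vir m v) + Psi (DP m (DP n p q) (DM n p q)) (DM m (DP n p q) (DM n p q)) v" for m n
    by (simp add: V lin_simps[OF lin_Vir])
  have Z: "Psi (DP m (DP n p q) (DM n p q)) (DM m (DP n p q) (DM n p q)) v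
      - Psi (DP n (DP m p q) (DM m p q)) (DM n (DP m p q) (DM m p q)) v
      = - (of_int (m - n) \<cdot> Psi (DP (m + n) p q) (DM (m + n) p q) v)"
    unfolding Psi_diff witt_bracket Psi_const by (simp only: Psi_def S_uminus minus_add_distrib)
  have "vcomm m n (Psi p q v) = Psi p q (Vir m (Vir n v)) - Psi p q (Vir n (Vir m v))
     - of_int (m - n) \<cdot> Psi p q (Vir (m + n) v)
     + (Psi (DP m (DP n p q) (DM n p q)) (DM m (DP n p q) (DM n p q)) v
      - Psi (DP n (DP m p q) (DM m p q)) (DM n (DP m p q) (DM m p q)) v
      + of_int (m - n) \<cdot> Psi (DP (m + n) p q) (DM (m + n) p q) v)"
    unfolding vcomm_def W V[of "m + n"] by (simp add: scale_right_diff_distrib)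
  then show ?thesis
    unfolding Z by (simp add: vcomm_def lin_simps[OF lin_Psi])
qed

lemma vcomm_psi: "vcomm m n (psi a k v) = psi a k (vcomm m n v)"
proof -
  have "psi Plus k v = Psi (fls_X_intpow k) 0 v" "psi Minus k v = Psi 0 (fls_X_intpow k) v" for v
    by (simp_all add: Psi_def S_X S_zero)
  then show ?thesis using vcomm_Psi by (cases a) simp_all
qed

lemma simple:
  assumes "subspace U" "\<And>a n v. v \<in> U \<Longrightarrow> psi a n v \<in> U" "v \<in> U" "v \<noteq> 0"
  shows "U = UNIV"
proof -
  obtain f1 f2 h1 h2 where "clifford_frame scale psi Cf vac \<xi> \<epsilon> f1 f2 h1 h2" using frame_exists by blast
  then show ?thesis using assms by (rule clifford_frame.psi_closed_simple)
qed

lemma singular: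
  assumes "\<And>a n. 1 \<le> n \<Longrightarrow> psi a n v = 0"
  shows "\<exists>s. v = s \<cdot> vac"
proof -
  obtain f1 f2 h1 h2 where "clifford_frame scale psi Cf vac \<xi> \<epsilon> f1 f2 h1 h2" using frame_exists by blast
  then show ?thesis using assms by (rule clifford_frame.psi_singular)
qed

text \<open>The defect maps \<open>vac\<close> to a vector killed by the positive modes, hence to a
  multiple of \<open>vac\<close>. As it commutes with all modes, it is that multiple everywhere by
  cyclicity.\<close>

lemma vcomm_scalar: "\<exists>z. \<forall>m n v. vcomm m n v = z m n \<cdot> v"
proof -
  have "\<exists>s. \<forall>v. vcomm m n v = s \<cdot> v" for m n
  proof -
    have "\<exists>s. vcomm m n vac = s \<cdot> vac"
      by (rule singular) (simp add: psi_vac lin_simps[OF lin_vcomm] flip: vcomm_psi)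
    then obtain s where s: "vcomm m n vac = s \<cdot> vac" by blast
    have "{v. vcomm m n v = s \<cdot> v} = UNIV"
    proof (rule psi_cyclic)
      show "subspace {v. vcomm m n v = s \<cdot> v}"
        by (rule subspaceI) (simp_all add: lin_simps[OF lin_vcomm] scale_right_distrib mult.commute)
    qed (simp_all add: s vcomm_psi lin_simps[OF lin_psi])
    then show ?thesis by blast
  qed
  then show ?thesis by metis
qed

end

section \<open>The Virasoro relations\<close>

text \<open>The functional \<open>lam\<close> is the vacuum coefficient for the ordering that puts \<open>psi Minus\<close> to the left.\<close>

locale clifford_fock = clifford_module scale psi Cf vac \<xi> \<epsilon>
  for scale :: "complex \<Rightarrow> 'v :: ab_group_add \<Rightarrow> 'v" (infixr \<open>\<cdot>\<close> 75)
    and psi Cf vac \<xi> \<epsilon> +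
  fixes lam :: "'v \<Rightarrow> complex"
  assumes lam_add: "\<And>u v. lam (u + v) = lam u + lam v"
    and lam_scale: "\<And>s v. lam (s \<cdot> v) = s * lam v"
    and lam_vac: "lam vac = 1"
    and lam_Minus_Plus: "\<And>p q. p \<le> 0 \<Longrightarrow> q \<le> 0 \<Longrightarrow> lam (psi Minus p (psi Plus q vac)) = 0"
begin

lemma lam_zero: "lam 0 = 0"
  using lam_scale[of 0 0] by simp

lemma lam_neg: "lam (- v) = - lam v"
  using lam_add[of v "- v"] by (simp add: lam_zero add_eq_0_iff2)

lemma lam_diff: "lam (u - v) = lam u - lam v"
  using lam_add[of u "- v"] by (simp add: lam_neg)

lemma lam_sum: "lam (sum g A) = (\<Sum>i\<in>A. lam (g i))"
  by (induction A rule: infinite_finite_induct) (simp_all add: lam_zero lam_add)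

lemmas lam_simps = lam_add lam_scale lam_zero lam_neg lam_diff lam_sum

lemma theta_flip: "theta i j + theta j i = 1"
  by (simp add: theta_def)

lemma sum_theta: "n \<le> 0 \<Longrightarrow> (\<Sum>i\<in>{n..0}. theta i (n - i)) = of_int (1 - n) / 2"
proof -
  assume n: "n \<le> 0"
  have "(\<Sum>i\<in>{n..0}. theta i (n - i)) = (\<Sum>i\<in>{n..0}. theta (n - i) i)"
    by (rule sum.reindex_bij_witness[of _ "\<lambda>i. n - i" "\<lambda>i. n - i"]) auto
  moreover have "(\<Sum>i\<in>{n..0}. theta i (n - i)) + (\<Sum>i\<in>{n..0}. theta (n - i) i) = of_int (1 - n)"
    using n by (simp add: theta_flip flip: sum.distrib)
  ultimately show ?thesis by (simp add: mult.commute)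
qed

text \<open>The value of \<open>lam\<close> on \<open>Vir n vac\<close>: the constant of
  \<open>Vir n\<close> minus the \<open>(1 - n) / 2\<close> contractions that arise when every
  \<open>psi Minus\<close> is moved to the left.\<close>

definition vd :: "int \<Rightarrow> complex" where
  "vd n = vc n + of_int (n - 1) / 2 * Cf n Minus Plus"

lemma Vir_vac_neg:
  assumes n: "n \<le> 0"
  shows "Vir n vac = (\<Sum>i\<in>{n..0}. psi Minus i (psi Plus (n - i) vac)) + vd n \<cdot> vac"
proof -
  have I: "{n - 1<..<1} = {n..0}" by auto
  have "pair Minus i Plus (n - i) = Cf n Minus Plus" if "i \<in> {n..0}" for i
    using that by (auto simp: pair_def)
  then have "(\<Sum>i\<in>{n..0}. theta i (n - i) * pair Minus i Plus (n - i)) = of_int (1 - n) / 2 * Cf n Minus Plus"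
    using sum_theta[OF n] by (simp add: sum_distrib_right[symmetric])
  moreover have "Vir n vac = (\<Sum>i\<in>{n..0}. psi Minus i (psi Plus (n - i) vac))
      - (\<Sum>i\<in>{n..0}. theta i (n - i) * pair Minus i Plus (n - i)) \<cdot> vac + vc n \<cdot> vac"
    using Vir_eq[of 1 vac n] psi_vac unfolding I
    by (simp add: nop_eq sum_subtractf scale_sum_left)
  ultimately show ?thesis
    by (simp add: vd_def scale_left_distrib scale_left_diff_distrib diff_divide_distrib left_diff_distrib)
qed

lemma lam_Vir_vac: "lam (Vir n vac) = vd n"
proof (cases "n \<le> 0")
  case True
  then show ?thesis
    by (simp add: Vir_vac_neg lam_simps lam_vac lam_Minus_Plus)
next
  case False
  then have "of_int (n - 1) * Cf n Minus Plus = (0 :: complex)"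
    by (cases "n = 1") (auto simp: Cf_high)
  then show ?thesis using False by (simp add: Vir_vac lam_simps lam_vac vd_def)
qed

lemma pair_self: "pair a m a n = Cf (m + n) a a"
  by (cases a) (simp_all add: pair_def)

text \<open>The weight depends on \<open>i + q\<close> only, so \<open>lam\<close> may be averaged
  over both orders of the two modes, and the average is half their anticommutator.\<close>

lemma lam_square:
  "(\<Sum>i\<in>{n..0}. \<Sum>q\<in>{n..0}. g (i + q) * lam (psi a i (psi a q vac)))
    = (\<Sum>i\<in>{n..0}. \<Sum>q\<in>{n..0}. g (i + q) * Cf (i + q) a a) / 2"
proof -
  let ?l = "\<lambda>i q. lam (psi a i (psi a q vac))"
  have l: "?l i q + ?l q i = Cf (i + q) a a" for i q
    using arg_cong[OF psi_swap[of a i a q vac], of lam] by (simp add: lam_simps lam_vac pair_self)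
  have "(\<Sum>i\<in>{n..0}. \<Sum>q\<in>{n..0}. g (i + q) * ?l i q) = (\<Sum>i\<in>{n..0}. \<Sum>q\<in>{n..0}. g (i + q) * ?l q i)"
    by (subst sum.swap) (simp add: add.commute)
  moreover have "(\<Sum>i\<in>{n..0}. \<Sum>q\<in>{n..0}. g (i + q) * ?l i q) + (\<Sum>i\<in>{n..0}. \<Sum>q\<in>{n..0}. g (i + q) * ?l q i)
      = (\<Sum>i\<in>{n..0}. \<Sum>q\<in>{n..0}. g (i + q) * Cf (i + q) a a)"
    by (simp add: l flip: sum.distrib distrib_left)
  ultimately show ?thesis by (simp add: mult.commute)
qed

text \<open>Move \<open>Vir m\<close> to the vacuum, where it leaves a multiple of a vector on which
  \<open>lam\<close> vanishes. The commutators on the way replace one mode by modes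
  \<open>p\<close>: those with \<open>1 \<le> p\<close> contract with \<open>psi Plus j\<close>,
  those with \<open>p \<le> 0\<close> remain, and then \<open>lam\<close> keeps only products of
  equal signs.\<close>

lemma lam_Vir_step:
  assumes m: "1 \<le> m" and i: "i \<le> 0" and j: "j \<le> 0"
  shows "lam (Vir m (psi Minus i (psi Plus j vac))) =
      (\<Sum>p\<in>{1..1 - j}. pair Minus i Plus (m - p) * pair Minus p Plus j)
    - (\<Sum>p\<in>{i + j..0}. Cf (i + m - p) Minus Minus * lam (psi Plus p (psi Plus j vac)))
    - (\<Sum>p\<in>{1..1 - j}. Cf (i + m - p) Minus Minus * Cf (p + j) Plus Plus)
    + (\<Sum>q\<in>{i + j..0}. Cf (j + m - q) Plus Plus * lam (psi Minus i (psi Minus q vac)))"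
proof -
  let ?y = "psi Plus j vac"
  have y: "psi a k ?y = 0" if "2 - j \<le> k" for a k
  proof -
    have "psi a k ?y = pair a k Plus j \<cdot> vac - psi Plus j (psi a k vac)" by (rule psi_swap)
    then show ?thesis using that j by (simp add: pair_high psi_vac lin_simps[OF lin_psi])
  qed
  have pos: "lam (psi a p ?y) = pair a p Plus j" if "1 \<le> p" for a p
    using that psi_swap[of a p Plus j vac] by (simp add: psi_vac lin_simps[OF lin_psi] lam_simps lam_vac)
  have split: "{i + j..<2 - j} = {i + j..0} \<union> {1..1 - j}" "{i + j..0} \<inter> {1..1 - j} = {}"
    using i j by auto
  have ivl: "{i + j..<1} = {i + j..0}" by auto
  have A: "lam (S Minus (fls_X_intpow (m + 1) * nab Minus Plus (fls_X_intpow i)) ?y)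
     = (\<Sum>p\<in>{1..1 - j}. pair Minus i Plus (m - p) * pair Minus p Plus j)"
  proof -
    have "S Minus (fls_X_intpow (m + 1) * nab Minus Plus (fls_X_intpow i)) ?y
       = (\<Sum>p\<in>{i + j..<2 - j}. pair Minus i Plus (m - p) \<cdot> psi Minus p ?y)"
      by (rule S_nab_sum[OF y]) (use m j in auto)
    then show ?thesis
      using j unfolding split(1)
      by (simp add: sum.union_disjoint split(2) lam_simps lam_Minus_Plus pos)
  qed
  have B: "lam (S Plus (fls_X_intpow (m + 1) * nab Minus Minus (fls_X_intpow i)) ?y)
     = (\<Sum>p\<in>{i + j..0}. Cf (i + m - p) Minus Minus * lam (psi Plus p ?y))
     + (\<Sum>p\<in>{1..1 - j}. Cf (i + m - p) Minus Minus * Cf (p + j) Plus Plus)"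
  proof -
    have "S Plus (fls_X_intpow (m + 1) * nab Minus Minus (fls_X_intpow i)) ?y
       = (\<Sum>p\<in>{i + j..<2 - j}. pair Minus i Minus (m - p) \<cdot> psi Plus p ?y)"
      by (rule S_nab_sum[OF y]) (use m j in auto)
    then show ?thesis
      unfolding split(1)
      by (simp add: sum.union_disjoint split(2) lam_simps pos pair_self add_diff_eq)
  qed
  have C: "lam (psi Minus i (S Minus (fls_X_intpow (m + 1) * nab Plus Plus (fls_X_intpow j)) vac))
     = (\<Sum>q\<in>{i + j..0}. Cf (j + m - q) Plus Plus * lam (psi Minus i (psi Minus q vac)))"
  proof -
    have "S Minus (fls_X_intpow (m + 1) * nab Plus Plus (fls_X_intpow j)) vac
       = (\<Sum>q\<in>{i + j..<1}. pair Plus j Plus (m - q) \<cdot> psi Minus q vac)"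
      by (rule S_nab_sum[OF psi_vac]) (use m i in auto)
    then show ?thesis
      unfolding ivl by (simp add: lin_simps[OF lin_psi] lam_simps pair_self add_diff_eq)
  qed
  have D: "lam (psi Minus i (S Plus (fls_X_intpow (m + 1) * nab Plus Minus (fls_X_intpow j)) vac)) = 0"
  proof -
    have "S Plus (fls_X_intpow (m + 1) * nab Plus Minus (fls_X_intpow j)) vac
       = (\<Sum>q\<in>{i + j..<1}. pair Plus j Minus (m - q) \<cdot> psi Plus q vac)"
      by (rule S_nab_sum[OF psi_vac]) (use m i in auto)
    then show ?thesis
      unfolding ivl using i by (simp add: lin_simps[OF lin_psi] lam_simps lam_Minus_Plus)
  qed
  have "Vir m (psi Minus i ?y) = psi Minus i (vc m \<cdot> ?y)
     + psi Minus i (S Minus (fls_X_intpow (m + 1) * nab Plus Plus (fls_X_intpow j)) vac)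
     - psi Minus i (S Plus (fls_X_intpow (m + 1) * nab Plus Minus (fls_X_intpow j)) vac)
     + (S Minus (fls_X_intpow (m + 1) * nab Minus Plus (fls_X_intpow i)) ?y
       - S Plus (fls_X_intpow (m + 1) * nab Minus Minus (fls_X_intpow i)) ?y)"
    unfolding Vir_psi Vir_vac[OF m] by (simp only: lin_simps[OF lin_psi]) (simp add: algebra_simps)
  from arg_cong[OF this, of lam] show ?thesis
    unfolding lam_simps A B C D lin_scale[OF lin_psi] lam_Minus_Plus[OF i j] by simp
qed

lemma vc_eq': "vc n = 1 / 2 * ((\<Sum>s\<in>{n - 1..1}. Cf s Minus Plus * Cf (n - s) Minus Plus)
    - (\<Sum>s\<in>{n - 1..1}. Cf s Plus Plus * Cf (n - s) Minus Minus))"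
  using vc_eq[of "{n - 1..1}" n] Cf_sym[of _ Plus Minus] by (simp add: sum_subtractf)

text \<open>Each pairing is a symplectic term plus an entry of \<open>C\<close>. Two symplectic
  terms give the anomaly, mixed products the term linear in \<open>C\<close>, and two entries the
  quadratic one.\<close>

lemma lam_diag_sum:
  assumes m: "1 \<le> m" and n: "n \<le> 0"
  shows "(\<Sum>i\<in>{n..0}. \<Sum>p\<in>{1..1 - (n - i)}. pair Minus i Plus (m - p) * pair Minus p Plus (n - i))
    = of_int (m - n) / 2 * (\<Sum>s\<in>{m + n - 1..1}. Cf s Minus Plus * Cf (m + n - s) Minus Plus)
      + of_int (m - n) * of_int (m + n - 1) / 2 * Cf (m + n) Minus Plus
      - (if m + n = 0 then of_int (m ^ 3 - m) / 6 else 0)"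
proof -
  let ?C = "\<lambda>k. Cf k Minus Plus"
  \<comment> \<open>In the variable \<open>s = p - i\<close> the symplectic terms sit at
    \<open>s = m\<close> and at \<open>s = - n\<close>.\<close>
  define H where "H i s = ((if s = m then - of_int i else 0) + ?C (m - s)) * ((if s = - n then - of_int (i + s) else 0) + ?C (n + s))" for i s
  have "pair Minus i Plus (m - p) * pair Minus p Plus (n - i) = H i (p - i)" for i p
    by (auto simp: H_def pair_def algebra_simps)
  then have "(\<Sum>i\<in>{n..0}. \<Sum>p\<in>{1..1 - (n - i)}. pair Minus i Plus (m - p) * pair Minus p Plus (n - i))
     = (\<Sum>s\<in>{1..1 - n}. \<Sum>i\<in>{1 - s..0}. H i s)"
    using sum_shear[OF n, of H] by simp
  also have "\<dots> = (\<Sum>s\<in>{1..1 - n}. (if s = m then (if s = - n then (\<Sum>i\<in>{1 - s..0}. of_int i * of_int i) + of_int s * (\<Sum>i\<in>{1 - s..0}. of_int i) else 0) else 0)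
     + ((if s = m then - (\<Sum>i\<in>{1 - s..0}. of_int i) * ?C (n + s) else 0)
     + ((if s = - n then - ((\<Sum>i\<in>{1 - s..0}. of_int i) + of_int s * of_int s) * ?C (m - s) else 0)
     + of_int s * (?C (m - s) * ?C (n + s)))))"
  proof (rule sum.cong[OF refl])
    fix s assume s: "s \<in> {1..1 - n}"
    have "H i s = (if s = m then (if s = - n then of_int i * of_int i + of_int s * of_int i else 0) else 0)
     + ((if s = m then - of_int i * ?C (n + s) else 0)
     + ((if s = - n then - (of_int i * ?C (m - s)) - of_int s * ?C (m - s) else 0)
     + (?C (m - s) * ?C (n + s))))" for i
      by (simp add: H_def algebra_simps)
    then show "(\<Sum>i\<in>{1 - s..0}. H i s) = (if s = m then (if s = - n then (\<Sum>i\<in>{1 - s..0}. of_int i * of_int i) + of_int s * (\<Sum>i\<in>{1 - s..0}. of_int i) else 0) else 0)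
     + ((if s = m then - (\<Sum>i\<in>{1 - s..0}. of_int i) * ?C (n + s) else 0)
     + ((if s = - n then - ((\<Sum>i\<in>{1 - s..0}. of_int i) + of_int s * of_int s) * ?C (m - s) else 0)
     + of_int s * (?C (m - s) * ?C (n + s))))"
      using s by (simp add: sum.distrib sum_negf sum_subtractf sum_distrib_left sum_distrib_right distrib_right minus_mult_left[symmetric] del: minus_mult_left minus_add_distrib)
  qed
  also have "\<dots> = (\<Sum>s\<in>{1..1 - n}. (if s = m then (if s = - n then (\<Sum>i\<in>{1 - s..0}. of_int i * of_int i) + of_int s * (\<Sum>i\<in>{1 - s..0}. of_int i) else 0) else 0))
     + ((\<Sum>s\<in>{1..1 - n}. (if s = m then - (\<Sum>i\<in>{1 - s..0}. of_int i) * ?C (n + s) else 0))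
     + ((\<Sum>s\<in>{1..1 - n}. (if s = - n then - ((\<Sum>i\<in>{1 - s..0}. of_int i) + of_int s * of_int s) * ?C (m - s) else 0))
     + (\<Sum>s\<in>{1..1 - n}. of_int s * (?C (m - s) * ?C (n + s)))))"
    by (simp only: sum.distrib)
  also have "(\<Sum>s\<in>{1..1 - n}. (if s = m then (if s = - n then (\<Sum>i\<in>{1 - s..0}. of_int i * of_int i) + of_int s * (\<Sum>i\<in>{1 - s..0}. of_int i) else 0) else 0))
      = (if m + n = 0 then - (of_int (m ^ 3 - m) / 6) else (0 :: complex))"
  \<comment> \<open>Both conditions hold only for \<open>s = m = - n\<close>; there the power sums
    combine to \<open>m (m - 1) (2 m - 1) / 6 - m^2 (m - 1) / 2 = - (m^3 - m) / 6\<close>.\<close>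
  proof (cases "m + n = 0")
    case True
    then have "n = - m" by simp
    then show ?thesis using m
      by (simp add: sum_interval_neg[of m] power3_eq_cube field_simps)
  qed (auto intro!: sum.neutral)
  also have "(\<Sum>s\<in>{1..1 - n}. (if s = m then - (\<Sum>i\<in>{1 - s..0}. of_int i) * ?C (n + s) else 0))
      = of_int m * (of_int m - 1) / 2 * ?C (n + m)"
    using m Cf_high[of "n + m"] by (auto simp: sum_interval_neg(1)[of m])
  also have "(\<Sum>s\<in>{1..1 - n}. (if s = - n then - ((\<Sum>i\<in>{1 - s..0}. of_int i) + of_int s * of_int s) * ?C (m - s) else 0))
      = - (of_int n * (of_int n - 1) / 2) * ?C (m + n)"
  proof -
    have *: "(\<Sum>i\<in>{1 + n..0}. of_int i) = - (of_int n * of_int n + of_int n) / (2 :: complex)"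
      using n sum_interval_neg(1)[of "- n"] by (simp add: algebra_simps)
    show ?thesis
      using n by (simp add: *) (auto simp: field_simps)
  qed
  also have "(\<Sum>s\<in>{1..1 - n}. of_int s * (?C (m - s) * ?C (n + s))) = of_int (m - n) / 2 * (\<Sum>s\<in>{m - 1..1 - n}. ?C (m - s) * ?C (n + s))"
  proof -
    \<comment> \<open>The lower end \<open>m - 1\<close> makes the range symmetric under the
      reflection \<open>s \<mapsto> m - n - s\<close>. Terms below it vanish because
      \<open>C_k = 0\<close> for \<open>k > 1\<close>, and a new point \<open>s = 0\<close> has
      weight 0.\<close>
    have "(\<Sum>s\<in>{1..1 - n}. of_int s * (?C (m - s) * ?C (n + s))) = (\<Sum>s\<in>{m - 1..1 - n}. of_int s * (?C (m - s) * ?C (n + s)))"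
    proof (rule sum.mono_neutral_cong)
      show "of_int s * (?C (m - s) * ?C (n + s)) = 0" if "s \<in> {1..1 - n} - {m - 1..1 - n}" for s
        using that Cf_high[of "m - s"] by (cases "1 < m - s") auto
      show "of_int s * (?C (m - s) * ?C (n + s)) = 0" if "s \<in> {m - 1..1 - n} - {1..1 - n}" for s
      proof -
        have "s = 0" using that m by auto
        then show ?thesis by simp
      qed
    qed auto
    also have "\<dots> = of_int (m - 1 + (1 - n)) / 2 * (\<Sum>s\<in>{m - 1..1 - n}. ?C (m - s) * ?C (n + s))"
      by (rule sum_weight_symmetrize) (simp add: algebra_simps)
    finally show ?thesis by (simp add: algebra_simps)
  qed
  also have "(\<Sum>s\<in>{m - 1..1 - n}. ?C (m - s) * ?C (n + s)) = (\<Sum>s\<in>{m + n - 1..1}. ?C s * ?C (m + n - s))"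
    by (rule sum.reindex_bij_witness[of _ "\<lambda>s. m - s" "\<lambda>s. m - s"]) (auto simp: algebra_simps)
  also have "(if m + n = 0 then - (of_int (m ^ 3 - m) / 6) else 0) +
      (of_int m * (of_int m - 1) / 2 * ?C (n + m) +
       (- (of_int n * (of_int n - 1) / 2) * ?C (m + n) +
        of_int (m - n) / 2 * (\<Sum>s\<in>{m + n - 1..1}. ?C s * ?C (m + n - s))))
    = of_int (m - n) / 2 * (\<Sum>s\<in>{m + n - 1..1}. ?C s * ?C (m + n - s))
      + of_int (m - n) * of_int (m + n - 1) / 2 * ?C (m + n)
      - (if m + n = 0 then of_int (m ^ 3 - m) / 6 else 0)"
  proof -
    have "- d + (M * (M - 1) / 2 * c + (- (N * (N - 1) / 2) * c + (M - N) / 2 * S))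
        = (M - N) / 2 * S + (M - N) * (M + N - 1) / 2 * c - d" for d M N S c :: complex
      by (simp add: field_simps)
    from this[of "if m + n = 0 then of_int (m ^ 3 - m) / 6 else 0" "of_int m" "?C (m + n)" "of_int n"]
    show ?thesis by (simp only: add.commute[of n m] of_int_diff of_int_add of_int_1 if_distrib[of uminus] minus_zero cong: if_cong)
  qed
  finally show ?thesis .
qed

text \<open>Regrouped by the index \<open>t\<close> of \<open>P\<close>, the three sums have the
  weights \<open>(1 - (h - t)) / 2\<close>, \<open>- (1 - t) / 2\<close> and
  \<open>- (t - n)\<close> with \<open>h = m + n\<close>. The dependence on \<open>t\<close> cancels
  and \<open>- (m - n) / 2\<close> remains.\<close>

lemma lam_offdiag_sum:
  assumes m: "1 \<le> m" and n: "n \<le> 0"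
  defines "P \<equiv> \<lambda>k. Cf k Plus Plus" and "M \<equiv> \<lambda>k. Cf k Minus Minus"
  shows "(\<Sum>i\<in>{n..0}. \<Sum>q\<in>{n..0}. P (n - i + m - q) * lam (psi Minus i (psi Minus q vac)))
    - (\<Sum>i\<in>{n..0}. \<Sum>p\<in>{n..0}. M (i + m - p) * lam (psi Plus p (psi Plus (n - i) vac)))
    - (\<Sum>i\<in>{n..0}. \<Sum>p\<in>{1..1 - (n - i)}. M (i + m - p) * P (p + (n - i)))
    = - (of_int (m - n) / 2 * (\<Sum>s\<in>{m + n - 1..1}. P s * M (m + n - s)))"
proof -
  let ?h = "m + n"
  have hi: "P k = 0" "M k = 0" if "1 < k" for k
    using that by (simp_all add: P_def M_def Cf_high)
  have A: "(\<Sum>i\<in>{n..0}. \<Sum>q\<in>{n..0}. P (n - i + m - q) * lam (psi Minus i (psi Minus q vac)))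
     = (\<Sum>t\<in>{?h - 1..1}. of_int (1 - (?h - t)) * (P t * M (?h - t))) / 2"
  proof -
    have "(\<Sum>i\<in>{n..0}. \<Sum>q\<in>{n..0}. P (n - i + m - q) * lam (psi Minus i (psi Minus q vac)))
       = (\<Sum>i\<in>{n..0}. \<Sum>q\<in>{n..0}. P (?h - (i + q)) * M (i + q)) / 2"
      using lam_square[of "\<lambda>t. P (?h - t)" Minus n] by (simp add: M_def algebra_simps)
    also have "(\<Sum>i\<in>{n..0}. \<Sum>q\<in>{n..0}. P (?h - (i + q)) * M (i + q)) = (\<Sum>t\<in>{n..0}. of_int (1 - t) * (P (?h - t) * M t))"
      by (rule sum_diagonals_square) (use m hi in auto)
    also have "\<dots> = (\<Sum>t\<in>{?h - 1..1}. of_int (1 - t) * (P (?h - t) * M t))"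
    proof (rule sum.mono_neutral_cong)
      show "of_int (1 - t) * (P (?h - t) * M t) = 0" if "t \<in> {n..0} - {?h - 1..1}" for t
        using that hi(1)[of "?h - t"] by (cases "1 < ?h - t") auto
      show "of_int (1 - t) * (P (?h - t) * M t) = 0" if "t \<in> {?h - 1..1} - {n..0}" for t
      proof -
        have "t = 1" using that m by auto
        then show ?thesis by simp
      qed
    qed auto
    also have "\<dots> = (\<Sum>t\<in>{?h - 1..1}. of_int (1 - (?h - t)) * (P t * M (?h - t)))"
      by (rule sum.reindex_bij_witness[of _ "\<lambda>t. ?h - t" "\<lambda>t. ?h - t"]) auto
    finally show ?thesis .
  qed
  have B: "(\<Sum>i\<in>{n..0}. \<Sum>p\<in>{n..0}. M (i + m - p) * lam (psi Plus p (psi Plus (n - i) vac)))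
     = (\<Sum>t\<in>{?h - 1..1}. of_int (1 - t) * (P t * M (?h - t))) / 2"
  proof -
    have "(\<Sum>i\<in>{n..0}. \<Sum>p\<in>{n..0}. M (i + m - p) * lam (psi Plus p (psi Plus (n - i) vac)))
       = (\<Sum>j\<in>{n..0}. \<Sum>p\<in>{n..0}. M (?h - (p + j)) * lam (psi Plus p (psi Plus j vac)))"
      by (rule sum.reindex_bij_witness[of _ "\<lambda>j. n - j" "\<lambda>i. n - i"]) (auto simp: algebra_simps)
    also have "\<dots> = (\<Sum>p\<in>{n..0}. \<Sum>j\<in>{n..0}. M (?h - (p + j)) * lam (psi Plus p (psi Plus j vac)))"
      by (rule sum.swap)
    also have "\<dots> = (\<Sum>i\<in>{n..0}. \<Sum>q\<in>{n..0}. M (?h - (i + q)) * P (i + q)) / 2"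
      using lam_square[of "\<lambda>t. M (?h - t)" Plus n] by (simp add: P_def)
    also have "(\<Sum>i\<in>{n..0}. \<Sum>q\<in>{n..0}. M (?h - (i + q)) * P (i + q)) = (\<Sum>t\<in>{n..0}. of_int (1 - t) * (M (?h - t) * P t))"
      by (rule sum_diagonals_square) (use m hi in auto)
    also have "\<dots> = (\<Sum>t\<in>{?h - 1..1}. of_int (1 - t) * (P t * M (?h - t)))"
    proof (rule sum.mono_neutral_cong)
      show "of_int (1 - t) * (M (?h - t) * P t) = 0" if "t \<in> {n..0} - {?h - 1..1}" for t
        using that hi(2)[of "?h - t"] by (cases "1 < ?h - t") auto
      show "of_int (1 - t) * (P t * M (?h - t)) = 0" if "t \<in> {?h - 1..1} - {n..0}" for t
      proof -
        have "t = 1" using that m by auto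
        then show ?thesis by simp
      qed
    qed auto
    finally show ?thesis .
  qed
  have C: "(\<Sum>i\<in>{n..0}. \<Sum>p\<in>{1..1 - (n - i)}. M (i + m - p) * P (p + (n - i)))
     = (\<Sum>t\<in>{?h - 1..1}. of_int (t - n) * (P t * M (?h - t)))"
  proof -
    have "(\<Sum>i\<in>{n..0}. \<Sum>p\<in>{1..1 - (n - i)}. M (i + m - p) * P (p + (n - i)))
       = (\<Sum>j\<in>{n..0}. \<Sum>p\<in>{1..1 - j}. P (p + j) * M (?h - (p + j)))"
      by (rule sum.reindex_bij_witness[of _ "\<lambda>j. n - j" "\<lambda>i. n - i"]) (auto simp: algebra_simps)
    also have "\<dots> = (\<Sum>t\<in>{n..1}. of_int (t - n) * (P t * M (?h - t)))"
      using sum_diagonals_triangle[OF n, of "\<lambda>t. P t * M (?h - t)"] .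
    also have "\<dots> = (\<Sum>t\<in>{?h - 1..1}. of_int (t - n) * (P t * M (?h - t)))"
    proof (rule sum.mono_neutral_right)
      show "\<forall>t\<in>{n..1} - {?h - 1..1}. of_int (t - n) * (P t * M (?h - t)) = 0"
        using hi by auto
    qed (use m in auto)
    finally show ?thesis .
  qed
  show ?thesis
    unfolding A B C sum_divide_distrib sum_distrib_left
    by (simp add: algebra_simps diff_divide_distrib add_divide_distrib flip: sum_subtractf sum_negf sum.distrib)
qed

end

section \<open>Generalized eigenspaces of a linear map\<close>

context complex_space
begin

definition gen_eigenspace :: "('v \<Rightarrow> 'v) \<Rightarrow> complex \<Rightarrow> 'v set" where
  "gen_eigenspace T a = {v. \<exists>j. ((\<lambda>v. T v - a \<cdot> v) ^^ j) v = 0}"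

lemma lin_shift: "lin T \<Longrightarrow> lin (\<lambda>v. T v - a \<cdot> v)"
  by (rule linI) (simp_all add: lin_simps scale_right_distrib scale_right_diff_distrib mult.commute)

lemma lin_funpow: "lin T \<Longrightarrow> lin (T ^^ j)"
  by (induction j) (auto intro!: linI simp: lin_simps)

lemma funpow_zero_mono: "lin T \<Longrightarrow> (T ^^ j) v = 0 \<Longrightarrow> j \<le> i \<Longrightarrow> (T ^^ i) v = 0"
proof -
  assume T: "lin T" and z: "(T ^^ j) v = 0" and "j \<le> i"
  then have "(T ^^ i) v = (T ^^ (i - j)) ((T ^^ j) v)"
    by (metis funpow_add le_add_diff_inverse2 o_apply)
  then show ?thesis using z by (simp add: lin_zero[OF lin_funpow[OF T]])
qed

lemma subspace_gen_eigenspace: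
  assumes T: "lin T" shows "subspace (gen_eigenspace T a)"
proof (rule subspaceI)
  let ?N = "\<lambda>v. T v - a \<cdot> v"
  note N = lin_shift[OF T, of a]
  show "0 \<in> gen_eigenspace T a"
    by (auto simp: gen_eigenspace_def intro: exI[of _ 0])
  show "c \<cdot> x \<in> gen_eigenspace T a" if x: "x \<in> gen_eigenspace T a" for c x
  proof -
    from x obtain j where "(?N ^^ j) x = 0" by (auto simp: gen_eigenspace_def)
    then have "(?N ^^ j) (c \<cdot> x) = 0" by (simp add: lin_scale[OF lin_funpow[OF N]])
    then show ?thesis by (auto simp: gen_eigenspace_def)
  qed
  show "x + y \<in> gen_eigenspace T a" if x: "x \<in> gen_eigenspace T a" and y: "y \<in> gen_eigenspace T a" for x y
  proof -
    from x y obtain i j where "(?N ^^ i) x = 0" "(?N ^^ j) y = 0" by (auto simp: gen_eigenspace_def)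
    then have "(?N ^^ max i j) x = 0" "(?N ^^ max i j) y = 0"
      using funpow_zero_mono[OF N] by auto
    then have "(?N ^^ max i j) (x + y) = 0" by (simp add: lin_add[OF lin_funpow[OF N]])
    then show ?thesis by (auto simp: gen_eigenspace_def)
  qed
qed

lemma gen_eigenspace_shift_iff: "T v - a \<cdot> v \<in> gen_eigenspace T a \<Longrightarrow> v \<in> gen_eigenspace T a"
proof -
  assume "T v - a \<cdot> v \<in> gen_eigenspace T a"
  then obtain j where "((\<lambda>v. T v - a \<cdot> v) ^^ j) (T v - a \<cdot> v) = 0" by (auto simp: gen_eigenspace_def)
  then have "((\<lambda>v. T v - a \<cdot> v) ^^ Suc j) v = 0" by (simp only: funpow_Suc_right o_apply)
  then show ?thesis unfolding gen_eigenspace_def by blast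
qed

lemma gen_eigenspace_closed:
  assumes T: "lin T" and v: "v \<in> gen_eigenspace T a"
  shows "T v \<in> gen_eigenspace T a"
proof -
  let ?N = "\<lambda>v. T v - a \<cdot> v"
  obtain j where j: "(?N ^^ j) v = 0" using v by (auto simp: gen_eigenspace_def)
  have "(?N ^^ j) (?N v) = ?N ((?N ^^ j) v)" by (rule funpow_swap1[symmetric])
  then have "(?N ^^ j) (?N v) = 0" by (simp add: j lin_zero[OF T])
  then have "?N v \<in> gen_eigenspace T a" unfolding gen_eigenspace_def by blast
  then have "?N v + a \<cdot> v \<in> gen_eigenspace T a"
    using subspace_add[OF subspace_gen_eigenspace[OF T]] subspace_scale[OF subspace_gen_eigenspace[OF T]] v by blast
  then show ?thesis by simp
qed

text \<open>Peeling off the factors \<open>T - b\<close> one at a time reduces the claim to an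
  eigenvector for \<open>b\<close> in the generalized eigenspace for \<open>a\<close>. On it
  \<open>T - a\<close> is the nonzero scalar \<open>b - a\<close>, yet some power of it
  vanishes.\<close>

lemma gen_eigenspace_inj:
  assumes T: "lin T" and v: "v \<in> gen_eigenspace T a" and "a \<noteq> b" and "((\<lambda>v. T v - b \<cdot> v) ^^ i) v = 0"
  shows "v = 0"
proof -
  let ?M = "\<lambda>v. T v - b \<cdot> v" and ?N = "\<lambda>v. T v - a \<cdot> v"
  have one: "y = 0" if y: "y \<in> gen_eigenspace T a" "?M y = 0" for y
  proof -
    obtain j where j: "(?N ^^ j) y = 0" using y by (auto simp: gen_eigenspace_def)
    have "?N y = (b - a) \<cdot> y" using y by (simp add: scale_left_diff_distrib)
    then have Ny: "?N (s \<cdot> y) = (s * (b - a)) \<cdot> y" for s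
      by (simp add: lin_scale[OF T] scale_left_commute[of a] flip: scale_right_diff_distrib scale_scale)
    have "(?N ^^ j) y = ((b - a) ^ j) \<cdot> y" for j
    proof (induction j)
      case (Suc j)
      then show ?case using Ny[of "(b - a) ^ j"] by (simp add: mult.commute)
    qed simp
    then show ?thesis using j \<open>a \<noteq> b\<close> by simp
  qed
  show ?thesis using assms(4)
  proof (induction i)
    case (Suc i)
    have "(?M ^^ i) v \<in> gen_eigenspace T a"
    proof (induction i)
      case (Suc i)
      then show ?case
        using subspace_diff[OF subspace_gen_eigenspace[OF T]] subspace_scale[OF subspace_gen_eigenspace[OF T]]
          gen_eigenspace_closed[OF T] by simp
    qed (simp add: v)
    from one[OF this] Suc show ?case by simp
  qed simp
qed

text \<open>A power of \<open>T - a l\<close> kills the summand of \<open>l\<close> and leaves a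
  relation among the others. Induction kills their images, and \<open>gen_eigenspace_inj\<close> the
  vectors themselves.\<close>

lemma gen_eigenspaces_independent:
  assumes T: "lin T" and "finite F" and "inj_on a F"
    and "\<And>k. k \<in> F \<Longrightarrow> u k \<in> gen_eigenspace T (a k)" and "(\<Sum>k\<in>F. u k) = 0" and "k \<in> F"
  shows "u k = 0"
  using assms(2-)
proof (induction F arbitrary: u k rule: finite_induct)
  case (insert l F)
  let ?N = "\<lambda>v. T v - a l \<cdot> v"
  have ul: "u l \<in> gen_eigenspace T (a l)" using insert.prems(2) by simp
  then obtain j where j: "(?N ^^ j) (u l) = 0" by (auto simp: gen_eigenspace_def)
  have N: "lin (?N ^^ j)" by (rule lin_funpow[OF lin_shift[OF T]])
  have mem: "(?N ^^ i) y \<in> gen_eigenspace T b" if "y \<in> gen_eigenspace T b" for i y b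
  proof (induction i)
    case (Suc i)
    then show ?case
      using subspace_diff[OF subspace_gen_eigenspace[OF T]] subspace_scale[OF subspace_gen_eigenspace[OF T]]
        gen_eigenspace_closed[OF T] by simp
  qed (simp add: that)
  have "(\<Sum>k\<in>F. (?N ^^ j) (u k)) = (?N ^^ j) (\<Sum>k\<in>insert l F. u k)"
    using insert.hyps j by (simp add: lin_add[OF N] lin_sum[OF N])
  then have sum0: "(\<Sum>k\<in>F. (?N ^^ j) (u k)) = 0"
    by (simp only: insert.prems(3) lin_zero[OF N])
  have zero: "(?N ^^ j) (u i) = 0" if "i \<in> F" for i
    by (rule insert.IH[where u = "\<lambda>i. (?N ^^ j) (u i)"])
      (use insert.prems that sum0 mem in \<open>auto simp: inj_on_insert\<close>)
  have F0: "u i = 0" if "i \<in> F" for i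
  proof (rule gen_eigenspace_inj[OF T _ _ zero[OF that]])
    show "u i \<in> gen_eigenspace T (a i)" using insert.prems(2) that by simp
    show "a i \<noteq> a l" using insert.prems(1) insert.hyps that by (auto simp: inj_on_def)
  qed
  then have "(\<Sum>k\<in>insert l F. u k) = u l" using insert.hyps by simp
  then have "u l = 0" using insert.prems(3) by simp
  then show ?case using F0 insert.prems(4) by blast
qed simp

end

context clifford_module
begin

text \<open>For \<open>n \<ge> 2 K\<close> one of the two modes in every bilinear is at least
  \<open>K\<close>. This starts the descending induction in
  \<open>gen_eigenspace_Vir_closed\<close>.\<close>

lemma Vir_smooth: "\<exists>K. \<forall>n\<ge>K. Vir n v = 0"
proof -
  obtain K where K: "\<And>a n. K \<le> n \<Longrightarrow> psi a n v = 0" using smooth by blast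
  have "Vir n v = 0" if "max 3 (2 * K) \<le> n" for n
  proof -
    have "{n - K<..<K} = {}" using that by auto
    then show ?thesis using Vir_eq[of K v n] K vc_pos(3)[of n] that by simp
  qed
  then show ?thesis by blast
qed

end

section \<open>The Virasoro relations and the decomposition of the Clifford module\<close>

context clifford_fock
begin

text \<open>The difference of the two sides commutes with all \<open>psi a n\<close>, so it is a scalar. The functional
  \<open>lam\<close> computes it if \<open>1 \<le> m\<close>, and the Jacobi identity with \<open>Vir 1\<close> gives the other cases.\<close>

theorem virasoro:
  "Vir m (Vir n v) - Vir n (Vir m v) = of_int (m - n) \<cdot> Vir (m + n) v
     + (if m + n = 0 then - (of_int (m ^ 3 - m) / 6) else 0) \<cdot> v"
proof -
  obtain z where z: "\<And>m n v. vcomm m n v = z m n \<cdot> v" using vcomm_scalar by blast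
  have br: "Vir m (Vir n v) = Vir n (Vir m v) + of_int (m - n) \<cdot> Vir (m + n) v + z m n \<cdot> v" for m n v
    using z[of m n v] by (simp add: vcomm_def algebra_simps)
  have z_lam: "z m n = lam (vcomm m n vac)" for m n
    by (simp add: z lam_simps lam_vac)
  have anti: "z n m = - z m n" for m n
    unfolding z_lam by (simp add: vcomm_def lam_simps add.commute[of n m] algebra_simps)
  have zpp: "z m n = 0" if "1 \<le> m" "1 \<le> n" for m n
  proof (cases "m = n")
    case True
    then show ?thesis using anti[of m m] by simp
  next
    case False
    then have "3 \<le> m + n" using that by simp
    then show ?thesis unfolding z_lam using that
      by (simp add: vcomm_def Vir_vac lin_simps[OF lin_Vir] lam_simps lam_vac vc_pos(3))
  qed
  have zpn: "z m n = (if m + n = 0 then - (of_int (m ^ 3 - m) / 6) else 0)" if m: "1 \<le> m" and n: "n \<le> 0" for m n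
  proof -
    have "lam (Vir m (Vir n vac)) = (\<Sum>i\<in>{n..0}. lam (Vir m (psi Minus i (psi Plus (n - i) vac)))) + vd n * vc m"
      unfolding Vir_vac_neg[OF n] by (simp add: lin_simps[OF lin_Vir] lam_simps Vir_vac[OF m] lam_vac)
    also have "(\<Sum>i\<in>{n..0}. lam (Vir m (psi Minus i (psi Plus (n - i) vac))))
       = (\<Sum>i\<in>{n..0}. (\<Sum>p\<in>{1..1 - (n - i)}. pair Minus i Plus (m - p) * pair Minus p Plus (n - i))
         - (\<Sum>p\<in>{n..0}. Cf (i + m - p) Minus Minus * lam (psi Plus p (psi Plus (n - i) vac)))
         - (\<Sum>p\<in>{1..1 - (n - i)}. Cf (i + m - p) Minus Minus * Cf (p + (n - i)) Plus Plus)
         + (\<Sum>q\<in>{n..0}. Cf (n - i + m - q) Plus Plus * lam (psi Minus i (psi Minus q vac))))"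
    proof (rule sum.cong[OF refl])
      fix i assume "i \<in> {n..0}"
      then have i: "i \<le> 0" "n - i \<le> 0" by simp_all
      have "i + (n - i) = n" by simp
      then show "lam (Vir m (psi Minus i (psi Plus (n - i) vac))) = (\<Sum>p\<in>{1..1 - (n - i)}. pair Minus i Plus (m - p) * pair Minus p Plus (n - i))
         - (\<Sum>p\<in>{n..0}. Cf (i + m - p) Minus Minus * lam (psi Plus p (psi Plus (n - i) vac)))
         - (\<Sum>p\<in>{1..1 - (n - i)}. Cf (i + m - p) Minus Minus * Cf (p + (n - i)) Plus Plus)
         + (\<Sum>q\<in>{n..0}. Cf (n - i + m - q) Plus Plus * lam (psi Minus i (psi Minus q vac)))"
        using lam_Vir_step[OF m i] by simp
    qed
    also have "\<dots> = (\<Sum>i\<in>{n..0}. \<Sum>p\<in>{1..1 - (n - i)}. pair Minus i Plus (m - p) * pair Minus p Plus (n - i))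
       + ((\<Sum>i\<in>{n..0}. \<Sum>q\<in>{n..0}. Cf (n - i + m - q) Plus Plus * lam (psi Minus i (psi Minus q vac)))
       - (\<Sum>i\<in>{n..0}. \<Sum>p\<in>{n..0}. Cf (i + m - p) Minus Minus * lam (psi Plus p (psi Plus (n - i) vac)))
       - (\<Sum>i\<in>{n..0}. \<Sum>p\<in>{1..1 - (n - i)}. Cf (i + m - p) Minus Minus * Cf (p + (n - i)) Plus Plus))"
      by (simp only: sum.distrib sum_subtractf) simp
    also have "(\<Sum>i\<in>{n..0}. \<Sum>p\<in>{1..1 - (n - i)}. pair Minus i Plus (m - p) * pair Minus p Plus (n - i))
       + ((\<Sum>i\<in>{n..0}. \<Sum>q\<in>{n..0}. Cf (n - i + m - q) Plus Plus * lam (psi Minus i (psi Minus q vac)))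
       - (\<Sum>i\<in>{n..0}. \<Sum>p\<in>{n..0}. Cf (i + m - p) Minus Minus * lam (psi Plus p (psi Plus (n - i) vac)))
       - (\<Sum>i\<in>{n..0}. \<Sum>p\<in>{1..1 - (n - i)}. Cf (i + m - p) Minus Minus * Cf (p + (n - i)) Plus Plus))
      = of_int (m - n) * vd (m + n) - (if m + n = 0 then of_int (m ^ 3 - m) / 6 else 0)"
    proof -
      have id: "k / 2 * S1 + k * h / 2 * c - d + - (k / 2 * S2) = k * (1 / 2 * (S1 - S2) + h / 2 * c) - d"
        for k h c d S1 S2 :: complex by (simp add: field_simps)
      show ?thesis
        unfolding lam_diag_sum[OF m n] lam_offdiag_sum[OF m n] vd_def[of "m + n"] vc_eq'[of "m + n"] id ..
    qed
    finally have 1: "lam (Vir m (Vir n vac)) = of_int (m - n) * vd (m + n)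
        - (if m + n = 0 then of_int (m ^ 3 - m) / 6 else 0) + vd n * vc m"
      .
    have 2: "lam (Vir n (Vir m vac)) = vc m * vd n"
      by (simp add: Vir_vac[OF m] lin_simps[OF lin_Vir] lam_simps lam_Vir_vac)
    show ?thesis unfolding z_lam vcomm_def by (simp add: lam_simps 1 2 lam_Vir_vac)
  qed
  \<comment> \<open>The anomaly \<open>m^3 - m\<close> vanishes at \<open>m = 1\<close>, so the
    relations of \<open>Vir 1\<close> with all other modes are available before the remaining
    cases.\<close>
  have z1: "z 1 n = 0" for n
    using zpp[of 1 n] zpn[of 1 n] by (cases "1 \<le> n") simp_all
  have jac: "of_int (1 - m) * z (m + 1) n + of_int (1 - n) * z m (n + 1) = 0" for m n
  proof -
    have b1: "Vir 1 (Vir k v) = Vir k (Vir 1 v) + of_int (1 - k) \<cdot> Vir (k + 1) v" for k v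
      using br[of 1 k v] by (simp add: z1 add.commute)
    let ?l = "\<lambda>v. lam v"
    have e1: "Vir 1 (Vir m (Vir n vac)) = Vir m (Vir n (Vir 1 vac)) + of_int (1 - n) \<cdot> Vir m (Vir (n + 1) vac)
        + of_int (1 - m) \<cdot> Vir (m + 1) (Vir n vac)"
      by (simp add: b1 lin_simps[OF lin_Vir])
    have e2: "Vir 1 (Vir n (Vir m vac)) = Vir n (Vir m (Vir 1 vac)) + of_int (1 - m) \<cdot> Vir n (Vir (m + 1) vac)
        + of_int (1 - n) \<cdot> Vir (n + 1) (Vir m vac)"
      by (simp add: b1 lin_simps[OF lin_Vir])
    have e3: "Vir 1 (Vir m (Vir n vac)) = Vir 1 (Vir n (Vir m vac))
        + of_int (m - n) \<cdot> (Vir (m + n) (Vir 1 vac) + of_int (1 - (m + n)) \<cdot> Vir (m + n + 1) vac) + z m n \<cdot> Vir 1 vac"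
      unfolding br[of m n vac] by (simp add: b1 lin_simps[OF lin_Vir])
    have e4: "Vir m (Vir n (Vir 1 vac)) = Vir n (Vir m (Vir 1 vac)) + of_int (m - n) \<cdot> Vir (m + n) (Vir 1 vac) + z m n \<cdot> Vir 1 vac"
      by (rule br)
    have e5: "Vir m (Vir (n + 1) vac) = Vir (n + 1) (Vir m vac) + of_int (m - (n + 1)) \<cdot> Vir (m + n + 1) vac + z m (n + 1) \<cdot> vac"
      using br[of m "n + 1" vac] by (simp add: add.assoc)
    have e6: "Vir (m + 1) (Vir n vac) = Vir n (Vir (m + 1) vac) + of_int (m + 1 - n) \<cdot> Vir (m + n + 1) vac + z (m + 1) n \<cdot> vac"
      using br[of "m + 1" n vac] by (simp add: algebra_simps)
    \<comment> \<open>The Jacobi identity on \<open>vac\<close> after \<open>lam\<close>: an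
      elimination between the complex values of the vectors involved.\<close>
    have elim: "(1 - M) * z2 + (1 - N) * z1 = 0"
      if "x1 = A1 + (1 - N) * P + (1 - M) * Q" "x2 = A2 + (1 - M) * R + (1 - N) * T"
        "x1 = x2 + (M - N) * (U + (1 - (M + N)) * V) + Z" "A1 = A2 + (M - N) * U + Z"
        "P = T + (M - (N + 1)) * V + z1" "Q = R + (M + 1 - N) * V + z2"
      for M N x1 x2 A1 A2 P Q R T U V Z z1 z2 :: complex
    proof -
      have "(1 - M) * z2 + (1 - N) * z1 = (A2 + (M - N) * U + Z + (1 - N) * (T + (M - (N + 1)) * V + z1)
          + (1 - M) * (R + (M + 1 - N) * V + z2))
        - (A2 + (1 - M) * R + (1 - N) * T + (M - N) * (U + (1 - (M + N)) * V) + Z)"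
        by (simp add: algebra_simps)
      also have "\<dots> = 0"
        using trans[OF sym[OF that(1)] that(3)] unfolding that(2,4-6) by (simp only: right_minus_eq)
      finally show ?thesis .
    qed
    note l = arg_cong[where f = lam]
    show ?thesis
      using l[OF e1] l[OF e2] l[OF e3] l[OF e4] l[OF e5] l[OF e6]
      unfolding lam_simps lam_vac mult_1_right of_int_diff of_int_add of_int_1 by (rule elim)
  qed
  have znn: "m \<le> 1 \<Longrightarrow> n \<le> 0 \<Longrightarrow> z m n = 0" for m n
  proof (induction m arbitrary: n rule: int_le_induct)
    case (step m)
    \<comment> \<open>\<open>jac\<close> at \<open>(m - 1, n - 1)\<close> relates
      \<open>z (m - 1) n\<close> to \<open>z m (n - 1)\<close>, which is zero by induction; the
      coefficient \<open>2 - n\<close> is nonzero for \<open>n \<le> 0\<close>.\<close>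
    have "of_int (1 - (n - 1)) * z (m - 1) n = (0 :: complex)"
      using jac[of "m - 1" "n - 1"] step.IH[of "n - 1"] step.prems by simp
    moreover have "of_int (1 - (n - 1)) \<noteq> (0 :: complex)" using step.prems by (simp only: of_int_eq_0_iff)
    ultimately show ?case by simp
  qed (simp add: z1)
  have "z m n = (if m + n = 0 then - (of_int (m ^ 3 - m) / 6) else 0)"
  proof -
    consider "1 \<le> m" "1 \<le> n" | "1 \<le> m" "n \<le> 0" | "m \<le> 0" "n \<le> 0" | "m \<le> 0" "1 \<le> n" by linarith
    then show ?thesis
    proof cases
      case 1
      then show ?thesis using zpp by simp
    next
      case 2
      then show ?thesis using zpn by simp
    next
      case 3
      show ?thesis
      proof (cases "m + n = 0")
        case True
        then have "m = 0" "n = 0" using 3 by simp_all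
        then show ?thesis using znn[of m n] by simp
      qed (use znn[of m n] 3 in simp)
    next
      case 4
      have zmn: "z m n = - (if m + n = 0 then - (of_int (n ^ 3 - n) / 6) else 0)"
        using zpn[OF 4(2,1)] unfolding anti[of n m] add.commute[of n m]
        by (metis minus_minus)
      show ?thesis
      proof (cases "m + n = 0")
        case True
        then have "n = - m" by simp
        then show ?thesis using zmn by (simp add: field_simps)
      qed (simp add: zmn)
    qed
  qed
  then show ?thesis using br[of m n v] by simp
qed

text \<open>\<open>Vir 1\<close> and \<open>Vir n\<close> commute up to a multiple of
  \<open>Vir (n + 1)\<close>. So the claim for \<open>n\<close> follows from that for
  \<open>n + 1\<close> and from that for \<open>(Vir 1 - a) v\<close>: a descent in
  \<open>n\<close>, starting where \<open>Vir n v = 0\<close>, inside an induction on the nilpotency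
  order.\<close>

lemma gen_eigenspace_Vir_closed:
  assumes "v \<in> gen_eigenspace (Vir 1) a"
  shows "Vir n v \<in> gen_eigenspace (Vir 1) a"
proof -
  let ?G = "gen_eigenspace (Vir 1) a" and ?N = "\<lambda>v. Vir 1 v - a \<cdot> v"
  note G = subspace_gen_eigenspace[OF lin_Vir, of 1 a]
  have NV: "?N (Vir n v) = Vir n (?N v) + of_int (1 - n) \<cdot> Vir (n + 1) v" for n v
    using virasoro[of 1 n v] by (simp add: lin_simps[OF lin_Vir] algebra_simps)
  have "(?N ^^ j) v = 0 \<Longrightarrow> Vir n v \<in> ?G" for j n v
  proof (induction j arbitrary: n v)
    case 0
    then show ?case using subspace_0[OF G] by (simp add: lin_simps[OF lin_Vir])
  next
    case (Suc j)
    then have IH: "Vir n (?N v) \<in> ?G" for n by (simp only: funpow_Suc_right o_apply)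
    obtain K where K: "\<And>n. K \<le> n \<Longrightarrow> Vir n v = 0" using Vir_smooth by blast
    show ?case
    proof (cases "K \<le> n")
      case True
      then show ?thesis using K subspace_0[OF G] by simp
    next
      case False
      then have "n \<le> K" by simp
      then show ?thesis
      proof (induction n rule: int_le_induct)
        case base
        then show ?case using K subspace_0[OF G] by simp
      next
        case (step n)
        have "?N (Vir (n - 1) v) \<in> ?G"
          unfolding NV using step by (simp add: subspace_add[OF G] subspace_scale[OF G] IH)
        then show ?case by (rule gen_eigenspace_shift_iff)
      qed
    qed
  qed
  then show ?thesis using assms by (auto simp: gen_eigenspace_def)
qed

theorem whittaker_decomposition:
  "\<exists>w W. (\<forall>k. w k \<in> W k \<and> w k \<noteq> 0 \<and> Vir 1 (w k) = (\<xi> * (of_int k + \<epsilon>)) \<cdot> w k \<and> Vir 2 (w k) = (\<xi>\<^sup>2 / 2) \<cdot> w k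
       \<and> (\<forall>n\<ge>3. Vir n (w k) = 0))
     \<and> (\<forall>k :: int. subspace (W k) \<and> (\<forall>n. \<forall>v\<in>W k. Vir n v \<in> W k))
     \<and> (\<forall>k U. subspace U \<longrightarrow> (\<forall>n. \<forall>v\<in>U. Vir n v \<in> U) \<longrightarrow> w k \<in> U \<longrightarrow> W k \<subseteq> U)
     \<and> (\<forall>v. \<exists>!u. (\<forall>k. u k \<in> W k) \<and> finite {k. u k \<noteq> 0} \<and> v = (\<Sum>k | u k \<noteq> 0. u k))"
proof -
  obtain f1 f2 h1 h2 where "clifford_frame scale psi Cf vac \<xi> \<epsilon> f1 f2 h1 h2" using frame_exists by blast
  then interpret fr: clifford_frame scale psi Cf vac \<xi> \<epsilon> f1 f2 h1 h2 .
  obtain w where w: "\<And>k. w k \<noteq> 0" "\<And>k. Vir 1 (w k) = (\<xi> * (of_int k + \<epsilon>)) \<cdot> w k"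
      "\<And>k. Vir 2 (w k) = (\<xi>\<^sup>2 / 2) \<cdot> w k" "\<And>k n. 3 \<le> n \<Longrightarrow> Vir n (w k) = 0"
    and gen: "\<And>U. subspace U \<Longrightarrow> (\<forall>m. \<forall>v\<in>U. Vir m v \<in> U) \<Longrightarrow> (\<forall>k. w k \<in> U) \<Longrightarrow> U = UNIV"
    using fr.whittaker_vectors_exist by blast
  define a where "a k = \<xi> * (of_int k + \<epsilon>)" for k :: int
  define W where "W k = \<Inter>{U. subspace U \<and> (\<forall>n. \<forall>v\<in>U. Vir n v \<in> U) \<and> w k \<in> U}" for k
  have Ws: "subspace (W k)" for k unfolding W_def by (rule subspace_Inter) auto
  have WL: "Vir n v \<in> W k" if "v \<in> W k" for n v k using that by (auto simp: W_def)
  have wW: "w k \<in> W k" for k by (auto simp: W_def)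
  have Wmin: "W k \<subseteq> U" if "subspace U" "\<forall>n. \<forall>v\<in>U. Vir n v \<in> U" "w k \<in> U" for k U
    using that by (auto simp: W_def)
  have WG: "W k \<subseteq> gen_eigenspace (Vir 1) (a k)" for k
  proof (rule Wmin)
    show "subspace (gen_eigenspace (Vir 1) (a k))" by (rule subspace_gen_eigenspace[OF lin_Vir])
    show "\<forall>n. \<forall>v\<in>gen_eigenspace (Vir 1) (a k). Vir n v \<in> gen_eigenspace (Vir 1) (a k)"
      using gen_eigenspace_Vir_closed by blast
    show "w k \<in> gen_eigenspace (Vir 1) (a k)"
      unfolding gen_eigenspace_def by (auto intro!: exI[of _ 1] simp: w a_def)
  qed
  have inj: "inj a" using xi_nz by (auto simp: a_def inj_def)
  \<comment> \<open>The sum of all \<open>W k\<close>. The set \<open>F\<close> only has to contain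
    the support, so adding two elements needs no care for cancellation.\<close>
  define R where "R = {v. \<exists>u F. finite F \<and> (\<forall>k. u k \<in> W k) \<and> (\<forall>k. k \<notin> F \<longrightarrow> u k = 0) \<and> v = (\<Sum>k\<in>F. u k)}"
  have "R = UNIV"
  proof (rule gen)
    show "subspace R"
    proof (rule subspaceI)
      show "0 \<in> R" unfolding R_def
        by (rule CollectI, rule exI[of _ "\<lambda>_. 0"], rule exI[of _ "{}"]) (simp add: subspace_0[OF Ws])
      fix x y c assume "x \<in> R"
      then obtain u F where u: "finite F" "\<forall>k. u k \<in> W k" "\<forall>k. k \<notin> F \<longrightarrow> u k = 0" "x = (\<Sum>k\<in>F. u k)"
        by (auto simp: R_def)
      show "c \<cdot> x \<in> R" unfolding R_def
        by (rule CollectI, rule exI[of _ "\<lambda>k. c \<cdot> u k"], rule exI[of _ F])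
          (use u subspace_scale[OF Ws] in \<open>simp add: scale_sum_right\<close>)
      assume "y \<in> R"
      then obtain u' F' where u': "finite F'" "\<forall>k. u' k \<in> W k" "\<forall>k. k \<notin> F' \<longrightarrow> u' k = 0" "y = (\<Sum>k\<in>F'. u' k)"
        by (auto simp: R_def)
      have "x = (\<Sum>k\<in>F \<union> F'. u k)" "y = (\<Sum>k\<in>F \<union> F'. u' k)"
        unfolding u(4) u'(4) by (rule sum.mono_neutral_left; use u u' in auto)+
      then show "x + y \<in> R" unfolding R_def
        by (intro CollectI exI[of _ "\<lambda>k. u k + u' k"] exI[of _ "F \<union> F'"])
          (use u u' subspace_add[OF Ws] in \<open>simp add: sum.distrib\<close>)
    qed
    show "\<forall>m. \<forall>v\<in>R. Vir m v \<in> R"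
    proof (intro allI ballI)
      fix m v assume "v \<in> R"
      then obtain u F where u: "finite F" "\<forall>k. u k \<in> W k" "\<forall>k. k \<notin> F \<longrightarrow> u k = 0" "v = (\<Sum>k\<in>F. u k)"
        by (auto simp: R_def)
      show "Vir m v \<in> R" unfolding R_def
        by (rule CollectI, rule exI[of _ "\<lambda>k. Vir m (u k)"], rule exI[of _ F])
          (use u WL in \<open>simp add: lin_simps[OF lin_Vir]\<close>)
    qed
    show "\<forall>k. w k \<in> R"
    proof
      fix k
      show "w k \<in> R" unfolding R_def
        by (rule CollectI, rule exI[of _ "\<lambda>i. if i = k then w k else 0"], rule exI[of _ "{k}"])
          (use wW subspace_0[OF Ws] in simp)
    qed
  qed
  have dec: "\<exists>!u. (\<forall>k. u k \<in> W k) \<and> finite {k. u k \<noteq> 0} \<and> v = (\<Sum>k | u k \<noteq> 0. u k)" for v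
  proof -
    have "v \<in> R" by (simp add: \<open>R = UNIV\<close>)
    then obtain u F where u: "finite F" "\<forall>k. u k \<in> W k" "\<forall>k. k \<notin> F \<longrightarrow> u k = 0" "v = (\<Sum>k\<in>F. u k)"
      by (auto simp: R_def)
    have sub: "{k. u k \<noteq> 0} \<subseteq> F" using u(3) by auto
    have fin: "finite {k. u k \<noteq> 0}" using sub u(1) by (rule finite_subset)
    have sum: "v = (\<Sum>k | u k \<noteq> 0. u k)" unfolding u(4)
      by (rule sum.mono_neutral_right) (use u(1) sub in auto)
    show ?thesis
    proof (rule ex1I[of _ u])
      show "(\<forall>k. u k \<in> W k) \<and> finite {k. u k \<noteq> 0} \<and> v = (\<Sum>k | u k \<noteq> 0. u k)"
        using u(2) fin sum by blast
      fix u' assume u': "(\<forall>k. u' k \<in> W k) \<and> finite {k. u' k \<noteq> 0} \<and> v = (\<Sum>k | u' k \<noteq> 0. u' k)"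
      define F where "F = {k. u k \<noteq> 0} \<union> {k. u' k \<noteq> 0}"
      have F: "finite F" using fin u' by (simp add: F_def)
      have "v = (\<Sum>k\<in>F. u k)" unfolding sum
        by (rule sum.mono_neutral_left) (use F in \<open>auto simp: F_def\<close>)
      moreover have "(\<Sum>k | u' k \<noteq> 0. u' k) = (\<Sum>k\<in>F. u' k)"
        by (rule sum.mono_neutral_left) (use F in \<open>auto simp: F_def\<close>)
      ultimately have 0: "(\<Sum>k\<in>F. u' k - u k) = 0"
        using u' by (simp add: sum_subtractf)
      have mem: "u' k - u k \<in> gen_eigenspace (Vir 1) (a k)" for k
        using subspace_diff[OF Ws, of "u' k" k "u k"] u' u(2) WG by blast
      have "u' k - u k = 0" if "k \<in> F" for k
        using gen_eigenspaces_independent[OF lin_Vir F inj_on_subset[OF inj subset_UNIV] mem 0 that] .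
      then have "u' k = u k" for k by (cases "k \<in> F") (auto simp: F_def)
      then show "u' = u" by blast
    qed
  qed
  show ?thesis
    by (rule exI[of _ w], rule exI[of _ W]) (use w Ws WL wW Wmin dec in auto)
qed

end

section \<open>The free algebra as a vector space, and its representations\<close>

definition word :: "(sign \<times> int) list \<Rightarrow> free_alg" where
  "word l = Poly_Mapping.single l 1"

lemma word_Nil: "word [] = 1"
  by (simp add: word_def flip: single_one zero_list_def)

lemma word_append: "word (k @ l) = word k * word l"
  by (simp add: word_def mult_single plus_list_def)

lemma word_Cons: "word (s # l) = gen (fst s) (snd s) * word l"
  using word_append[of "[s]" l] by (simp add: gen_def word_def)

lemma scal_add: "scal (c + d) = scal c + scal d"
  and scal_mult: "scal (c * d) = scal c * scal d"
  and scal_0: "scal 0 = 0"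
  and scal_uminus: "scal (- c) = - scal c"
  by (simp_all add: scal_def single_add mult_single plus_list_def single_uminus)

lemma scal_1: "scal 1 = 1"
  by (simp add: scal_def flip: single_one zero_list_def)

lemma single_scal_word: "Poly_Mapping.single l c = scal c * word l"
  by (simp add: scal_def word_def mult_single plus_list_def)

lemma free_alg_sum: "x = (\<Sum>l\<in>Poly_Mapping.keys x. scal (Poly_Mapping.lookup x l) * word l)"
proof (rule poly_mapping_eqI)
  fix k
  show "Poly_Mapping.lookup x k = Poly_Mapping.lookup (\<Sum>l\<in>Poly_Mapping.keys x. scal (Poly_Mapping.lookup x l) * word l) k"
    by (simp add: lookup_sum lookup_single when_def in_keys_iff flip: single_scal_word)
qed

lemma free_alg_induct:
  assumes "\<And>l. l \<in> Poly_Mapping.keys x \<Longrightarrow> P (word l)" and "P 0"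
    and "\<And>x y. P x \<Longrightarrow> P y \<Longrightarrow> P (x + y)" and "\<And>c x. P x \<Longrightarrow> P (scal c * x)"
  shows "P x"
proof -
  have "P (\<Sum>l\<in>A. scal (Poly_Mapping.lookup x l) * word l)"
    if "finite A" "A \<subseteq> Poly_Mapping.keys x" for A
    using that by (induction A) (simp_all add: assms)
  from this[of "Poly_Mapping.keys x"] show ?thesis
    using free_alg_sum[of x] by simp
qed

lemma free_alg_induct':
  assumes "\<And>l. P (word l)" and "\<And>x y. P x \<Longrightarrow> P y \<Longrightarrow> P (x + y)" and "\<And>c x. P x \<Longrightarrow> P (scal c * x)"
  shows "P x"
proof -
  have "P (scal 0 * word [])" using assms by blast
  then show ?thesis using assms by (intro free_alg_induct[of x P]) (simp_all add: scal_0)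
qed

lemma scal_comm: "x * scal c = scal c * x"
proof (induction x rule: free_alg_induct')
  case (1 l)
  then show ?case by (simp add: word_def scal_def mult_single plus_list_def)
next
  case (2 x y)
  then show ?case by (simp only: distrib_left distrib_right)
next
  case (3 d x)
  have "scal d * scal c = scal c * scal d"
    unfolding scal_mult[symmetric] by (simp only: mult.commute)
  then have "scal d * (scal c * x) = scal c * (scal d * x)"
    by (simp only: mult.assoc[symmetric])
  then show ?case by (simp only: mult.assoc 3)
qed

lemma scal_left_comm: "x * (scal c * y) = scal c * (x * y)"
  by (simp only: mult.assoc[symmetric] scal_comm[of x])

lemma gen_scal: "gen a n * (scal c * y) = scal c * (gen a n * y)"
  by (rule scal_left_comm)

lemma scal_scal: "scal c * (scal d * y) = scal (c * d) * y"
  by (simp add: scal_mult mult.assoc)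

text \<open>Words are a basis of the free algebra, so functions on words extend linearly.\<close>

locale free_target = complex_space scale
  for scale :: "complex \<Rightarrow> 'v :: ab_group_add \<Rightarrow> 'v" (infixr \<open>\<cdot>\<close> 75) +
  fixes f :: "(sign \<times> int) list \<Rightarrow> 'v"
begin

definition ext :: "free_alg \<Rightarrow> 'v" where
  "ext x = (\<Sum>l\<in>Poly_Mapping.keys x. Poly_Mapping.lookup x l \<cdot> f l)"

lemma ext_add: "ext (x + y) = ext x + ext y"
  unfolding ext_def by (rule setsum_keys_plus_distrib) (simp_all add: scale_left_distrib)

lemma ext_superset:
  assumes "finite A" "Poly_Mapping.keys x \<subseteq> A"
  shows "ext x = (\<Sum>l\<in>A. Poly_Mapping.lookup x l \<cdot> f l)"
  unfolding ext_def by (rule sum.mono_neutral_left[OF assms]) (auto simp: in_keys_iff)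

lemma lookup_scal_mult: "Poly_Mapping.lookup (scal c * x) l = c * Poly_Mapping.lookup x l"
proof -
  have "Poly_Mapping.lookup (Poly_Mapping.map ((*) c) x) l = c * Poly_Mapping.lookup x l"
    by (simp add: map.rep_eq when_def)
  then show ?thesis by (simp only: mult_map_scale_conv_mult scal_def zero_list_def)
qed

lemma ext_scal: "ext (scal c * x) = c \<cdot> ext x"
proof -
  have "Poly_Mapping.keys (scal c * x) \<subseteq> Poly_Mapping.keys x"
    by (auto simp: in_keys_iff lookup_scal_mult)
  then have "ext (scal c * x) = (\<Sum>l\<in>Poly_Mapping.keys x. Poly_Mapping.lookup (scal c * x) l \<cdot> f l)"
    by (intro ext_superset) simp_all
  then show ?thesis by (simp add: lookup_scal_mult ext_def scale_sum_right)
qed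

lemma ext_word: "ext (word l) = f l"
  by (simp add: ext_def word_def)

lemma ext_zero: "ext 0 = 0"
  by (simp add: ext_def)

end

interpretation free_space: complex_space "\<lambda>c x. scal c * x"
  by unfold_locales (simp_all add: algebra_simps scal_add scal_mult scal_1)

context complex_space
begin

definition word_act :: "(sign \<Rightarrow> int \<Rightarrow> 'v \<Rightarrow> 'v) \<Rightarrow> 'v \<Rightarrow> (sign \<times> int) list \<Rightarrow> 'v" where
  "word_act \<psi> v l = foldr (\<lambda>s. \<psi> (fst s) (snd s)) l v"

definition free_act :: "(sign \<Rightarrow> int \<Rightarrow> 'v \<Rightarrow> 'v) \<Rightarrow> free_alg \<Rightarrow> 'v \<Rightarrow> 'v" where
  "free_act \<psi> x v = free_target.ext scale (word_act \<psi> v) x"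

context
  fixes \<psi> :: "sign \<Rightarrow> int \<Rightarrow> 'v \<Rightarrow> 'v"
  assumes lin_\<psi>: "\<And>a n. lin (\<psi> a n)"
begin

interpretation t: free_target scale "word_act \<psi> v" for v ..

lemma free_act_word: "free_act \<psi> (word l) v = word_act \<psi> v l"
  and free_act_add: "free_act \<psi> (x + y) v = free_act \<psi> x v + free_act \<psi> y v"
  and free_act_scal_mult: "free_act \<psi> (scal c * x) v = c \<cdot> free_act \<psi> x v"
  and free_act_0: "free_act \<psi> 0 v = 0"
  by (simp_all add: free_act_def t.ext_word t.ext_add t.ext_scal t.ext_zero)

lemma free_act_1: "free_act \<psi> 1 v = v"
  using free_act_word[of "[]" v] by (simp add: word_Nil word_act_def)

lemma free_act_scal: "free_act \<psi> (scal c) v = c \<cdot> v"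
  using free_act_scal_mult[of c 1 v] by (simp add: free_act_1)

lemma free_act_gen: "free_act \<psi> (gen a n) v = \<psi> a n v"
  using free_act_word[of "[(a, n)]" v] by (simp add: word_Cons word_Nil word_act_def)

lemma free_act_uminus: "free_act \<psi> (- x) v = - free_act \<psi> x v"
  using free_act_add[of x "- x" v] by (simp add: free_act_0 add_eq_0_iff2)

lemma free_act_diff: "free_act \<psi> (x - y) v = free_act \<psi> x v - free_act \<psi> y v"
  using free_act_add[of x "- y" v] by (simp add: free_act_uminus)

lemma lin_word_act: "lin (\<lambda>v. word_act \<psi> v l)"
  by (induction l) (auto intro!: linI simp: word_act_def lin_simps lin_simps[OF lin_\<psi>])

lemma lin_free_act: "lin (free_act \<psi> x)"
proof (induction x rule: free_alg_induct')
  case (1 l)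
  then show ?case using lin_word_act by (simp add: free_act_word[abs_def])
next
  case (2 x y)
  then show ?case by (auto intro!: linI simp: free_act_add lin_simps scale_right_distrib)
next
  case (3 c x)
  then show ?case by (auto intro!: linI simp: free_act_scal_mult lin_simps scale_right_distrib mult.commute)
qed

lemma free_act_mult: "free_act \<psi> (x * y) v = free_act \<psi> x (free_act \<psi> y v)"
proof (induction x rule: free_alg_induct')
  case (1 k)
  show ?case
  proof (induction y rule: free_alg_induct')
    case (1 l)
    then show ?case by (simp add: free_act_word word_act_def flip: word_append)
  qed (simp_all add: distrib_left free_act_add lin_add[OF lin_free_act] scal_left_comm free_act_scal_mult
      lin_scale[OF lin_free_act])
qed (simp_all add: distrib_right free_act_add free_act_scal_mult mult.assoc)

end

end

section \<open>The Fock space\<close>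

text \<open>Order of the factors in a monomial: \<open>Minus\<close> before \<open>Plus\<close>,
  then increasing modes, in agreement with the functional \<open>lam\<close>. The condition
  \<open>m \<le> 0\<close> keeps a positive mode from ever being in place.\<close>

fun before :: "sign \<times> int \<Rightarrow> sign \<times> int \<Rightarrow> bool" where
  "before (a, m) (b, n) \<longleftrightarrow> m \<le> 0 \<and> (a = Minus \<and> b = Plus \<or> a = b \<and> m < n)"

lemma before_trans: "before s t \<Longrightarrow> before t u \<Longrightarrow> before s u"
  by (cases s; cases t; cases u) auto

lemma before_irrefl: "\<not> before s s"
  by (cases s) auto

lemma before_total: "snd s \<le> 0 \<Longrightarrow> snd t \<le> 0 \<Longrightarrow> \<not> before s t \<Longrightarrow> s \<noteq> t \<Longrightarrow> before t s"
  by (cases s; cases t; cases "fst s"; cases "fst t") auto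

lemma before_nonpos: "before s t \<Longrightarrow> snd s \<le> 0"
  by (cases s; cases t) auto

text \<open>The order is strict because the square of a generator is a scalar.\<close>

definition fock_words :: "(sign \<times> int) list set" where
  "fock_words = {l. sorted_wrt before l \<and> (\<forall>s\<in>set l. snd s \<le> 0)}"

definition fock_set :: "free_alg set" where
  "fock_set = {y. Poly_Mapping.keys y \<subseteq> fock_words}"

lemma keys_scal_mult: "Poly_Mapping.keys (scal c * x) \<subseteq> Poly_Mapping.keys x"
  using keys_mult[of "scal c" x] by (auto simp: scal_def plus_list_def split: if_splits)

lemma keys_gen_mult: "Poly_Mapping.keys (gen a n * x) \<subseteq> (#) (a, n) ` Poly_Mapping.keys x"
  using keys_mult[of "gen a n" x] by (auto simp: gen_def plus_list_def)

lemma keys_word: "Poly_Mapping.keys (word l) = {l}"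
  by (simp add: word_def)

lemma fock_set_closed:
  "0 \<in> fock_set" "x \<in> fock_set \<Longrightarrow> y \<in> fock_set \<Longrightarrow> x + y \<in> fock_set"
  "x \<in> fock_set \<Longrightarrow> y \<in> fock_set \<Longrightarrow> x - y \<in> fock_set" "x \<in> fock_set \<Longrightarrow> - x \<in> fock_set"
  "x \<in> fock_set \<Longrightarrow> scal c * x \<in> fock_set"
  using keys_add[of x y] keys_diff[of x y] keys_scal_mult[of c x]
  by (auto simp: fock_set_def in_keys_iff)

text \<open>\<open>B_pos\<close> is the consistency condition for a vacuum killed by the positive
  modes: the anticommutator of two of them must vanish on it.\<close>

locale fock_model =
  fixes B :: "sign \<times> int \<Rightarrow> sign \<times> int \<Rightarrow> complex"
  assumes B_sym: "B u v = B v u" and B_pos: "0 < snd u \<Longrightarrow> 0 < snd v \<Longrightarrow> B u v = 0"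
begin

abbreviation g :: "sign \<times> int \<Rightarrow> free_alg" where "g s \<equiv> gen (fst s) (snd s)"

text \<open>The action of a generator on an ordered monomial, by the Clifford relations: it is moved to
  the right until it is in place or, if its mode is positive, annihilates the vacuum.\<close>

fun clw :: "sign \<times> int \<Rightarrow> (sign \<times> int) list \<Rightarrow> free_alg" where
  "clw u [] = (if snd u \<le> 0 then word [u] else 0)"
| "clw u (s # l) = (if before u s then word (u # s # l)
     else if u = s then scal (B s s / 2) * word l
     else scal (B u s) * word l - g s * clw u l)"

interpretation t: free_target "\<lambda>c x. scal c * x" "clw u" for u
  by (simp add: free_target_def free_space.complex_space_axioms)

definition cl :: "sign \<times> int \<Rightarrow> free_alg \<Rightarrow> free_alg" where
  "cl u = t.ext u"

lemma cl_add: "cl u (x + y) = cl u x + cl u y"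
  and cl_scal: "cl u (scal c * x) = scal c * cl u x"
  and cl_word: "cl u (word l) = clw u l"
  and cl_zero: "cl u 0 = 0"
  by (simp_all add: cl_def t.ext_add t.ext_scal t.ext_word t.ext_zero)

lemma cl_uminus: "cl u (- x) = - cl u x"
  using cl_add[of u x "- x"] by (simp add: cl_zero add_eq_0_iff2)

lemma cl_diff: "cl u (x - y) = cl u x - cl u y"
  using cl_add[of u x "- y"] by (simp add: cl_uminus)

lemma cl_above:
  assumes "snd u \<le> 0" "\<And>l s. l \<in> Poly_Mapping.keys y \<Longrightarrow> s \<in> set l \<Longrightarrow> before u s"
  shows "cl u y = g u * y"
proof (rule free_alg_induct[of y "\<lambda>y. cl u y = g u * y"])
  fix l assume "l \<in> Poly_Mapping.keys y"
  then show "cl u (word l) = g u * word l"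
    unfolding cl_word word_Cons[symmetric] using assms by (cases l) auto
qed (simp_all add: cl_add cl_scal cl_zero distrib_left gen_scal scal_scal)

lemma cl_gen:
  "before u s \<Longrightarrow> cl u (g s * y) = g u * (g s * y)"
  "cl s (g s * y) = scal (B s s / 2) * y"
  "\<not> before u s \<Longrightarrow> u \<noteq> s \<Longrightarrow> cl u (g s * y) = scal (B u s) * y - g s * cl u y"
  by (induction y rule: free_alg_induct')
    (simp_all add: cl_add cl_scal cl_word distrib_left right_diff_distrib gen_scal scal_scal before_irrefl mult.commute
       flip: word_Cons)

text \<open>Straightening only deletes letters or inserts \<open>u\<close>, the latter only with a
  mode \<open>\<le> 0\<close> and at its place in the order.\<close>

lemma clw_keys:
  assumes "l \<in> fock_words" "l' \<in> Poly_Mapping.keys (clw u l)"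
  shows "l' \<in> fock_words \<and> set l' \<subseteq> set l \<union> {v. v = u \<and> snd u \<le> 0}"
  using assms
proof (induction l arbitrary: l')
  case Nil
  then show ?case by (auto simp: keys_word fock_words_def split: if_splits)
next
  case (Cons s l)
  have l: "l \<in> fock_words" and s: "snd s \<le> 0" "\<And>t. t \<in> set l \<Longrightarrow> before s t"
    using Cons.prems(1) by (auto simp: fock_words_def)
  consider "before u s" | "u = s" | "\<not> before u s" "u \<noteq> s" by blast
  then show ?case
  proof cases
    case 1
    then have "l' = u # s # l" using Cons.prems(2) by (simp add: keys_word)
    then show ?thesis using 1 Cons.prems(1) s before_trans[OF 1] before_nonpos[OF 1]
      by (auto simp: fock_words_def)
  next
    case 2
    then have "l' \<in> Poly_Mapping.keys (word l)"
      using Cons.prems(2) keys_scal_mult[of "B s s / 2" "word l"] by (auto simp: before_irrefl)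
    then show ?thesis using l by (auto simp: keys_word)
  next
    case 3
    then have "l' = l \<or> (\<exists>k\<in>Poly_Mapping.keys (clw u l). l' = s # k)"
      using Cons.prems(2) keys_diff[of "scal (B u s) * word l" "g s * clw u l"]
        keys_scal_mult[of "B u s" "word l"] keys_gen_mult[of "fst s" "snd s" "clw u l"]
      by (auto simp: keys_word)
    then show ?thesis
    proof
      assume "\<exists>k\<in>Poly_Mapping.keys (clw u l). l' = s # k"
      then obtain k where k: "k \<in> Poly_Mapping.keys (clw u l)" "l' = s # k" by blast
      note IH = Cons.IH[OF l k(1)]
      have "before s t" if "t \<in> set k" for t
      proof -
        have "t \<in> set l \<or> t = u \<and> snd u \<le> 0" using IH that by blast
        then show ?thesis using s(2) before_total[OF _ s(1) 3] by blast
      qed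
      then show ?thesis using IH k(2) s(1) by (auto simp: fock_words_def)
    qed (use l in auto)
  qed
qed

lemma cl_keys:
  assumes "y \<in> fock_set" "l' \<in> Poly_Mapping.keys (cl u y)"
  shows "\<exists>l\<in>Poly_Mapping.keys y. l' \<in> fock_words \<and> set l' \<subseteq> set l \<union> {v. v = u \<and> snd u \<le> 0}"
proof -
  have "Poly_Mapping.keys (\<Sum>l\<in>A. scal (Poly_Mapping.lookup y l) * clw u l) \<subseteq> (\<Union>l\<in>A. Poly_Mapping.keys (clw u l))"
    if "finite A" for A
    using that
  proof (induction A)
    case (insert l A)
    then show ?case
      using keys_add[of "scal (Poly_Mapping.lookup y l) * clw u l" "\<Sum>l\<in>A. scal (Poly_Mapping.lookup y l) * clw u l"]
        keys_scal_mult[of "Poly_Mapping.lookup y l" "clw u l"] by auto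
  qed simp
  from this[of "Poly_Mapping.keys y"] assms(2) obtain l where "l \<in> Poly_Mapping.keys y" "l' \<in> Poly_Mapping.keys (clw u l)"
    unfolding cl_def t.ext_def by auto
  then show ?thesis using clw_keys[of l l' u] assms(1) by (auto simp: fock_set_def)
qed

lemma cl_fock: "y \<in> fock_set \<Longrightarrow> cl u y \<in> fock_set"
  using cl_keys[of y _ u] unfolding fock_set_def by blast

definition rel :: "sign \<times> int \<Rightarrow> sign \<times> int \<Rightarrow> free_alg \<Rightarrow> bool" where
  "rel u v y \<longleftrightarrow> cl u (cl v y) + cl v (cl u y) = scal (B u v) * y"

lemma rel_sym: "rel u v y \<Longrightarrow> rel v u y"
  by (simp add: rel_def add.commute B_sym)

lemma half_add: "scal (b / 2) * y + scal (b / 2) * y = scal b * y"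
  by (simp flip: distrib_right scal_add)

text \<open>As \<open>u\<close> precedes all letters, it is put in front, also after
  \<open>v\<close> has acted on the rest; and \<open>v\<close> passes \<open>u\<close> by the
  defining recursion.\<close>

lemma rel_above:
  assumes l: "l \<in> fock_words" and u: "snd u \<le> 0" "\<And>s. s \<in> set l \<Longrightarrow> before u s" and uv: "\<not> before v u"
  shows "rel u v (word l)"
proof (cases "v = u")
  case True
  have "cl u (word l) = g u * word l"
    by (rule cl_above) (use u in \<open>auto simp: keys_word\<close>)
  then show ?thesis using True by (simp add: rel_def cl_gen(2) half_add)
next
  case False
  have "cl u (word l) = g u * word l"
    by (rule cl_above) (use u in \<open>auto simp: keys_word\<close>)
  then have "cl v (cl u (word l)) = scal (B v u) * word l - g u * cl v (word l)"
    using cl_gen(3)[OF uv False] by simp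
  moreover have "cl u (cl v (word l)) = g u * cl v (word l)"
  proof (rule cl_above[OF u(1)])
    fix k s assume k: "k \<in> Poly_Mapping.keys (cl v (word l))" "s \<in> set k"
    then have "s \<in> set l \<or> s = v \<and> snd v \<le> 0" using clw_keys[OF l, of k v] by (auto simp: cl_word)
    then show "before u s" using u(2) before_total[OF _ u(1) uv False] by blast
  qed
  ultimately show ?thesis by (simp add: rel_def B_sym[of u v])
qed

text \<open>Confluence of the straightening. If one generator belongs in front of the first letter
  \<open>s\<close>, use \<open>rel_above\<close>; if one equals \<open>s\<close>, compute; otherwise
  both pass \<open>s\<close>, their signs cancel, and induction applies to the rest. For two
  positive modes on the empty word \<open>B_pos\<close> is what makes it work.\<close>

lemma rel_word: "l \<in> fock_words \<Longrightarrow> rel u v (word l)"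
proof (induction l arbitrary: u v)
  case Nil
  show ?case
  proof (cases "snd u \<le> 0 \<or> snd v \<le> 0")
    case False
    then show ?thesis by (simp add: rel_def cl_word cl_zero B_pos scal_0)
  next
    case True
    then consider "snd u \<le> 0" "\<not> before v u" | "snd v \<le> 0" "\<not> before u v"
      using before_nonpos before_trans before_irrefl by metis
    then show ?thesis
      by cases (use Nil rel_above[of "[]"] rel_sym in auto)
  qed
next
  case (Cons s l)
  have l: "l \<in> fock_words" and s: "snd s \<le> 0" "\<And>t. t \<in> set l \<Longrightarrow> before s t"
    using Cons.prems by (auto simp: fock_words_def)
  have small: "rel u v (word (s # l))" if "before u s" "\<not> before v u" for u v
    by (rule rel_above[OF Cons.prems]) (use that before_nonpos before_trans[OF that(1)] s in auto)
  show ?case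
  proof (cases "before u s \<or> before v s")
    case True
    then show ?thesis
      using small[of u v] small[of v u] rel_sym before_trans before_irrefl by blast
  next
    case False
    let ?x = "word l"
    have cs: "cl s (cl w ?x) = g s * cl w ?x" if "\<not> before w s" "w \<noteq> s" for w
    proof (rule cl_above[OF s(1)])
      fix k t assume "k \<in> Poly_Mapping.keys (cl w ?x)" "t \<in> set k"
      then have "t \<in> set l \<or> t = w \<and> snd w \<le> 0" using clw_keys[OF l, of k w] by (auto simp: cl_word)
      then show "before s t" using s(2) before_total[OF _ s(1) that] by blast
    qed
    have csx: "cl s ?x = g s * ?x"
      by (rule cl_above) (use s in \<open>auto simp: keys_word\<close>)
    have same: "rel s v (word (s # l))" if "\<not> before v s" for v
    proof (cases "v = s")
      case True
      then show ?thesis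
        by (simp add: rel_def word_Cons cl_gen(2) cl_scal csx half_add)
    next
      case False
      then show ?thesis using that
        by (simp add: rel_def word_Cons cl_gen(2,3) cl_scal cl_diff csx cs B_sym[of s v])
    qed
    show ?thesis
    proof (cases "u = s \<or> v = s")
      case True
      then show ?thesis using same[of u] same[of v] False rel_sym[of s u] by blast
    next
      case F2: False
      have IH: "cl u (cl v ?x) = scal (B u v) * ?x - cl v (cl u ?x)"
        using Cons.IH[OF l, of u v] by (simp add: rel_def eq_diff_eq)
      show ?thesis using False F2
        by (simp add: rel_def word_Cons cl_gen(3) cl_scal cl_diff IH right_diff_distrib gen_scal scal_scal)
    qed
  qed
qed

lemma rel_fock: "y \<in> fock_set \<Longrightarrow> cl u (cl v y) + cl v (cl u y) = scal (B u v) * y"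
  unfolding rel_def[symmetric]
proof (rule free_alg_induct[of y "rel u v"])
  assume y: "y \<in> fock_set"
  show "rel u v (word l)" if "l \<in> Poly_Mapping.keys y" for l
    using that y by (intro rel_word) (auto simp: fock_set_def)
next
  show "rel u v (x + y)" if "rel u v x" "rel u v y" for x y
    using that by (simp add: rel_def cl_add distrib_left algebra_simps)
  show "rel u v (scal c * x)" if "rel u v x" for c x
    using that by (simp add: rel_def cl_scal scal_scal mult.commute flip: distrib_left)
qed (simp add: rel_def cl_zero)

end

section \<open>The Fock space as a complex vector space\<close>

unbundle no fps_syntax
unbundle vec_syntax

text \<open>A type of its own, because the Clifford modules above occupy a whole type.\<close>

typedef fock = fock_set
  using fock_set_closed(1) by blast

instantiation fock :: ab_group_add
begin

definition zero_fock where "0 = Abs_fock 0"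
definition plus_fock where "x + y = Abs_fock (Rep_fock x + Rep_fock y)"
definition minus_fock where "x - y = Abs_fock (Rep_fock x - Rep_fock y)"
definition uminus_fock where "- x = Abs_fock (- Rep_fock x)"

instance
proof
  fix a b c :: fock
  note defs = zero_fock_def plus_fock_def minus_fock_def uminus_fock_def
  note simps = defs Abs_fock_inverse Rep_fock_inverse Rep_fock fock_set_closed
  show "a + b + c = a + (b + c)" by (simp add: simps add.assoc)
  show "a + b = b + a" by (simp add: simps add.commute)
  show "0 + a = a" by (simp add: simps)
  show "- a + a = 0" by (simp add: simps)
  show "a - b = a + - b" by (simp add: simps)
qed

end

lemma Rep_fock_zero: "Rep_fock 0 = 0"
  and Rep_fock_add: "Rep_fock (x + y) = Rep_fock x + Rep_fock y"
  by (simp_all add: zero_fock_def plus_fock_def Abs_fock_inverse Rep_fock fock_set_closed)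

definition fscale :: "complex \<Rightarrow> fock \<Rightarrow> fock" where
  "fscale c y = Abs_fock (scal c * Rep_fock y)"

lemma Rep_fscale: "Rep_fock (fscale c y) = scal c * Rep_fock y"
  by (simp add: fscale_def Abs_fock_inverse Rep_fock fock_set_closed)

lemma fock_eqI: "Rep_fock x = Rep_fock y \<Longrightarrow> x = y"
  by (simp add: Rep_fock_inject)

global_interpretation fock: complex_space fscale
  by unfold_locales
    (auto intro!: fock_eqI simp: Rep_fscale Rep_fock_add distrib_left distrib_right scal_add scal_scal scal_1)

definition fvac :: fock where "fvac = Abs_fock 1"

lemma Rep_fvac: "Rep_fock fvac = word []"
  unfolding fvac_def word_Nil[symmetric]
  by (rule Abs_fock_inverse) (simp add: fock_set_def keys_word fock_words_def)

section \<open>The Fock module of the connection\<close>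

locale irregular_connection =
  fixes A :: "int \<Rightarrow> mat_pm" and \<xi> \<epsilon> \<tau>p \<tau>m :: complex
  assumes A_high: "\<And>k. k > 1 \<Longrightarrow> A k = 0"
    and A_1: "A 1 = mat_pm \<xi> 0 0 (- \<xi>)" and xi_nz: "\<xi> \<noteq> 0"
    and A_0: "A 0 = mat_pm \<epsilon> \<tau>m (- \<tau>p) (- \<epsilon>)"
    and A_neg: "\<And>k. k < 0 \<Longrightarrow> trace (A k) = 0"
begin

definition Cf :: "int \<Rightarrow> sign \<Rightarrow> sign \<Rightarrow> complex" where
  "Cf k a b = Cmat A k $ a $ b"

lemma mat_pm_nth: "mat_pm p q r s $ Plus $ Plus = p" "mat_pm p q r s $ Plus $ Minus = q"
  "mat_pm p q r s $ Minus $ Plus = r" "mat_pm p q r s $ Minus $ Minus = s"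
  by (simp_all add: mat_pm_def)

lemma Cf_entries: "Cf k Plus b = - (A k $ Minus $ b)" "Cf k Minus b = A k $ Plus $ b"
  by (simp_all add: Cf_def Cmat_def matrix_matrix_mult_def UNIV_sign mat_pm_nth)

lemma trace_zero: "trace (A k) = 0"
proof -
  consider "k < 0" | "k = 0" | "k = 1" | "k > 1" by linarith
  then show ?thesis
  proof cases
    case 1
    then show ?thesis by (rule A_neg)
  qed (simp_all add: A_0 A_1 A_high trace_def UNIV_sign mat_pm_nth)
qed

text \<open>Multiplication by the symplectic matrix turns vanishing trace into symmetry.\<close>

lemma Cf_sym: "Cf k a b = Cf k b a"
proof -
  have "A k $ Plus $ Plus + A k $ Minus $ Minus = 0"
    using trace_zero[of k] by (simp add: trace_def UNIV_sign)
  then show ?thesis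
    by (cases a; cases b) (simp_all add: Cf_entries add_eq_0_iff add_eq_0_iff2)
qed

lemma Cf_high: "1 < k \<Longrightarrow> Cf k a b = 0"
  by (cases a) (simp_all add: Cf_entries A_high)

lemma Cf_vals: "Cf 1 Plus Minus = \<xi>" "Cf 1 Plus Plus = 0" "Cf 1 Minus Minus = 0" "Cf 0 Plus Minus = \<epsilon>"
  by (simp_all add: Cf_entries A_0 A_1 mat_pm_nth)

definition B :: "sign \<times> int \<Rightarrow> sign \<times> int \<Rightarrow> complex" where
  "B u v = (if snd u + snd v = 0 then of_int (snd u) * symp (fst u) (fst v) else 0) + Cf (snd u + snd v) (fst u) (fst v)"

sublocale fock_model B
proof
  fix u v :: "sign \<times> int"
  have symp: "symp a b = - symp b a" for a b by (cases a; cases b) simp_all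
  have "of_int (snd u) * symp (fst u) (fst v) = of_int (snd v) * symp (fst v) (fst u)" if "snd u + snd v = 0"
  proof -
    have "snd v = - snd u" using that by simp
    then show ?thesis using symp[of "fst u" "fst v"] by simp
  qed
  then show "B u v = B v u"
    unfolding B_def Cf_sym[of _ "fst u"] add.commute[of "snd v"] by simp
  show "B u v = 0" if "0 < snd u" "0 < snd v"
    using that by (simp add: B_def Cf_high)
qed

definition fpsi :: "sign \<Rightarrow> int \<Rightarrow> fock \<Rightarrow> fock" where
  "fpsi a n y = Abs_fock (cl (a, n) (Rep_fock y))"

lemma Rep_fpsi: "Rep_fock (fpsi a n y) = cl (a, n) (Rep_fock y)"
  by (simp add: fpsi_def Abs_fock_inverse Rep_fock cl_fock)

lemma lin_fpsi: "fock.lin (fpsi a n)"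
  by (rule fock.linI; rule fock_eqI) (simp_all add: Rep_fpsi Rep_fock_add Rep_fscale cl_add cl_scal)

lemma fpsi_word:
  assumes "snd s \<le> 0" "l \<in> fock_words" "\<And>t. t \<in> set l \<Longrightarrow> before s t"
  shows "fpsi (fst s) (snd s) (Abs_fock (word l)) = Abs_fock (word (s # l))"
proof (rule fock_eqI)
  have "word l \<in> fock_set" "word (s # l) \<in> fock_set"
    using assms by (auto simp: fock_set_def keys_word fock_words_def)
  then show "Rep_fock (fpsi (fst s) (snd s) (Abs_fock (word l))) = Rep_fock (Abs_fock (word (s # l)))"
    using assms cl_above[of s "word l"] by (simp add: Rep_fpsi Abs_fock_inverse word_Cons keys_word)
qed

text \<open>An ordered monomial is built on the vacuum by its own letters from right to left, each
  of them already in place.\<close>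

lemma fpsi_cyclic:
  assumes S: "fock.subspace S" "fvac \<in> S" "\<And>a n v. v \<in> S \<Longrightarrow> fpsi a n v \<in> S"
  shows "S = UNIV"
proof -
  have words: "Abs_fock (word l) \<in> S" if "l \<in> fock_words" for l
    using that
  proof (induction l)
    case Nil
    then show ?case using S(2) by (simp add: fvac_def word_Nil)
  next
    case (Cons s l)
    then have "l \<in> fock_words" "snd s \<le> 0" "\<And>t. t \<in> set l \<Longrightarrow> before s t"
      by (auto simp: fock_words_def)
    then show ?case using S(3) Cons.IH fpsi_word by metis
  qed
  have "y \<in> S" for y
  proof -
    have "Rep_fock y \<in> fock_set \<and> Abs_fock (Rep_fock y) \<in> S"
    proof (rule free_alg_induct[of "Rep_fock y" "\<lambda>x. x \<in> fock_set \<and> Abs_fock x \<in> S"])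
      show "word l \<in> fock_set \<and> Abs_fock (word l) \<in> S" if "l \<in> Poly_Mapping.keys (Rep_fock y)" for l
        using words that Rep_fock[of y] by (auto simp: fock_set_def keys_word)
      show "0 \<in> fock_set \<and> Abs_fock 0 \<in> S"
        using fock.subspace_0[OF S(1)] fock_set_closed(1) by (simp add: zero_fock_def)
      show "x + x' \<in> fock_set \<and> Abs_fock (x + x') \<in> S"
        if "x \<in> fock_set \<and> Abs_fock x \<in> S" "x' \<in> fock_set \<and> Abs_fock x' \<in> S" for x x'
        using that fock.subspace_add[OF S(1), of "Abs_fock x" "Abs_fock x'"]
        by (simp add: plus_fock_def Abs_fock_inverse fock_set_closed)
      show "scal c * x \<in> fock_set \<and> Abs_fock (scal c * x) \<in> S" if "x \<in> fock_set \<and> Abs_fock x \<in> S" for c x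
        using that fock.subspace_scale[OF S(1), of "Abs_fock x" c]
        by (simp add: fscale_def Abs_fock_inverse fock_set_closed)
    qed
    then show ?thesis by (simp add: Rep_fock_inverse)
  qed
  then show ?thesis by blast
qed

text \<open>Since \<open>Minus\<close> precedes \<open>Plus\<close>, the product
  \<open>psi Minus p (psi Plus q vac)\<close> is already an ordered word for nonpositive modes, and
  its coefficient at the empty word is 0, as \<open>clifford_fock\<close> demands.\<close>

definition flam :: "fock \<Rightarrow> complex" where "flam y = Poly_Mapping.lookup (Rep_fock y) []"

lemma lookup_scal: "Poly_Mapping.lookup (scal c * x) l = c * Poly_Mapping.lookup x l"
  using free_target.lookup_scal_mult[of "\<lambda>c x. scal c * x"]
  by (simp add: free_target_def free_space.complex_space_axioms)

sublocale F: clifford_fock fscale fpsi Cf fvac \<xi> \<epsilon> flam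
proof unfold_locales
  show "fock.lin (fpsi a n)" for a n by (rule lin_fpsi)
  show "fpsi a m (fpsi b n v) + fpsi b n (fpsi a m v)
      = fscale ((if m + n = 0 then of_int m * symp a b else 0) + Cf (m + n) a b) v" for a m b n v
    using rel_fock[OF Rep_fock, of "(a, m)" "(b, n)" v]
    by (intro fock_eqI) (simp add: Rep_fpsi Rep_fock_add Rep_fscale B_def)
  show "Cf k a b = Cf k b a" for k a b by (rule Cf_sym)
  show "1 < k \<Longrightarrow> Cf k a b = 0" for k a b by (rule Cf_high)
  show "fpsi a n fvac = 0" if "1 \<le> n" for a n
    by (rule fock_eqI) (use that in \<open>simp add: Rep_fpsi Rep_fvac cl_word Rep_fock_zero\<close>)
  show "fvac \<noteq> 0"
    using Rep_fvac Rep_fock_zero keys_word[of "[]"] by force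
  show "flam (u + v) = flam u + flam v" for u v by (simp add: flam_def Rep_fock_add lookup_add)
  show "flam (fscale s v) = s * flam v" for s v by (simp add: flam_def Rep_fscale lookup_scal)
  show "flam fvac = 1" by (simp add: flam_def Rep_fvac word_def)
  show "flam (fpsi Minus p (fpsi Plus q fvac)) = 0" if "p \<le> 0" "q \<le> 0" for p q
    using that by (simp add: flam_def Rep_fpsi Rep_fvac cl_word) (simp add: word_def lookup_single)
qed (fact Cf_vals xi_nz fpsi_cyclic)+

end

section \<open>The induced module\<close>

lemma Free_simps [simp]:
  "carrier Free = UNIV" "x \<otimes>\<^bsub>Free\<^esub> y = x * y" "x \<oplus>\<^bsub>Free\<^esub> y = x + y" "\<one>\<^bsub>Free\<^esub> = 1" "\<zero>\<^bsub>Free\<^esub> = 0"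
  by (simp_all add: Free_def ring_of_type_algebra_def)

lemma ring_Free: "ring Free"
proof (rule ringI)
  show "abelian_group Free"
  proof (rule abelian_groupI)
    show "\<exists>y\<in>carrier Free. y \<oplus>\<^bsub>Free\<^esub> x = \<zero>\<^bsub>Free\<^esub>" for x
      by (rule bexI[of _ "- x"]) simp_all
  qed (simp_all add: ac_simps)
  show "Group.monoid Free" by (rule monoidI) (simp_all add: mult.assoc)
qed (simp_all add: distrib_left distrib_right)

context
  fixes A :: "int \<Rightarrow> mat_pm"
begin

interpretation Free: ring Free by (rule ring_Free)

lemma ideal_clifford: "ideal (clifford_ideal A) Free"
  unfolding clifford_ideal_def by (rule Free.genideal_ideal) simp

interpretation I: ideal "clifford_ideal A" Free by (rule ideal_clifford)

lemma ring_SF: "ring (SF A)"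
  unfolding SF_def by (rule I.quotient_is_ring)

definition proj :: "free_alg \<Rightarrow> sf" where
  "proj x = clifford_ideal A +>\<^bsub>Free\<^esub> x"

lemma proj_hom: "proj \<in> ring_hom Free (SF A)"
  using I.rcos_ring_hom by (simp add: proj_def[abs_def] SF_def)

lemma proj_add: "proj (x + y) = proj x \<oplus>\<^bsub>SF A\<^esub> proj y"
  and proj_mult: "proj (x * y) = proj x \<otimes>\<^bsub>SF A\<^esub> proj y"
  and proj_one: "proj 1 = \<one>\<^bsub>SF A\<^esub>"
  and proj_closed: "proj x \<in> carrier (SF A)"
  using ring_hom_add[OF proj_hom] ring_hom_mult[OF proj_hom] ring_hom_one[OF proj_hom] ring_hom_closed[OF proj_hom]
  by simp_all

lemma proj_zero: "proj 0 = \<zero>\<^bsub>SF A\<^esub>"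
  using ring_hom_zero[OF proj_hom ring_Free ring_SF] by simp

lemma proj_uminus: "proj (- x) = \<ominus>\<^bsub>SF A\<^esub> proj x"
proof -
  interpret SF: ring "SF A" by (rule ring_SF)
  have "proj (- x) \<oplus>\<^bsub>SF A\<^esub> proj x = \<zero>\<^bsub>SF A\<^esub>" by (simp flip: proj_add proj_zero)
  then show ?thesis using SF.minus_equality proj_closed by metis
qed

lemma proj_diff: "proj (x - y) = proj x \<ominus>\<^bsub>SF A\<^esub> proj y"
  unfolding a_minus_def using proj_add[of x "- y"] by (simp add: proj_uminus)

lemma proj_surj: assumes "Z \<in> carrier (SF A)" shows "\<exists>x. Z = proj x"
  using assms
  by (auto simp: SF_def FactRing_def A_RCOSETS_def RCOSETS_def proj_def a_r_coset_def)

lemma proj_psi: "psi A a n = proj (gen a n)" and proj_sc: "sc A c = proj (scal c)"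
  by (simp_all add: psi_def sc_def proj_def)

lemma Free_uminus: "\<ominus>\<^bsub>Free\<^esub> x = - x"
  by (rule Free.minus_equality) simp_all

lemma proj_eq_zero_iff: "proj x = \<zero>\<^bsub>SF A\<^esub> \<longleftrightarrow> x \<in> clifford_ideal A"
proof
  assume "proj x = \<zero>\<^bsub>SF A\<^esub>"
  then have "clifford_ideal A +>\<^bsub>Free\<^esub> x = clifford_ideal A"
    by (simp add: proj_def SF_def FactRing_def)
  then show "x \<in> clifford_ideal A"
    using I.a_rcos_self[of x] by simp
next
  assume "x \<in> clifford_ideal A"
  then show "proj x = \<zero>\<^bsub>SF A\<^esub>"
    using I.a_rcos_const[of x] by (simp add: proj_def SF_def FactRing_def)
qed

lemma ideal_add: "x \<in> clifford_ideal A \<Longrightarrow> y \<in> clifford_ideal A \<Longrightarrow> x + y \<in> clifford_ideal A"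
  using I.a_closed by simp

lemma ideal_mult: "x \<in> clifford_ideal A \<Longrightarrow> y * x \<in> clifford_ideal A" "x \<in> clifford_ideal A \<Longrightarrow> x * y \<in> clifford_ideal A"
  using I.I_l_closed[of x y] I.I_r_closed[of x y] by simp_all

lemma relator_mem: "r \<in> clifford_relators A \<Longrightarrow> r \<in> clifford_ideal A"
  unfolding clifford_ideal_def using Free.genideal_self[of "clifford_relators A"] by auto

lemma ideal_minimal:
  assumes "0 \<in> J" "\<And>x y. x \<in> J \<Longrightarrow> y \<in> J \<Longrightarrow> x + y \<in> J" "\<And>x y. x \<in> J \<Longrightarrow> y * x \<in> J" "\<And>x y. x \<in> J \<Longrightarrow> x * y \<in> J"
    and "clifford_relators A \<subseteq> J"
  shows "clifford_ideal A \<subseteq> J"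
proof -
  have "- x \<in> J" if "x \<in> J" for x using assms(3)[OF that, of "-1"] by simp
  then have "subgroup J (add_monoid Free)"
    using assms by (intro Free.add.subgroupI) (auto simp: Free_uminus simp flip: a_inv_def)
  then have "ideal J Free"
    using assms by (intro idealI ring_Free) auto
  then show ?thesis unfolding clifford_ideal_def by (rule Free.genideal_minimal) (rule assms(5))
qed

lemma SF_sub_gens: "range (sc A) \<union> {psi A a n | a n. n \<in> N} \<subseteq> carrier (SF A)"
  by (auto simp: proj_psi proj_sc proj_closed)

lemma SF_sub_carrier: "x \<in> SF_sub A N \<Longrightarrow> x \<in> carrier (SF A)"
  unfolding SF_sub_def using ring.generate_ring_in_carrier[OF ring_SF SF_sub_gens] .

lemma SF_sub_closed:
  "\<one>\<^bsub>SF A\<^esub> \<in> SF_sub A N" "x \<in> SF_sub A N \<Longrightarrow> y \<in> SF_sub A N \<Longrightarrow> x \<oplus>\<^bsub>SF A\<^esub> y \<in> SF_sub A N"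
  "x \<in> SF_sub A N \<Longrightarrow> y \<in> SF_sub A N \<Longrightarrow> x \<otimes>\<^bsub>SF A\<^esub> y \<in> SF_sub A N"
  "sc A c \<in> SF_sub A N" "n \<in> N \<Longrightarrow> psi A a n \<in> SF_sub A N" "\<zero>\<^bsub>SF A\<^esub> \<in> SF_sub A N"
  "x \<in> SF_sub A N \<Longrightarrow> \<ominus>\<^bsub>SF A\<^esub> x \<in> SF_sub A N"
  unfolding SF_sub_def
  using ring.zero_in_generate[OF ring_SF] by (auto intro: generate_ring.intros)

lemma SF_sub_mono: "N \<subseteq> N' \<Longrightarrow> SF_sub A N \<subseteq> SF_sub A N'"
  unfolding SF_sub_def
  by (intro ring.generate_ring_min_subring1[OF ring_SF SF_sub_gens] ring.generate_ring_is_subring[OF ring_SF SF_sub_gens])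
    (auto intro!: generate_ring.incl)

text \<open>The elements whose left multiplication preserves \<open>P\<close> include the generators
  and are closed under the ring operations; apply them to 1. A minus sign counts as the scalar
  -1.\<close>

lemma SF_sub_induct [consumes 1, case_names one add sc psi]:
  assumes x: "x \<in> SF_sub A N"
    and "P \<one>\<^bsub>SF A\<^esub>"
    and "\<And>x y. x \<in> SF_sub A N \<Longrightarrow> y \<in> SF_sub A N \<Longrightarrow> P x \<Longrightarrow> P y \<Longrightarrow> P (x \<oplus>\<^bsub>SF A\<^esub> y)"
    and "\<And>c x. x \<in> SF_sub A N \<Longrightarrow> P x \<Longrightarrow> P (sc A c \<otimes>\<^bsub>SF A\<^esub> x)"
    and "\<And>a n x. n \<in> N \<Longrightarrow> x \<in> SF_sub A N \<Longrightarrow> P x \<Longrightarrow> P (psi A a n \<otimes>\<^bsub>SF A\<^esub> x)"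
  shows "P x"
proof -
  interpret SF: ring "SF A" by (rule ring_SF)
  have neg: "\<ominus>\<^bsub>SF A\<^esub> z = sc A (-1) \<otimes>\<^bsub>SF A\<^esub> z" if z: "z \<in> carrier (SF A)" for z
  proof -
    obtain u where "z = proj u" using proj_surj[OF z] by blast
    then show ?thesis by (simp add: proj_sc scal_uminus scal_1 flip: proj_uminus proj_mult)
  qed
  have "\<forall>y\<in>SF_sub A N. P y \<longrightarrow> P (h \<otimes>\<^bsub>SF A\<^esub> y)" if "h \<in> SF_sub A N" for h
    using that[unfolded SF_sub_def]
  proof (induction h rule: generate_ring.induct)
    case one
    then show ?case by (simp add: SF_sub_carrier)
  next
    case (incl h)
    then show ?case using assms(4,5) by auto
  next
    case (a_inv h)
    then have h: "h \<in> SF_sub A N" by (simp add: SF_sub_def)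
    show ?case
    proof (intro ballI impI)
      fix y assume y: "y \<in> SF_sub A N" "P y"
      have "\<ominus>\<^bsub>SF A\<^esub> h \<otimes>\<^bsub>SF A\<^esub> y = sc A (-1) \<otimes>\<^bsub>SF A\<^esub> (h \<otimes>\<^bsub>SF A\<^esub> y)"
        using neg[of "h \<otimes>\<^bsub>SF A\<^esub> y"] h y by (simp add: SF_sub_carrier SF.l_minus)
      then show "P (\<ominus>\<^bsub>SF A\<^esub> h \<otimes>\<^bsub>SF A\<^esub> y)" using a_inv y h SF_sub_closed(3) assms(4) by simp
    qed
  next
    case (eng_add h k)
    then have "h \<in> SF_sub A N" "k \<in> SF_sub A N" by (simp_all add: SF_sub_def)
    then show ?case using eng_add assms(3) SF_sub_closed(3) by (simp add: SF.l_distr SF_sub_carrier)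
  next
    case (eng_mult h k)
    then have "h \<in> SF_sub A N" "k \<in> SF_sub A N" by (simp_all add: SF_sub_def)
    then show ?case using eng_mult SF_sub_closed(3) by (simp add: SF.m_assoc SF_sub_carrier)
  qed
  from this[OF x] show ?thesis using assms(2) SF_sub_closed(1) SF.r_one[OF SF_sub_carrier[OF x]] by metis
qed

end

section \<open>The Clifford algebra and the inducing module, acting on the Fock space\<close>

context irregular_connection
begin

definition fact :: "free_alg \<Rightarrow> fock \<Rightarrow> fock" where
  "fact = fock.free_act fpsi"

lemma fact_simps: "fact (x + y) v = fact x v + fact y v" "fact (x * y) v = fact x (fact y v)"
  "fact (gen a n) v = fpsi a n v" "fact (scal c) v = fscale c v" "fact 1 v = v" "fact 0 v = 0"
  "fact (x - y) v = fact x v - fact y v" "fact (- x) v = - fact x v"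
  unfolding fact_def
  by (rule fock.free_act_add fock.free_act_mult fock.free_act_gen fock.free_act_scal fock.free_act_1
      fock.free_act_0 fock.free_act_diff fock.free_act_uminus; rule lin_fpsi)+

lemma lin_fact: "fock.lin (fact x)"
  unfolding fact_def by (rule fock.lin_free_act[OF lin_fpsi])

lemma relator_eq: "clifford_relators A = {gen a m * gen b n + gen b n * gen a m - scal (B (a, m) (b, n)) | a b m n. True}"
  by (simp add: clifford_relators_def B_def Cf_def)

lemma fact_ideal: "x \<in> clifford_ideal A \<Longrightarrow> fact x v = 0"
proof -
  let ?K = "{x. \<forall>v. fact x v = 0}"
  have "clifford_ideal A \<subseteq> ?K"
  proof (rule ideal_minimal)
    show "clifford_relators A \<subseteq> ?K"
    proof -
      have "fpsi a m (fpsi b n v) + fpsi b n (fpsi a m v) = fscale (B (a, m) (b, n)) v" for a m b n v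
        using F.psi_psi[of a m b n v] by (simp add: B_def)
      then show ?thesis unfolding relator_eq by (auto simp: fact_simps)
    qed
  qed (auto simp: fact_simps fock.lin_zero[OF lin_fact])
  then show "x \<in> clifford_ideal A \<Longrightarrow> fact x v = 0" by blast
qed

abbreviation pr :: "free_alg \<Rightarrow> sf" where "pr \<equiv> proj A"

lemma pr_eq_iff: "pr x = pr y \<longleftrightarrow> x - y \<in> clifford_ideal A"
proof -
  interpret SF: ring "SF A" by (rule ring_SF)
  have "pr x = pr y \<longleftrightarrow> pr (x - y) = \<zero>\<^bsub>SF A\<^esub>"
    unfolding proj_diff using proj_closed SF.r_right_minus_eq by metis
  then show ?thesis by (simp add: proj_eq_zero_iff)
qed

text \<open>Any representative serves, since the ideal acts by zero.\<close>

definition act :: "sf \<Rightarrow> fock \<Rightarrow> fock" where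
  "act z v = fact (SOME x. z = pr x) v"

lemma act_pr: "act (pr x) v = fact x v"
proof -
  define y where "y = (SOME y. pr x = pr y)"
  have "pr x = pr y" unfolding y_def by (rule someI[of _ x]) simp
  then have "fact (x - y) v = 0" by (simp add: fact_ideal flip: pr_eq_iff)
  then show ?thesis by (simp add: act_def fact_simps flip: y_def)
qed

lemma act_simps:
  "x \<in> carrier (SF A) \<Longrightarrow> y \<in> carrier (SF A) \<Longrightarrow> act (x \<oplus>\<^bsub>SF A\<^esub> y) v = act x v + act y v"
  "x \<in> carrier (SF A) \<Longrightarrow> y \<in> carrier (SF A) \<Longrightarrow> act (x \<otimes>\<^bsub>SF A\<^esub> y) v = act x (act y v)"
  "x \<in> carrier (SF A) \<Longrightarrow> y \<in> carrier (SF A) \<Longrightarrow> act (x \<ominus>\<^bsub>SF A\<^esub> y) v = act x v - act y v"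
  "x \<in> carrier (SF A) \<Longrightarrow> act (\<ominus>\<^bsub>SF A\<^esub> x) v = - act x v"
  "act \<one>\<^bsub>SF A\<^esub> v = v" "act \<zero>\<^bsub>SF A\<^esub> v = 0" "act (sc A c) v = fscale c v" "act (psi A a n) v = fpsi a n v"
  by (auto dest!: proj_surj simp: act_pr fact_simps simp flip: proj_add proj_mult proj_diff proj_uminus proj_one proj_zero
      simp: proj_sc proj_psi)

lemma lin_act: "x \<in> carrier (SF A) \<Longrightarrow> fock.lin (act x)"
  by (auto dest!: proj_surj simp: act_pr[abs_def] lin_fact)

lemma psi_closed: "psi A a n \<in> carrier (SF A)" and sc_closed: "sc A c \<in> carrier (SF A)"
  by (simp_all add: proj_psi proj_sc proj_closed)

text \<open>Straightening: modulo a left ideal containing the Clifford relations and the positive modes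
  that occur, the recursion \<open>clw\<close> computes the product with a generator.\<close>

lemma gen_word_reduce:
  assumes J: "\<And>x y. x \<in> J \<Longrightarrow> y \<in> J \<Longrightarrow> x + y \<in> J" "\<And>x y. x \<in> J \<Longrightarrow> y * x \<in> J" "clifford_ideal A \<subseteq> J"
    and u: "0 < snd u \<Longrightarrow> g u \<in> J"
  shows "g u * word l - clw u l \<in> J"
proof (induction l)
  case Nil
  then show ?case
    using u J(3) ideal_add[of _ A] proj_eq_zero_iff[of A 0]
    by (auto simp: word_Nil word_Cons proj_zero not_le)
next
  case (Cons s l)
  have zero: "0 \<in> J" using J(3) proj_eq_zero_iff[of A 0] by (auto simp: proj_zero)
  have rel: "(g u * g s + g s * g u - scal (B u s)) * w \<in> J" for u s w
  proof -
    have "g u * g s + g s * g u - scal (B u s) \<in> clifford_ideal A"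
    proof (rule relator_mem)
      show "g u * g s + g s * g u - scal (B u s) \<in> clifford_relators A"
        unfolding relator_eq by (rule CollectI, rule exI[of _ "fst u"], rule exI[of _ "fst s"],
          rule exI[of _ "snd u"], rule exI[of _ "snd s"]) simp
    qed
    then show ?thesis using ideal_mult(2)[of _ A w] J(3) by blast
  qed
  consider "before u s" | "u = s" | "\<not> before u s" "u \<noteq> s" by blast
  then show ?case
  proof cases
    case 1
    then show ?thesis using zero by (simp add: word_Cons)
  next
    case 2
    have "scal (1/2) * ((g s * g s + g s * g s - scal (B s s)) * word l) \<in> J"
      by (rule J(2)) (rule rel)
    also have "scal (1/2) * ((g s * g s + g s * g s - scal (B s s)) * word l)
        = scal (1/2 + 1/2) * (g s * (g s * word l)) - scal (1/2 * B s s) * word l"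
      unfolding scal_add scal_mult by (simp add: algebra_simps)
    finally show ?thesis using 2 by (simp add: before_irrefl word_Cons scal_1)
  next
    case 3
    have "(g u * g s + g s * g u - scal (B u s)) * word l + (-1) * (g s * (g u * word l - clw u l)) \<in> J"
      by (rule J(1)[OF rel J(2)[OF J(2)[OF Cons.IH]]])
    then show ?thesis using 3 by (simp add: word_Cons algebra_simps)
  qed
qed

lemma gen_reduce:
  assumes J: "\<And>x y. x \<in> J \<Longrightarrow> y \<in> J \<Longrightarrow> x + y \<in> J" "\<And>x y. x \<in> J \<Longrightarrow> y * x \<in> J" "clifford_ideal A \<subseteq> J"
    and u: "0 < snd u \<Longrightarrow> g u \<in> J"
  shows "g u * y - cl u y \<in> J"
proof (induction y rule: free_alg_induct')
  case (1 l)
  then show ?case using gen_word_reduce[OF assms] by (simp add: cl_word)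
next
  case (2 x y)
  then show ?case using J(1)[OF 2] by (simp add: cl_add algebra_simps)
next
  case (3 c x)
  then show ?case using J(2)[OF 3, of "scal c"] by (simp add: cl_scal gen_scal algebra_simps)
qed

text \<open>Copy of the inducing module in the Fock space. Identities between zero modes are checked
  here, after applying both sides to the vacuum.\<close>

definition F0 :: "fock set" where "F0 = (\<lambda>x. act x fvac) ` SF_sub A {0}"

lemma pr_psi0_Rep: "psi A a 0 \<otimes>\<^bsub>SF A\<^esub> pr (Rep_fock y) = pr (Rep_fock (fpsi a 0 y))"
proof -
  have "g (a, 0) * Rep_fock y - cl (a, 0) (Rep_fock y) \<in> clifford_ideal A"
    by (rule gen_reduce) (simp_all add: ideal_add ideal_mult)
  then show ?thesis by (simp add: proj_psi Rep_fpsi pr_eq_iff flip: proj_mult)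
qed

text \<open>Straightening zero modes uses only the Clifford relations and no property of the vacuum,
  so the ordered form of \<open>x\<close> equals \<open>x\<close> in the algebra. Evaluation at the
  vacuum is therefore injective on this subalgebra.\<close>

lemma SF0_normal_form: "x \<in> SF_sub A {0} \<Longrightarrow> pr (Rep_fock (act x fvac)) = x"
proof (induction x rule: SF_sub_induct)
  case one
  then show ?case by (simp add: act_simps Rep_fvac word_Nil proj_one)
next
  case (add x y)
  then show ?case by (simp add: act_simps SF_sub_carrier Rep_fock_add proj_add)
next
  case (sc c x)
  then show ?case by (simp add: act_simps SF_sub_carrier sc_closed Rep_fscale proj_mult flip: proj_sc)
next
  case (psi a n x)
  then show ?case by (simp add: act_simps SF_sub_carrier psi_closed flip: pr_psi0_Rep)
qed

lemma SF0_inj: "x \<in> SF_sub A {0} \<Longrightarrow> y \<in> SF_sub A {0} \<Longrightarrow> act x fvac = act y fvac \<Longrightarrow> x = y"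
  using SF0_normal_form by metis

lemma F0_Rep: "y \<in> F0 \<Longrightarrow> pr (Rep_fock y) \<in> SF_sub A {0}" "y \<in> F0 \<Longrightarrow> act (pr (Rep_fock y)) fvac = y"
  by (auto simp: F0_def SF0_normal_form)

lemma F0_I: "x \<in> SF_sub A {0} \<Longrightarrow> act x fvac \<in> F0"
  by (simp add: F0_def)

lemma F0_subspace: "fock.subspace F0"
proof (rule fock.subspaceI)
  show "0 \<in> F0" using F0_I[OF SF_sub_closed(6)] by (simp add: act_simps)
  fix x y c assume "x \<in> F0"
  then obtain u where u: "u \<in> SF_sub A {0}" "x = act u fvac" by (auto simp: F0_def)
  show "fscale c x \<in> F0"
    using F0_I[OF SF_sub_closed(3)[OF SF_sub_closed(4)[of A c] u(1)]] u
    by (simp add: act_simps SF_sub_carrier sc_closed)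
  assume "y \<in> F0"
  then obtain u' where u': "u' \<in> SF_sub A {0}" "y = act u' fvac" by (auto simp: F0_def)
  show "x + y \<in> F0"
    using F0_I[OF SF_sub_closed(2)[OF u(1) u'(1)]] u u' by (simp add: act_simps SF_sub_carrier)
qed

lemma F0_psi0: "y \<in> F0 \<Longrightarrow> fpsi a 0 y \<in> F0"
  using F0_I[OF SF_sub_closed(3)[OF SF_sub_closed(5)[of 0 "{0}" A a]]]
  by (fastforce simp: F0_def act_simps SF_sub_carrier psi_closed)

text \<open>Positive modes kill the vacuum and anticommute with zero modes up to entries of
  \<open>C_n\<close>, which vanish for \<open>n \<ge> 2\<close>.\<close>

lemma F0_psi:
  assumes "y \<in> F0" "1 \<le> n"
  shows "fpsi a n y \<in> F0" "2 \<le> n \<Longrightarrow> fpsi a n y = 0"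
proof -
  note sub = F0_subspace
  have "fpsi a n (act x fvac) \<in> F0 \<and> (2 \<le> n \<longrightarrow> fpsi a n (act x fvac) = 0)" if "x \<in> SF_sub A {0}" for x
    using that
  proof (induction x rule: SF_sub_induct)
    case one
    then show ?case using assms(2) fock.subspace_0[OF sub] by (simp add: act_simps F.psi_vac)
  next
    case (add x y)
    then show ?case
      by (simp add: act_simps SF_sub_carrier fock.lin_simps[OF lin_fpsi] fock.subspace_add[OF sub])
  next
    case (sc c x)
    then show ?case
      by (simp add: act_simps SF_sub_carrier sc_closed fock.lin_simps[OF lin_fpsi] fock.subspace_scale[OF sub])
  next
    case (psi b k x)
    have "fpsi a n (fpsi b 0 (act x fvac)) = fscale (F.pair a n b 0) (act x fvac) - fpsi b 0 (fpsi a n (act x fvac))"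
      by (rule F.psi_swap)
    moreover have "act x fvac \<in> F0" using psi by (intro F0_I) simp
    moreover have "2 \<le> n \<Longrightarrow> F.pair a n b 0 = 0" by (rule F.pair_high) simp
    ultimately show ?case
      using psi by (auto simp: act_simps SF_sub_carrier psi_closed fock.lin_simps[OF lin_fpsi] fock.subspace_diff[OF sub]
          fock.subspace_scale[OF sub] F0_psi0)
  qed
  then show "fpsi a n y \<in> F0" "2 \<le> n \<Longrightarrow> fpsi a n y = 0" using assms(1) by (auto simp: F0_def)
qed

lemma F0_act: "x \<in> SF_sub A {0..} \<Longrightarrow> y \<in> F0 \<Longrightarrow> act x y \<in> F0"
proof (induction x arbitrary: y rule: SF_sub_induct)
  case one
  then show ?case by (simp add: act_simps)
next
  case (add x x')
  then show ?case by (simp add: act_simps SF_sub_carrier fock.subspace_add[OF F0_subspace])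
next
  case (sc c x)
  then show ?case by (simp add: act_simps SF_sub_carrier sc_closed fock.subspace_scale[OF F0_subspace])
next
  case (psi a n x)
  then have "fpsi a n (act x y) \<in> F0"
    using F0_psi0 F0_psi(1) by (cases "n = 0") auto
  then show ?case using psi by (simp add: act_simps SF_sub_carrier psi_closed)
qed

lemma pair_1_0: "F.pair (opp a) 1 b 0 = (if b = a then \<xi> else 0)"
  by (cases a; cases b) (simp_all add: F.pair_def Cf_vals Cf_sym[of _ Minus Plus])

text \<open>On the Fock space the anti-derivation is already present as \<open>1 / \<xi>\<close>
  times the mode 1 of opposite sign. Pulling it back through the normal form settles its
  compatibility with the relations of the zero modes.\<close>

lemma antider_exists: "\<exists>D. is_antider A a D"
proof -
  interpret SF: ring "SF A" by (rule ring_SF)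
  define E where "E v = fscale (1 / \<xi>) (fpsi (opp a) 1 (act v fvac))" for v
  define D where "D v = pr (Rep_fock (E v))" for v
  have E: "E v \<in> F0" if "v \<in> SF_sub A {0}" for v
    unfolding E_def using that by (intro fock.subspace_scale[OF F0_subspace] F0_psi F0_I) simp_all
  have D: "D v \<in> SF_sub A {0}" "act (D v) fvac = E v" if "v \<in> SF_sub A {0}" for v
    unfolding D_def using E[OF that] by (rule F0_Rep)+
  note c = SF_sub_carrier[of _ A "{0}"] SF_sub_carrier[of _ A "{0..}"] psi_closed sc_closed
  note l = fock.lin_simps[OF lin_fpsi]
  have "is_antider A a D"
    unfolding is_antider_def
  proof (intro conjI ballI allI)
    show "D x \<in> SF_sub A {0}" if "x \<in> SF_sub A {0}" for x using D(1)[OF that] .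
    show "D (x \<oplus>\<^bsub>SF A\<^esub> y) = D x \<oplus>\<^bsub>SF A\<^esub> D y" if "x \<in> SF_sub A {0}" "y \<in> SF_sub A {0}" for x y
    proof (rule SF0_inj)
      show "D (x \<oplus>\<^bsub>SF A\<^esub> y) \<in> SF_sub A {0}" "D x \<oplus>\<^bsub>SF A\<^esub> D y \<in> SF_sub A {0}"
        using that D(1) SF_sub_closed(2) by blast+
      show "act (D (x \<oplus>\<^bsub>SF A\<^esub> y)) fvac = act (D x \<oplus>\<^bsub>SF A\<^esub> D y) fvac"
        using that SF_sub_closed(2)[OF that] D
        by (simp add: act_simps c) (simp add: E_def act_simps c l fock.scale_right_distrib)
    qed
    show "D (sc A t \<otimes>\<^bsub>SF A\<^esub> x) = sc A t \<otimes>\<^bsub>SF A\<^esub> D x" if "x \<in> SF_sub A {0}" for t x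
    proof (rule SF0_inj)
      have tx: "sc A t \<otimes>\<^bsub>SF A\<^esub> x \<in> SF_sub A {0}" using that SF_sub_closed(3,4) by blast
      then show "D (sc A t \<otimes>\<^bsub>SF A\<^esub> x) \<in> SF_sub A {0}" by (rule D(1))
      show "sc A t \<otimes>\<^bsub>SF A\<^esub> D x \<in> SF_sub A {0}" using D(1)[OF that] SF_sub_closed(3,4) by blast
      show "act (D (sc A t \<otimes>\<^bsub>SF A\<^esub> x)) fvac = act (sc A t \<otimes>\<^bsub>SF A\<^esub> D x) fvac"
        using that tx D by (simp add: act_simps c) (simp add: E_def act_simps c l mult.commute)
    qed
    show "D \<one>\<^bsub>SF A\<^esub> = \<zero>\<^bsub>SF A\<^esub>"
      by (rule SF0_inj) (simp_all add: D SF_sub_closed act_simps E_def F.psi_vac)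
    show "D (psi A b 0 \<otimes>\<^bsub>SF A\<^esub> x) = (if b = a then x else \<zero>\<^bsub>SF A\<^esub>) \<ominus>\<^bsub>SF A\<^esub> psi A b 0 \<otimes>\<^bsub>SF A\<^esub> D x"
      if "x \<in> SF_sub A {0}" for b x
    proof (rule SF0_inj)
      have bx: "psi A b 0 \<otimes>\<^bsub>SF A\<^esub> x \<in> SF_sub A {0}" using that SF_sub_closed(3,5) by blast
      then show "D (psi A b 0 \<otimes>\<^bsub>SF A\<^esub> x) \<in> SF_sub A {0}" by (rule D(1))
      have bD: "psi A b 0 \<otimes>\<^bsub>SF A\<^esub> D x \<in> SF_sub A {0}"
        using D(1)[OF that] SF_sub_closed(3,5) by blast
      then show "(if b = a then x else \<zero>\<^bsub>SF A\<^esub>) \<ominus>\<^bsub>SF A\<^esub> psi A b 0 \<otimes>\<^bsub>SF A\<^esub> D x \<in> SF_sub A {0}"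
        unfolding a_minus_def using that SF_sub_closed(2,6,7) by simp
      have "E (psi A b 0 \<otimes>\<^bsub>SF A\<^esub> x) = (if b = a then act x fvac else 0) - fpsi b 0 (E x)"
        using that xi_nz F.psi_swap[of "opp a" 1 b 0 "act x fvac"]
        by (simp add: E_def act_simps c l pair_1_0 fock.scale_right_diff_distrib)
      then show "act (D (psi A b 0 \<otimes>\<^bsub>SF A\<^esub> x)) fvac
          = act ((if b = a then x else \<zero>\<^bsub>SF A\<^esub>) \<ominus>\<^bsub>SF A\<^esub> psi A b 0 \<otimes>\<^bsub>SF A\<^esub> D x) fvac"
        using that bx bD D[OF that] D(2)[OF bx] by (simp add: act_simps c)
    qed
  qed
  then show ?thesis by blast
qed

lemma antider: "is_antider A a (antider A a)"
  unfolding antider_def using someI_ex[OF antider_exists] .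

text \<open>The anti-derivation is given by a choice operator, but its axioms fix it on all products
  of generators, so every choice agrees with the mode 1 on the Fock space.\<close>

lemma antider_act:
  assumes "v \<in> SF_sub A {0}"
  shows "antider A a v \<in> SF_sub A {0}"
    and "fscale \<xi> (act (antider A a v) fvac) = fpsi (opp a) 1 (act v fvac)"
proof -
  let ?D = "antider A a"
  note D = antider[of a, unfolded is_antider_def]
  have D1: "?D x \<in> SF_sub A {0}" if "x \<in> SF_sub A {0}" for x using D that by blast
  then show "?D v \<in> SF_sub A {0}" using assms .
  note c = SF_sub_carrier[of _ A "{0}"] SF_sub_carrier[of _ A "{0..}"] psi_closed sc_closed
  note l = fock.lin_simps[OF lin_fpsi]
  interpret SF: ring "SF A" by (rule ring_SF)
  show "fscale \<xi> (act (?D v) fvac) = fpsi (opp a) 1 (act v fvac)"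
    using assms
  proof (induction v rule: SF_sub_induct)
    case one
    have "?D \<one>\<^bsub>SF A\<^esub> = \<zero>\<^bsub>SF A\<^esub>" using D by blast
    then show ?case by (simp add: act_simps F.psi_vac)
  next
    case (add x y)
    have "?D (x \<oplus>\<^bsub>SF A\<^esub> y) = ?D x \<oplus>\<^bsub>SF A\<^esub> ?D y" using D add by blast
    then show ?case using add D1 by (simp add: act_simps c l fock.scale_right_distrib)
  next
    case (sc t x)
    have "?D (sc A t \<otimes>\<^bsub>SF A\<^esub> x) = sc A t \<otimes>\<^bsub>SF A\<^esub> ?D x" using D sc by blast
    then have "act (?D (sc A t \<otimes>\<^bsub>SF A\<^esub> x)) fvac = fscale t (act (?D x) fvac)"
      using sc D1 by (simp add: act_simps c)
    then have "fscale \<xi> (act (?D (sc A t \<otimes>\<^bsub>SF A\<^esub> x)) fvac) = fscale t (fscale \<xi> (act (?D x) fvac))"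
      by (simp only: fock.scale_left_commute)
    then show ?case using sc by (simp only: sc.IH) (simp add: act_simps c l)
  next
    case (psi b n x)
    have "?D (psi A b 0 \<otimes>\<^bsub>SF A\<^esub> x) = (if b = a then x else \<zero>\<^bsub>SF A\<^esub>) \<ominus>\<^bsub>SF A\<^esub> psi A b 0 \<otimes>\<^bsub>SF A\<^esub> ?D x"
      using D psi by blast
    then have "act (?D (psi A b 0 \<otimes>\<^bsub>SF A\<^esub> x)) fvac = (if b = a then act x fvac else 0) - fpsi b 0 (act (?D x) fvac)"
      using psi D1 by (simp add: act_simps c)
    then have "fscale \<xi> (act (?D (psi A b 0 \<otimes>\<^bsub>SF A\<^esub> x)) fvac)
       = fscale (if b = a then \<xi> else 0) (act x fvac) - fpsi b 0 (fscale \<xi> (act (?D x) fvac))"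
      by (simp add: fock.scale_right_diff_distrib l)
    then have "fscale \<xi> (act (?D (psi A b 0 \<otimes>\<^bsub>SF A\<^esub> x)) fvac)
       = fscale (if b = a then \<xi> else 0) (act x fvac) - fpsi b 0 (fpsi (opp a) 1 (act x fvac))"
      by (simp only: psi.IH)
    then show ?case
      using psi F.psi_swap[of "opp a" 1 b 0 "act x fvac"] by (simp add: act_simps c pair_1_0)
  qed
qed

lemma xi_entry: "Cmat A 1 $ Plus $ Minus = \<xi>"
  using Cf_vals(1) by (simp add: Cf_def)

lemma opp_opp: "opp (opp a) = a"
  by (cases a) simp_all

text \<open>The nonnegative part of the algebra preserves \<open>F0\<close>; its action there is
  read back through the normal form.\<close>

lemma V01_action_exists: "\<exists>\<rho>. is_V01_action A \<rho>"
proof -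
  interpret SF: ring "SF A" by (rule ring_SF)
  define \<rho> where "\<rho> x v = pr (Rep_fock (act x (act v fvac)))" for x v
  have R: "\<rho> x v \<in> SF_sub A {0}" "act (\<rho> x v) fvac = act x (act v fvac)"
    if "x \<in> SF_sub A {0..}" "v \<in> SF_sub A {0}" for x v
    unfolding \<rho>_def using F0_act[OF that(1) F0_I[OF that(2)]] by (rule F0_Rep)+
  note c = SF_sub_carrier[of _ A "{0}"] SF_sub_carrier[of _ A "{0..}"] psi_closed sc_closed
  note l = fock.lin_simps[OF lin_fpsi]
  have pos: "sc A t \<in> SF_sub A {0..}" "0 \<le> n \<Longrightarrow> psi A a n \<in> SF_sub A {0..}" for t n a
    by (simp_all add: SF_sub_closed)
  have "is_V01_action A \<rho>"
    unfolding is_V01_action_def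
  proof (intro conjI ballI allI impI)
    fix x y v u assume x: "x \<in> SF_sub A {0..}" and y: "y \<in> SF_sub A {0..}"
      and v: "v \<in> SF_sub A {0}" and u: "u \<in> SF_sub A {0}"
    show "\<rho> x (v \<oplus>\<^bsub>SF A\<^esub> u) = \<rho> x v \<oplus>\<^bsub>SF A\<^esub> \<rho> x u"
      by (rule SF0_inj) (use x v u R SF_sub_closed in \<open>simp_all add: act_simps c fock.lin_simps[OF lin_act]\<close>)
    show "\<rho> (x \<oplus>\<^bsub>SF A\<^esub> y) v = \<rho> x v \<oplus>\<^bsub>SF A\<^esub> \<rho> y v"
      by (rule SF0_inj) (use x y v R SF_sub_closed in \<open>simp_all add: act_simps c\<close>)
    show "\<rho> (x \<otimes>\<^bsub>SF A\<^esub> y) v = \<rho> x (\<rho> y v)"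
      by (rule SF0_inj) (use x y v R SF_sub_closed in \<open>simp_all add: act_simps c\<close>)
  next
    fix v assume v: "v \<in> SF_sub A {0}"
    show "\<rho> (sc A t) v = sc A t \<otimes>\<^bsub>SF A\<^esub> v" for t
      by (rule SF0_inj) (use v R pos SF_sub_closed in \<open>simp_all add: act_simps c\<close>)
    show "\<rho> (psi A a 0) v = psi A a 0 \<otimes>\<^bsub>SF A\<^esub> v" for a
      by (rule SF0_inj) (use v R pos SF_sub_closed in \<open>simp_all add: act_simps c\<close>)
    show "\<rho> (psi A a 1) v = sc A (Cmat A 1 $ Plus $ Minus) \<otimes>\<^bsub>SF A\<^esub> antider A (opp a) v" for a
      by (rule SF0_inj) (use v R[OF pos(2) v] SF_sub_closed antider_act[OF v] in \<open>simp_all add: act_simps c xi_entry opp_opp\<close>)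
    show "\<rho> (psi A a n) v = \<zero>\<^bsub>SF A\<^esub>" if "2 \<le> n" for a n
      by (rule SF0_inj) (use v that R[OF pos(2) v] SF_sub_closed F0_psi(2)[OF F0_I[OF v]] in \<open>simp_all add: act_simps c\<close>)
  qed (use R(1) in blast)
  then show ?thesis by blast
qed

lemma V01_action: "is_V01_action A (module.smult (V01 A))"
  using someI_ex[OF V01_action_exists] by (simp add: V01_def)

lemma V01_simps: "carrier (V01 A) = SF_sub A {0}" "x \<oplus>\<^bsub>V01 A\<^esub> y = x \<oplus>\<^bsub>SF A\<^esub> y"
  by (simp_all add: V01_def)

text \<open>The chosen action, too, is pinned down by its values on generators, here by induction
  over the nonnegative subalgebra.\<close>

lemma V01_smult:
  assumes "x \<in> SF_sub A {0..}" "v \<in> SF_sub A {0}"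
  shows "x \<odot>\<^bsub>V01 A\<^esub> v \<in> SF_sub A {0}" "act (x \<odot>\<^bsub>V01 A\<^esub> v) fvac = act x (act v fvac)"
proof -
  let ?r = "module.smult (V01 A)"
  note r' = V01_action[unfolded is_V01_action_def]
  note r = r'[THEN conjunct2, THEN conjunct2, THEN conjunct1, rule_format]
  note rg = r'[THEN conjunct2, THEN conjunct2, THEN conjunct2, rule_format]
  note c = SF_sub_carrier[of _ A "{0}"] SF_sub_carrier[of _ A "{0..}"] psi_closed sc_closed
  have r1: "?r x v \<in> SF_sub A {0}" if "x \<in> SF_sub A {0..}" "v \<in> SF_sub A {0}" for x v
    using r'[THEN conjunct1] that by blast
  then show "?r x v \<in> SF_sub A {0}" using assms .
  have pos: "sc A t \<in> SF_sub A {0..}" "0 \<le> n \<Longrightarrow> psi A a n \<in> SF_sub A {0..}" for t n a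
    by (simp_all add: SF_sub_closed)
  interpret SF: ring "SF A" by (rule ring_SF)
  have rsc: "act (?r (sc A t) v) fvac = fscale t (act v fvac)" if v: "v \<in> SF_sub A {0}" for t v
  proof -
    have "?r (sc A t) v = sc A t \<otimes>\<^bsub>SF A\<^esub> v" using rg[OF v] by blast
    then show ?thesis using v by (simp add: act_simps c)
  qed
  have rpsi: "act (?r (psi A a n) v) fvac = fpsi a n (act v fvac)" if v: "v \<in> SF_sub A {0}" and n: "0 \<le> n" for a n v
  proof -
    consider "n = 0" | "n = 1" | "2 \<le> n" using n by linarith
    then show ?thesis
    proof cases
      case 1
      have "?r (psi A a 0) v = psi A a 0 \<otimes>\<^bsub>SF A\<^esub> v" using rg[OF v] by blast
      then show ?thesis using v 1 by (simp add: act_simps c)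
    next
      case 2
      have "?r (psi A a 1) v = sc A (Cmat A 1 $ Plus $ Minus) \<otimes>\<^bsub>SF A\<^esub> antider A (opp a) v" using rg[OF v] by blast
      then show ?thesis using v 2 antider_act[OF v, of "opp a"] by (simp add: act_simps c xi_entry opp_opp)
    next
      case 3
      have "?r (psi A a n) v = \<zero>\<^bsub>SF A\<^esub>" using rg[OF v] 3 by blast
      then show ?thesis using F0_psi(2)[OF F0_I[OF v], of n] 3 by (simp add: act_simps)
    qed
  qed
  show "act (?r x v) fvac = act x (act v fvac)"
    using assms
  proof (induction x arbitrary: v rule: SF_sub_induct)
    case one
    then show ?case using rsc[of v 1] by (simp add: proj_sc scal_1 proj_one act_simps)
  next
    case (add x y)
    have "?r (x \<oplus>\<^bsub>SF A\<^esub> y) v = ?r x v \<oplus>\<^bsub>SF A\<^esub> ?r y v" using r[of x y v] add by blast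
    then show ?case using add r1 by (simp add: act_simps c)
  next
    case (sc t x)
    have "?r (sc A t \<otimes>\<^bsub>SF A\<^esub> x) v = ?r (sc A t) (?r x v)" using r[of "sc A t" x v] sc pos by blast
    then show ?case using sc r1 rsc by (simp add: act_simps c)
  next
    case (psi a n x)
    then have n: "0 \<le> n" by simp
    have "?r (psi A a n \<otimes>\<^bsub>SF A\<^esub> x) v = ?r (psi A a n) (?r x v)" using r[of "psi A a n" x v] psi pos(2)[OF n] by blast
    then show ?case using psi r1 rpsi[OF _ n] by (simp add: act_simps c)
  qed
qed

end

section \<open>The tensor product and its isomorphism with the Fock space\<close>

context irregular_connection
begin

definition TF :: "(sf \<times> sf \<Rightarrow>\<^sub>0 int) monoid" where "TF = tensor_free (SF A) (V01 A)"
definition TN :: "(sf \<times> sf \<Rightarrow>\<^sub>0 int) set" where "TN = tensor_null (SF A) (SF_sub A {0..}) (V01 A)"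

lemma TF_simps: "z \<in> carrier TF \<longleftrightarrow> Poly_Mapping.keys z \<subseteq> carrier (SF A) \<times> SF_sub A {0}"
  "z \<otimes>\<^bsub>TF\<^esub> z' = z + z'" "\<one>\<^bsub>TF\<^esub> = 0" "z \<in> carrier TF \<Longrightarrow> inv\<^bsub>TF\<^esub> z = - z"
  by (simp_all add: TF_def tensor_free_def V01_simps)

lemma comm_group_TF: "comm_group TF"
  by (simp add: TF_def tensor_free_def abelian_free_Abelian_group)

lemma group_TF: "group TF"
  using comm_group_TF by (simp add: comm_group_def)

lemma frag_of_TF: "x \<in> carrier (SF A) \<Longrightarrow> v \<in> SF_sub A {0} \<Longrightarrow> frag_of (x, v) \<in> carrier TF"
  by (simp add: TF_simps)

lemma TF_closed: "z \<in> carrier TF \<Longrightarrow> z' \<in> carrier TF \<Longrightarrow> z + z' \<in> carrier TF"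
  "z \<in> carrier TF \<Longrightarrow> - z \<in> carrier TF"
  "z \<in> carrier TF \<Longrightarrow> z' \<in> carrier TF \<Longrightarrow> z - z' \<in> carrier TF" "0 \<in> carrier TF"
  using keys_add[of z z'] keys_diff[of z z'] by (auto simp: TF_simps)

lemma SF_ring_closed: "x \<in> carrier (SF A) \<Longrightarrow> y \<in> carrier (SF A) \<Longrightarrow> x \<oplus>\<^bsub>SF A\<^esub> y \<in> carrier (SF A)"
  "x \<in> carrier (SF A) \<Longrightarrow> y \<in> carrier (SF A) \<Longrightarrow> x \<otimes>\<^bsub>SF A\<^esub> y \<in> carrier (SF A)"
  "\<one>\<^bsub>SF A\<^esub> \<in> carrier (SF A)" "\<zero>\<^bsub>SF A\<^esub> \<in> carrier (SF A)"
  using ring.ring_simprules(1,5,6,2)[OF ring_SF] by blast+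

lemma relators_TF: "tensor_relators (SF A) (SF_sub A {0..}) (V01 A) \<subseteq> carrier TF"
  using V01_smult(1) SF_sub_carrier[of _ A "{0..}"]
  unfolding tensor_relators_def V01_simps
  by (auto intro!: TF_closed frag_of_TF SF_ring_closed SF_sub_closed)

lemma subgroup_TN: "subgroup TN TF"
  unfolding TN_def tensor_null_def TF_def[symmetric]
  by (rule group.generate_is_subgroup[OF group_TF relators_TF])

lemma TN_closed: "z \<in> TN \<Longrightarrow> z \<in> carrier TF" "0 \<in> TN" "z \<in> TN \<Longrightarrow> z' \<in> TN \<Longrightarrow> z + z' \<in> TN"
  "z \<in> TN \<Longrightarrow> - z \<in> TN"
proof -
  show TF: "z \<in> TN \<Longrightarrow> z \<in> carrier TF" for z
    using subgroup.subset[OF subgroup_TN] by blast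
  show "0 \<in> TN" "z \<in> TN \<Longrightarrow> z' \<in> TN \<Longrightarrow> z + z' \<in> TN"
    using subgroup.one_closed[OF subgroup_TN] subgroup.m_closed[OF subgroup_TN] by (simp_all add: TF_simps)
  show "z \<in> TN \<Longrightarrow> - z \<in> TN"
    using subgroup.m_inv_closed[OF subgroup_TN, of z] TF[of z] TF_simps(4)[of z] by metis
qed

lemma TN_diff: "z \<in> TN \<Longrightarrow> z' \<in> TN \<Longrightarrow> z - z' \<in> TN"
  using TN_closed(3)[of z "- z'"] TN_closed(4)[of z'] by simp

lemma TN_induct [consumes 1, case_names rel add uminus]:
  assumes "z \<in> TN" and "\<And>r. r \<in> tensor_relators (SF A) (SF_sub A {0..}) (V01 A) \<Longrightarrow> P r"
    and "\<And>y z. P y \<Longrightarrow> P z \<Longrightarrow> P (y + z)" and "\<And>z. P z \<Longrightarrow> P (- z)" and "P 0"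
  shows "P z"
  using assms(1)[unfolded TN_def tensor_null_def TF_def[symmetric]]
proof (induction z rule: generate.induct)
  case (inv h)
  then show ?case using relators_TF assms(2,4) by (auto simp: TF_simps(4))
qed (use assms in \<open>simp_all add: TF_simps\<close>)

text \<open>The comparison map: a tensor of \<open>x\<close> and \<open>v\<close> goes to
  \<open>x\<close> applied to the image of \<open>v\<close> in \<open>F0\<close>.\<close>

definition phi :: "(sf \<times> sf \<Rightarrow>\<^sub>0 int) \<Rightarrow> fock" where
  "phi z = (\<Sum>p\<in>Poly_Mapping.keys z. fscale (of_int (Poly_Mapping.lookup z p)) (act (fst p) (act (snd p) fvac)))"

lemma phi_add: "phi (y + z) = phi y + phi z"
  unfolding phi_def by (rule setsum_keys_plus_distrib) (simp_all add: fock.scale_left_distrib)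

lemma phi_frag_of: "phi (frag_of p) = act (fst p) (act (snd p) fvac)"
  by (simp add: phi_def)

lemma phi_zero: "phi 0 = 0"
  by (simp add: phi_def)

lemma phi_uminus: "phi (- z) = - phi z"
  using phi_add[of z "- z"] by (simp add: phi_zero add_eq_0_iff2)

lemma phi_diff: "phi (y - z) = phi y - phi z"
  using phi_add[of y "- z"] by (simp add: phi_uminus)

lemma phi_TN: "z \<in> TN \<Longrightarrow> phi z = 0"
proof (induction z rule: TN_induct)
  case (rel r)
  note c = SF_sub_carrier[of _ A "{0}"] SF_sub_carrier[of _ A "{0..}"]
  show ?case using rel unfolding tensor_relators_def V01_simps
    by (auto simp: phi_diff phi_frag_of act_simps c fock.lin_simps[OF lin_act] V01_smult)
qed (simp_all add: phi_add phi_uminus phi_zero)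

definition lmul :: "sf \<Rightarrow> (sf \<times> sf \<Rightarrow>\<^sub>0 int) \<Rightarrow> (sf \<times> sf \<Rightarrow>\<^sub>0 int)" where
  "lmul r = frag_extend (\<lambda>(x, v). frag_of (r \<otimes>\<^bsub>SF A\<^esub> x, v))"

lemma lmul_simps: "lmul r (y + z) = lmul r y + lmul r z" "lmul r (- z) = - lmul r z" "lmul r (y - z) = lmul r y - lmul r z"
  "lmul r 0 = 0" "lmul r (frag_of (x, v)) = frag_of (r \<otimes>\<^bsub>SF A\<^esub> x, v)"
  by (simp_all add: lmul_def frag_extend_add frag_extend_minus frag_extend_diff)

lemma lmul_TF:
  assumes r: "r \<in> carrier (SF A)" and z: "z \<in> carrier TF"
  shows "lmul r z \<in> carrier TF"
  using z unfolding TF_simps(1)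
proof (induction z rule: frag_induction)
  case (one p)
  then show ?case using r by (cases p) (simp add: lmul_simps SF_ring_closed)
next
  case (diff a b)
  then show ?case using keys_diff[of "lmul r a" "lmul r b"] by (auto simp: lmul_simps)
qed (simp_all add: lmul_simps)

lemma phi_lmul:
  assumes r: "r \<in> carrier (SF A)" and z: "z \<in> carrier TF"
  shows "phi (lmul r z) = act r (phi z)"
  using z unfolding TF_simps(1)
proof (induction z rule: frag_induction)
  case (one p)
  then show ?case using r by (cases p) (simp add: lmul_simps phi_frag_of act_simps)
qed (simp_all add: lmul_simps phi_zero phi_diff fock.lin_simps[OF lin_act[OF r]])

lemma relatorI:
  "x \<in> carrier (SF A) \<Longrightarrow> y \<in> carrier (SF A) \<Longrightarrow> v \<in> SF_sub A {0} \<Longrightarrow>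
     frag_of (x \<oplus>\<^bsub>SF A\<^esub> y, v) - frag_of (x, v) - frag_of (y, v) \<in> TN"
  "x \<in> carrier (SF A) \<Longrightarrow> v \<in> SF_sub A {0} \<Longrightarrow> u \<in> SF_sub A {0} \<Longrightarrow>
     frag_of (x, v \<oplus>\<^bsub>SF A\<^esub> u) - frag_of (x, v) - frag_of (x, u) \<in> TN"
  "x \<in> carrier (SF A) \<Longrightarrow> s \<in> SF_sub A {0..} \<Longrightarrow> v \<in> SF_sub A {0} \<Longrightarrow>
     frag_of (x \<otimes>\<^bsub>SF A\<^esub> s, v) - frag_of (x, s \<odot>\<^bsub>V01 A\<^esub> v) \<in> TN"
  unfolding TN_def tensor_null_def tensor_relators_def V01_simps
  by (rule generate.incl, blast)+

lemma lmul_TN: "r \<in> carrier (SF A) \<Longrightarrow> z \<in> TN \<Longrightarrow> lmul r z \<in> TN"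
proof -
  assume r: "r \<in> carrier (SF A)" and "z \<in> TN"
  interpret SF: ring "SF A" by (rule ring_SF)
  note c = SF_sub_carrier[of _ A "{0..}"]
  show ?thesis using \<open>z \<in> TN\<close>
  proof (induction z rule: TN_induct)
    case (rel z)
    then consider
      (1) x y v where "z = frag_of (x \<oplus>\<^bsub>SF A\<^esub> y, v) - frag_of (x, v) - frag_of (y, v)"
        "x \<in> carrier (SF A)" "y \<in> carrier (SF A)" "v \<in> SF_sub A {0}"
      | (2) x v u where "z = frag_of (x, v \<oplus>\<^bsub>SF A\<^esub> u) - frag_of (x, v) - frag_of (x, u)"
        "x \<in> carrier (SF A)" "v \<in> SF_sub A {0}" "u \<in> SF_sub A {0}"
      | (3) x s v where "z = frag_of (x \<otimes>\<^bsub>SF A\<^esub> s, v) - frag_of (x, s \<odot>\<^bsub>V01 A\<^esub> v)"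
        "x \<in> carrier (SF A)" "s \<in> SF_sub A {0..}" "v \<in> SF_sub A {0}"
      unfolding tensor_relators_def V01_simps by auto
    then show ?case
    proof cases
      case 1
      then show ?thesis using relatorI(1)[of "r \<otimes>\<^bsub>SF A\<^esub> x" "r \<otimes>\<^bsub>SF A\<^esub> y" v] r
        by (simp add: lmul_simps SF.r_distr)
    next
      case 2
      then show ?thesis using relatorI(2)[of "r \<otimes>\<^bsub>SF A\<^esub> x" v u] r by (simp add: lmul_simps)
    next
      case 3
      then show ?thesis using relatorI(3)[of "r \<otimes>\<^bsub>SF A\<^esub> x" s v] r by (simp add: lmul_simps SF.m_assoc c)
    qed
  qed (simp_all add: lmul_simps TN_closed)
qed

lemma one_SF0: "\<one>\<^bsub>SF A\<^esub> \<in> SF_sub A {0}"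
  by (rule SF_sub_closed)

lemma frag_zero_TN: "frag_of (\<zero>\<^bsub>SF A\<^esub>, \<one>\<^bsub>SF A\<^esub>) \<in> TN" "x \<in> carrier (SF A) \<Longrightarrow> frag_of (x, \<zero>\<^bsub>SF A\<^esub>) \<in> TN"
proof -
  interpret SF: ring "SF A" by (rule ring_SF)
  show "frag_of (\<zero>\<^bsub>SF A\<^esub>, \<one>\<^bsub>SF A\<^esub>) \<in> TN"
    using TN_closed(4)[OF relatorI(1)[of "\<zero>\<^bsub>SF A\<^esub>" "\<zero>\<^bsub>SF A\<^esub>" "\<one>\<^bsub>SF A\<^esub>"]] one_SF0 by simp
  show "frag_of (x, \<zero>\<^bsub>SF A\<^esub>) \<in> TN" if "x \<in> carrier (SF A)"
    using TN_closed(4)[OF relatorI(2)[of x "\<zero>\<^bsub>SF A\<^esub>" "\<zero>\<^bsub>SF A\<^esub>"]] that SF_sub_closed(6) by simp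
qed

text \<open>The annihilator of the tensor of 1 and 1, pulled back to the free algebra; this is the
  left ideal modulo which monomials are straightened.\<close>

definition J :: "free_alg set" where "J = {x. frag_of (pr x, \<one>\<^bsub>SF A\<^esub>) \<in> TN}"

lemma J_props: "x \<in> J \<Longrightarrow> y \<in> J \<Longrightarrow> x + y \<in> J" "x \<in> J \<Longrightarrow> y * x \<in> J" "clifford_ideal A \<subseteq> J"
  "1 \<le> n \<Longrightarrow> gen a n \<in> J"
proof -
  interpret SF: ring "SF A" by (rule ring_SF)
  show "x + y \<in> J" if "x \<in> J" "y \<in> J" for x y
    using TN_closed(3)[OF TN_closed(3)[OF relatorI(1)[OF proj_closed[of A x] proj_closed[of A y] one_SF0]]] that
    unfolding J_def mem_Collect_eq proj_add by fastforce
  show "y * x \<in> J" if "x \<in> J" for x y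
    using lmul_TN[OF proj_closed, of "frag_of (pr x, \<one>\<^bsub>SF A\<^esub>)" y] that by (simp add: J_def lmul_simps proj_mult)
  show "clifford_ideal A \<subseteq> J"
    using frag_zero_TN(1) by (auto simp: J_def simp flip: proj_eq_zero_iff)
  show "gen a n \<in> J" if "1 \<le> n"
  proof -
    have p: "psi A a n \<in> SF_sub A {0..}" using that by (simp add: SF_sub_closed)
    have "psi A a n \<odot>\<^bsub>V01 A\<^esub> \<one>\<^bsub>SF A\<^esub> = \<zero>\<^bsub>SF A\<^esub>"
      by (rule SF0_inj) (use V01_smult[OF p one_SF0] that in \<open>simp_all add: SF_sub_closed act_simps F.psi_vac\<close>)
    then have "frag_of (\<one>\<^bsub>SF A\<^esub> \<otimes>\<^bsub>SF A\<^esub> psi A a n, \<one>\<^bsub>SF A\<^esub>) - frag_of (\<one>\<^bsub>SF A\<^esub>, \<zero>\<^bsub>SF A\<^esub>) \<in> TN"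
      using relatorI(3)[OF SF.one_closed p one_SF0] by simp
    then have "frag_of (psi A a n, \<one>\<^bsub>SF A\<^esub>) \<in> TN"
      using TN_closed(3)[OF _ frag_zero_TN(2)[OF SF.one_closed]] by (fastforce simp: psi_closed)
    then show ?thesis by (simp add: J_def proj_psi)
  qed
qed

text \<open>\<open>J\<close> contains the relations and the positive modes, so straightening is
  valid modulo \<open>J\<close>. This bounds the induced module from above, while the Fock action
  bounds it from below.\<close>

lemma normal_form_J: "x - Rep_fock (fact x fvac) \<in> J"
proof (induction x rule: free_alg_induct')
  case (1 l)
  show ?case
  proof (induction l)
    case Nil
    have "0 \<in> J" using J_props(3) proj_eq_zero_iff[of A 0] by (auto simp: proj_zero)
    then show ?case by (simp add: word_Nil fact_simps Rep_fvac)
  next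
    case (Cons s l)
    let ?y = "Rep_fock (fact (word l) fvac)"
    have "g s * ?y - cl s ?y \<in> J"
      by (rule gen_reduce) (use J_props(1,2,3) J_props(4)[of "snd s" "fst s"] in auto)
    moreover have "g s * (word l - ?y) \<in> J" by (rule J_props(2)[OF Cons])
    ultimately have "g s * (word l - ?y) + (g s * ?y - cl s ?y) \<in> J" by (intro J_props(1))
    then show ?case by (simp add: word_Cons fact_simps Rep_fpsi algebra_simps)
  qed
next
  case (2 x y)
  then show ?case using J_props(1)[OF 2] by (simp add: fact_simps Rep_fock_add algebra_simps)
next
  case (3 c x)
  then show ?case using J_props(2)[OF 3, of "scal c"] by (simp add: fact_simps Rep_fscale algebra_simps)
qed

text \<open>An element \<open>v\<close> of the zero mode subalgebra is \<open>v\<close> acting on 1,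
  so it moves across the tensor sign. For differences, \<open>x = (x - y) + y\<close> turns
  additivity into a rule for subtraction.\<close>

lemma frag_cyclic:
  assumes "z \<in> carrier TF"
  shows "\<exists>x. z - frag_of (pr x, \<one>\<^bsub>SF A\<^esub>) \<in> TN"
  using assms unfolding TF_simps(1)
proof (induction z rule: frag_induction)
  case zero
  have "0 - frag_of (pr 0, \<one>\<^bsub>SF A\<^esub>) \<in> TN"
    using TN_closed(4)[OF frag_zero_TN(1)] by (simp add: proj_zero)
  then show ?case by blast
next
  case (one p)
  obtain x v where p: "p = (x, v)" "x \<in> carrier (SF A)" "v \<in> SF_sub A {0}" using one by auto
  have v': "v \<in> SF_sub A {0..}" using SF_sub_mono[of "{0}" "{0..}" A] p(3) by auto
  have "v \<odot>\<^bsub>V01 A\<^esub> \<one>\<^bsub>SF A\<^esub> = v"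
    by (rule SF0_inj) (use V01_smult[OF v' one_SF0] p(3) in \<open>simp_all add: act_simps\<close>)
  then have "frag_of (x \<otimes>\<^bsub>SF A\<^esub> v, \<one>\<^bsub>SF A\<^esub>) - frag_of (x, v) \<in> TN"
    using relatorI(3)[OF p(2) v' one_SF0] by simp
  then have "frag_of p - frag_of (x \<otimes>\<^bsub>SF A\<^esub> v, \<one>\<^bsub>SF A\<^esub>) \<in> TN"
    using TN_closed(4) p(1) by fastforce
  moreover obtain u where "x \<otimes>\<^bsub>SF A\<^esub> v = pr u"
    using proj_surj SF_ring_closed(2)[OF p(2)] SF_sub_carrier[OF p(3)] by blast
  ultimately show ?case by metis
next
  case (diff a b)
  then obtain x y where d: "a - frag_of (pr x, \<one>\<^bsub>SF A\<^esub>) \<in> TN" "b - frag_of (pr y, \<one>\<^bsub>SF A\<^esub>) \<in> TN" by blast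
  have d3: "frag_of (pr x, \<one>\<^bsub>SF A\<^esub>) - frag_of (pr (x - y), \<one>\<^bsub>SF A\<^esub>) - frag_of (pr y, \<one>\<^bsub>SF A\<^esub>) \<in> TN"
    using relatorI(1)[OF proj_closed proj_closed one_SF0, of "x - y" y] by (simp flip: proj_add)
  have "(a - frag_of (pr x, \<one>\<^bsub>SF A\<^esub>)) - (b - frag_of (pr y, \<one>\<^bsub>SF A\<^esub>))
     + (frag_of (pr x, \<one>\<^bsub>SF A\<^esub>) - frag_of (pr (x - y), \<one>\<^bsub>SF A\<^esub>) - frag_of (pr y, \<one>\<^bsub>SF A\<^esub>)) \<in> TN"
    by (rule TN_closed(3)[OF TN_diff[OF d] d3])
  then have "a - b - frag_of (pr (x - y), \<one>\<^bsub>SF A\<^esub>) \<in> TN" by (simp add: algebra_simps)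
  then show ?case by blast
qed

text \<open>Reduce to a tensor with second factor 1. If its image vanishes, its ordered form is 0,
  and \<open>normal_form_J\<close> puts the first factor into \<open>J\<close>.\<close>

lemma phi_eq_0: "z \<in> carrier TF \<Longrightarrow> phi z = 0 \<Longrightarrow> z \<in> TN"
proof -
  assume z: "z \<in> carrier TF" "phi z = 0"
  obtain x where x: "z - frag_of (pr x, \<one>\<^bsub>SF A\<^esub>) \<in> TN" using frag_cyclic[OF z(1)] by blast
  then have "fact x fvac = 0"
    using phi_TN[OF x] z(2) by (simp add: phi_diff phi_frag_of act_pr act_simps)
  then have "frag_of (pr x, \<one>\<^bsub>SF A\<^esub>) \<in> TN"
    using normal_form_J[of x] by (simp add: Rep_fock_zero J_def)
  from TN_closed(3)[OF x this] show ?thesis by simp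
qed

lemma phi_surj: "\<exists>z\<in>carrier TF. phi z = y"
proof -
  let ?U = "range (\<lambda>x. fact x fvac)"
  have "?U = UNIV"
  proof (rule fpsi_cyclic)
    show "fock.subspace ?U"
    proof (rule fock.subspaceI)
      show "0 \<in> ?U" using fact_simps(6)[of fvac] by (metis rangeI)
      fix u v c assume u: "u \<in> ?U"
      then obtain x where x: "u = fact x fvac" by blast
      have "fscale c u = fact (scal c * x) fvac" by (simp add: x fact_simps)
      then show "fscale c u \<in> ?U" by blast
      assume "v \<in> ?U"
      then obtain y where "v = fact y fvac" by blast
      then have "u + v = fact (x + y) fvac" by (simp add: x fact_simps)
      then show "u + v \<in> ?U" by blast
    qed
    show "fvac \<in> ?U" using fact_simps(5) by (metis rangeI)
    show "fpsi a n v \<in> ?U" if "v \<in> ?U" for a n v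
    proof -
      from that obtain x where "v = fact x fvac" by blast
      then have "fpsi a n v = fact (gen a n * x) fvac" by (simp add: fact_simps)
      then show ?thesis by blast
    qed
  qed
  then obtain x where "y = fact x fvac" by blast
  then have "phi (frag_of (pr x, \<one>\<^bsub>SF A\<^esub>)) = y"
    by (simp add: phi_frag_of act_pr act_simps)
  then show ?thesis using frag_of_TF[OF proj_closed one_SF0] by blast
qed

definition cos :: "(sf \<times> sf \<Rightarrow>\<^sub>0 int) \<Rightarrow> ind" where "cos z = {h + z | h. h \<in> TN}"

lemma cos_r_coset: "TN #>\<^bsub>TF\<^esub> z = cos z"
  by (auto simp: cos_def r_coset_def TF_simps)

lemma cos_eq_iff: "cos z = cos z' \<longleftrightarrow> z - z' \<in> TN"
proof
  assume "cos z = cos z'"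
  moreover have "z \<in> cos z" unfolding cos_def using TN_closed(2) by force
  ultimately obtain h where "h \<in> TN" "z = h + z'" by (auto simp: cos_def)
  then show "z - z' \<in> TN" by simp
next
  assume d: "z - z' \<in> TN"
  show "cos z = cos z'"
  proof (intro equalityI subsetI)
    fix y assume "y \<in> cos z"
    then obtain h where "h \<in> TN" "y = h + z" by (auto simp: cos_def)
    then have "h + (z - z') \<in> TN" "y = (h + (z - z')) + z'" using d TN_closed(3) by simp_all
    then show "y \<in> cos z'" unfolding cos_def by blast
  next
    fix y assume "y \<in> cos z'"
    then obtain h where "h \<in> TN" "y = h + z'" by (auto simp: cos_def)
    then have "h - (z - z') \<in> TN" "y = (h - (z - z')) + z" using d TN_diff by simp_all
    then show "y \<in> cos z" unfolding cos_def by blast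
  qed
qed

lemma cos_mem: "z' \<in> cos z \<Longrightarrow> cos z' = cos z"
  unfolding cos_eq_iff by (auto simp: cos_def)

lemma self_cos: "z \<in> cos z"
  unfolding cos_def using TN_closed(2) by force

lemma Ind_carrier: "carrier (Ind A) = cos ` carrier TF"
  by (simp add: Ind_def induced_def carrier_FactGroup cos_r_coset flip: TF_def TN_def)

lemma Ind_add: "cos z \<oplus>\<^bsub>Ind A\<^esub> cos z' = cos (z + z')"
proof -
  have "cos z \<oplus>\<^bsub>Ind A\<^esub> cos z' = cos z <#>\<^bsub>TF\<^esub> cos z'"
    by (simp add: Ind_def induced_def flip: TF_def TN_def)
  also have "\<dots> = cos (z + z')"
  proof (intro equalityI subsetI)
    fix y assume "y \<in> cos z <#>\<^bsub>TF\<^esub> cos z'"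
    then obtain h h' where h: "h \<in> TN" "h' \<in> TN" "y = (h + z) + (h' + z')"
      by (auto simp: set_mult_def cos_def TF_simps)
    then have "h + h' \<in> TN" "y = (h + h') + (z + z')" using TN_closed(3) by (simp_all add: algebra_simps)
    then show "y \<in> cos (z + z')" unfolding cos_def by blast
  next
    fix y assume "y \<in> cos (z + z')"
    then obtain h where h: "h \<in> TN" "y = (h + z) + z'" by (auto simp: cos_def add.assoc)
    then have "h + z \<in> cos z" by (auto simp: cos_def)
    then show "y \<in> cos z <#>\<^bsub>TF\<^esub> cos z'"
      using h(2) self_cos[of z'] by (auto simp: set_mult_def TF_simps)
  qed
  finally show ?thesis .
qed

lemma Ind_zero: "\<zero>\<^bsub>Ind A\<^esub> = cos 0"
  by (auto simp: Ind_def induced_def cos_def simp flip: TF_def TN_def)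

lemma Ind_smult:
  assumes r: "r \<in> carrier (SF A)"
  shows "r \<odot>\<^bsub>Ind A\<^esub> cos z = cos (lmul r z)"
proof -
  have "r \<odot>\<^bsub>Ind A\<^esub> cos z = (\<Union>y\<in>cos z. cos (lmul r y))"
    by (simp add: Ind_def induced_def cos_r_coset lmul_def flip: TF_def TN_def)
  also have "\<dots> = (\<Union>y\<in>cos z. cos (lmul r z))"
  proof (rule SUP_cong[OF refl])
    fix y assume "y \<in> cos z"
    then have "y - z \<in> TN" by (auto simp: cos_def)
    then show "cos (lmul r y) = cos (lmul r z)"
      unfolding cos_eq_iff using lmul_TN[OF r] by (simp flip: lmul_simps)
  qed
  also have "\<dots> = cos (lmul r z)" using self_cos by blast
  finally show ?thesis .
qed

definition Phi :: "ind \<Rightarrow> fock" where "Phi T = phi (SOME z. z \<in> T)"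

lemma Phi_cos: "Phi (cos z) = phi z"
proof -
  have "(SOME y. y \<in> cos z) \<in> cos z" using self_cos by (rule someI)
  then have "(SOME y. y \<in> cos z) - z \<in> TN" by (simp add: cos_mem flip: cos_eq_iff)
  then show ?thesis using phi_TN by (force simp: Phi_def phi_diff)
qed

lemma Phi_bij: "bij_betw Phi (carrier (Ind A)) UNIV"
  unfolding bij_betw_def
proof
  show "inj_on Phi (carrier (Ind A))"
  proof (rule inj_onI)
    fix s t assume "s \<in> carrier (Ind A)" "t \<in> carrier (Ind A)" "Phi s = Phi t"
    then obtain y z where "s = cos y" "t = cos z" "y \<in> carrier TF" "z \<in> carrier TF" "phi y = phi z"
      by (auto simp: Ind_carrier Phi_cos)
    then show "s = t" using phi_eq_0[of "y - z"] by (simp add: cos_eq_iff phi_diff TF_closed)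
  qed
  show "Phi ` carrier (Ind A) = UNIV"
  proof -
    have "y \<in> Phi ` carrier (Ind A)" for y
    proof -
      obtain z where "z \<in> carrier TF" "phi z = y" using phi_surj by blast
      then show ?thesis unfolding Ind_carrier using Phi_cos by (metis imageI)
    qed
    then show ?thesis by blast
  qed
qed

lemma Ind_zero_closed: "\<zero>\<^bsub>Ind A\<^esub> \<in> carrier (Ind A)" and Phi_zero: "Phi \<zero>\<^bsub>Ind A\<^esub> = 0"
  by (auto simp: Ind_carrier Ind_zero Phi_cos phi_zero TF_closed)

lemma Phi_add:
  assumes "s \<in> carrier (Ind A)" "t \<in> carrier (Ind A)"
  shows "s \<oplus>\<^bsub>Ind A\<^esub> t \<in> carrier (Ind A)" "Phi (s \<oplus>\<^bsub>Ind A\<^esub> t) = Phi s + Phi t"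
  using assms by (auto simp: Ind_carrier Ind_add Phi_cos phi_add TF_closed)

lemma Phi_smult:
  assumes "r \<in> carrier (SF A)" "t \<in> carrier (Ind A)"
  shows "r \<odot>\<^bsub>Ind A\<^esub> t \<in> carrier (Ind A)" "Phi (r \<odot>\<^bsub>Ind A\<^esub> t) = act r (Phi t)"
  using assms by (auto simp: Ind_carrier Ind_smult Phi_cos phi_lmul lmul_TF)

end

section \<open>Transport of structure\<close>

text \<open>The image is only required to be a subspace, so the same transport serves the whole
  induced module and, by \<open>restrict\<close>, each summand.\<close>

locale embedded_module = complex_space scale
  for scale :: "complex \<Rightarrow> 'v :: ab_group_add \<Rightarrow> 'v" (infixr \<open>\<cdot>\<close> 75) +
  fixes V :: "(complex, 'm) module" and \<Phi> :: "'m \<Rightarrow> 'v"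
  assumes inj: "inj_on \<Phi> (carrier V)" and image_subspace: "subspace (\<Phi> ` carrier V)"
    and zero_closed: "\<zero>\<^bsub>V\<^esub> \<in> carrier V" and \<Phi>_zero: "\<Phi> \<zero>\<^bsub>V\<^esub> = 0"
    and add_closed: "s \<in> carrier V \<Longrightarrow> t \<in> carrier V \<Longrightarrow> s \<oplus>\<^bsub>V\<^esub> t \<in> carrier V"
    and \<Phi>_add: "s \<in> carrier V \<Longrightarrow> t \<in> carrier V \<Longrightarrow> \<Phi> (s \<oplus>\<^bsub>V\<^esub> t) = \<Phi> s + \<Phi> t"
    and smult_closed: "t \<in> carrier V \<Longrightarrow> c \<odot>\<^bsub>V\<^esub> t \<in> carrier V"
    and \<Phi>_smult: "t \<in> carrier V \<Longrightarrow> \<Phi> (c \<odot>\<^bsub>V\<^esub> t) = c \<cdot> \<Phi> t"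
begin

lemmas closed = zero_closed add_closed smult_closed

lemma \<Phi>_eqI: "s \<in> carrier V \<Longrightarrow> t \<in> carrier V \<Longrightarrow> \<Phi> s = \<Phi> t \<Longrightarrow> s = t"
  using inj by (rule inj_onD)

lemma \<Phi>_eq_0: "t \<in> carrier V \<Longrightarrow> \<Phi> t = 0 \<longleftrightarrow> t = \<zero>\<^bsub>V\<^esub>"
  using \<Phi>_eqI[of t "\<zero>\<^bsub>V\<^esub>"] by (auto simp: closed \<Phi>_zero)

lemma abelian_group: "abelian_group V"
proof (rule abelian_groupI)
  fix x assume x: "x \<in> carrier V"
  then have "- \<Phi> x \<in> \<Phi> ` carrier V" by (intro subspace_neg[OF image_subspace] imageI)
  then obtain y where "y \<in> carrier V" "\<Phi> y = - \<Phi> x" by auto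
  with x show "\<exists>y\<in>carrier V. y \<oplus>\<^bsub>V\<^esub> x = \<zero>\<^bsub>V\<^esub>"
    by (intro bexI[of _ y] \<Phi>_eqI) (simp_all add: closed \<Phi>_zero \<Phi>_add)
qed (auto intro!: \<Phi>_eqI simp: closed \<Phi>_zero \<Phi>_add ac_simps)

sublocale abelian_group V by (rule abelian_group)

lemma \<Phi>_a_inv: "t \<in> carrier V \<Longrightarrow> \<Phi> (\<ominus>\<^bsub>V\<^esub> t) = - \<Phi> t"
  using \<Phi>_add[of "\<ominus>\<^bsub>V\<^esub> t" t] by (simp add: l_neg \<Phi>_zero add_eq_0_iff2)

lemma \<Phi>_a_minus: "s \<in> carrier V \<Longrightarrow> t \<in> carrier V \<Longrightarrow> \<Phi> (s \<ominus>\<^bsub>V\<^esub> t) = \<Phi> s - \<Phi> t"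
  by (simp add: a_minus_def \<Phi>_add \<Phi>_a_inv)

lemma \<Phi>_finsum:
  assumes "finite K" "\<And>k. k \<in> K \<Longrightarrow> u k \<in> carrier V"
  shows "finsum V u K \<in> carrier V" "\<Phi> (finsum V u K) = (\<Sum>k\<in>K. \<Phi> (u k))"
  using assms by (induction K rule: finite_induct) (simp_all add: \<Phi>_zero \<Phi>_add Pi_iff)

lemma module: "module CC V"
proof (rule moduleI)
  show "cring CC" unfolding CC_def by (rule cring_from_type_algebra)
  have CC: "a \<oplus>\<^bsub>CC\<^esub> b = a + b" "a \<otimes>\<^bsub>CC\<^esub> b = a * b" "\<one>\<^bsub>CC\<^esub> = 1" for a b
    by (simp_all add: CC_def ring_of_type_algebra_def)
  show "(a \<oplus>\<^bsub>CC\<^esub> b) \<odot>\<^bsub>V\<^esub> x = a \<odot>\<^bsub>V\<^esub> x \<oplus>\<^bsub>V\<^esub> b \<odot>\<^bsub>V\<^esub> x" if "x \<in> carrier V" for a b x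
    using that by (intro \<Phi>_eqI) (simp_all add: closed CC \<Phi>_add \<Phi>_smult scale_left_distrib)
  show "a \<odot>\<^bsub>V\<^esub> (x \<oplus>\<^bsub>V\<^esub> y) = a \<odot>\<^bsub>V\<^esub> x \<oplus>\<^bsub>V\<^esub> a \<odot>\<^bsub>V\<^esub> y" if "x \<in> carrier V" "y \<in> carrier V" for a x y
    using that by (intro \<Phi>_eqI) (simp_all add: closed \<Phi>_add \<Phi>_smult scale_right_distrib)
  show "(a \<otimes>\<^bsub>CC\<^esub> b) \<odot>\<^bsub>V\<^esub> x = a \<odot>\<^bsub>V\<^esub> (b \<odot>\<^bsub>V\<^esub> x)" if "x \<in> carrier V" for a b x
    using that by (intro \<Phi>_eqI) (simp_all add: closed CC \<Phi>_smult)
  show "\<one>\<^bsub>CC\<^esub> \<odot>\<^bsub>V\<^esub> x = x" if "x \<in> carrier V" for x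
    using that by (intro \<Phi>_eqI) (simp_all add: closed CC \<Phi>_smult)
qed (simp_all add: abelian_group closed)

lemma image_mem_iff: "U \<subseteq> carrier V \<Longrightarrow> t \<in> carrier V \<Longrightarrow> \<Phi> t \<in> \<Phi> ` U \<longleftrightarrow> t \<in> U"
  by (rule inj_on_image_mem_iff[OF inj])

lemma submodule_iff: "submodule U CC V \<longleftrightarrow> U \<subseteq> carrier V \<and> subspace (\<Phi> ` U)"
proof
  assume U: "submodule U CC V"
  note E = module.submoduleE[OF module U]
  have CC: "carrier CC = UNIV" by (simp add: CC_def ring_of_type_algebra_def)
  have "\<zero>\<^bsub>V\<^esub> \<in> U"
    using subgroup.one_closed[OF submodule.axioms(1)[OF U]] by simp
  then have "subspace (\<Phi> ` U)"
    using E(1,4,5) \<Phi>_zero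
    by (intro subspaceI) (auto simp: CC subset_iff simp flip: \<Phi>_add \<Phi>_smult intro: image_eqI)
  then show "U \<subseteq> carrier V \<and> subspace (\<Phi> ` U)" using E(1) by blast
next
  assume "U \<subseteq> carrier V \<and> subspace (\<Phi> ` U)"
  then have U: "U \<subseteq> carrier V" and S: "subspace (\<Phi> ` U)" by auto
  have *: "t \<in> U" if "t \<in> carrier V" "\<Phi> t \<in> \<Phi> ` U" for t
    using image_mem_iff[OF U] that by blast
  have c: "t \<in> carrier V" if "t \<in> U" for t using U that by blast
  show "submodule U CC V"
    by (intro module.submoduleI[OF module] * U)
      (auto simp: c closed \<Phi>_zero \<Phi>_a_inv \<Phi>_add \<Phi>_smult
        intro!: subspace_0[OF S] subspace_neg[OF S] subspace_add[OF S] subspace_scale[OF S])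
qed

lemma restrict:
  assumes "subspace S"
  shows "embedded_module scale (V\<lparr>carrier := {t \<in> carrier V. \<Phi> t \<in> S}\<rparr>) \<Phi>"
proof
  have *: "\<Phi> ` {t \<in> carrier V. \<Phi> t \<in> S} = \<Phi> ` carrier V \<inter> S" by auto
  show "subspace (\<Phi> ` carrier (V\<lparr>carrier := {t \<in> carrier V. \<Phi> t \<in> S}\<rparr>))"
    using subspace_inter[OF image_subspace assms] by (simp add: *)
  show "inj_on \<Phi> (carrier (V\<lparr>carrier := {t \<in> carrier V. \<Phi> t \<in> S}\<rparr>))"
    using inj by (auto intro: inj_on_subset)
qed (auto simp: closed \<Phi>_zero \<Phi>_add \<Phi>_smult subspace_0[OF assms] subspace_add[OF assms] subspace_scale[OF assms])

lemma virasoro_moduleI: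
  assumes L: "\<And>n t. t \<in> carrier V \<Longrightarrow> L n t \<in> carrier V" "\<And>n t. t \<in> carrier V \<Longrightarrow> \<Phi> (L n t) = M n (\<Phi> t)"
    and M: "\<And>n. lin (M n)"
      "\<And>m n v. M m (M n v) - M n (M m v) =
         of_int (m - n) \<cdot> M (m + n) v + (if m + n = 0 then c / 12 * of_int (m ^ 3 - m) else 0) \<cdot> v"
  shows "virasoro_module c V L"
  unfolding virasoro_module_def
proof (intro conjI allI ballI)
  fix n v u assume "v \<in> carrier V" "u \<in> carrier V"
  then show "L n (v \<oplus>\<^bsub>V\<^esub> u) = L n v \<oplus>\<^bsub>V\<^esub> L n u"
    by (intro \<Phi>_eqI) (simp_all add: closed L \<Phi>_add lin_add[OF M(1)])
next
  fix n t v assume "v \<in> carrier V"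
  then show "L n (t \<odot>\<^bsub>V\<^esub> v) = t \<odot>\<^bsub>V\<^esub> L n v"
    by (intro \<Phi>_eqI) (simp_all add: closed L \<Phi>_smult lin_scale[OF M(1)])
next
  fix m n v assume "v \<in> carrier V"
  then show "L m (L n v) \<ominus>\<^bsub>V\<^esub> L n (L m v) = of_int (m - n) \<odot>\<^bsub>V\<^esub> L (m + n) v
      \<oplus>\<^bsub>V\<^esub> (if m + n = 0 then c / 12 * of_int (m ^ 3 - m) else 0) \<odot>\<^bsub>V\<^esub> v"
    using M(2)[of m n "\<Phi> v"]
    by (intro \<Phi>_eqI) (simp_all add: closed L \<Phi>_smult \<Phi>_add \<Phi>_a_minus del: of_int_diff of_int_power)
qed (simp_all add: module L)

end

section \<open>The decomposition of the induced module\<close>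

context irregular_connection
begin

lemma Ind_complex_simps [simp]: "carrier (Ind_complex A) = carrier (Ind A)" "zero (Ind_complex A) = zero (Ind A)"
  "add (Ind_complex A) = add (Ind A)" "c \<odot>\<^bsub>Ind_complex A\<^esub> t = sc A c \<odot>\<^bsub>Ind A\<^esub> t"
  by (simp_all add: Ind_complex_def restrict_scalars_def)

lemma embedded: "embedded_module fscale (Ind_complex A) Phi"
proof
  show "inj_on Phi (carrier (Ind_complex A))" "fock.subspace (Phi ` carrier (Ind_complex A))"
    using Phi_bij by (auto simp: bij_betw_def)
qed (simp_all add: Ind_zero_closed Phi_zero Phi_add Phi_smult sc_closed act_simps)

sublocale V: embedded_module fscale "Ind_complex A" Phi by (rule embedded)

text \<open>Finite sums depend on the additive structure alone, which restriction of scalars leaves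
  as it is.\<close>

lemma finsum_Ind: "finsum (Ind A) = finsum (Ind_complex A)"
  by (rule ext)+ (simp only: finsum_def finprod_def partial_object.simps monoid.simps Ind_complex_simps)

lemma nprod_closed: "nprod A a i b j \<in> carrier (SF A)"
proof -
  interpret SF: ring "SF A" by (rule ring_SF)
  show ?thesis by (simp add: nprod_def psi_closed sc_closed)
qed

lemma act_nprod: "act (nprod A Minus i Plus j) v = F.nop i j v"
proof -
  interpret SF: ring "SF A" by (rule ring_SF)
  show ?thesis by (simp add: nprod_def F.nop_def act_simps psi_closed sc_closed)
qed

lemma Phi_nprod:
  assumes "t \<in> carrier (Ind A)"
  shows "nprod A Minus i Plus j \<odot>\<^bsub>Ind A\<^esub> t \<in> carrier (Ind A)"
    and "Phi (nprod A Minus i Plus j \<odot>\<^bsub>Ind A\<^esub> t) = F.nop i j (Phi t)"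
  using Phi_smult[OF nprod_closed assms] by (simp_all only: act_nprod)

lemma vir_const: "vir_const A n = F.vc n"
  by (simp add: vir_const_def F.vc_def Cf_def)

text \<open>\<open>Phi\<close> is injective, so the indices with nonzero terms are the same on both
  sides, and they are finitely many by smoothness.\<close>

lemma Phi_vir:
  assumes t: "t \<in> carrier (Ind A)"
  shows "vir A n t \<in> carrier (Ind A)" "Phi (vir A n t) = F.Vir n (Phi t)"
proof -
  let ?S = "{i. nprod A Minus i Plus (n - i) \<odot>\<^bsub>Ind A\<^esub> t \<noteq> \<zero>\<^bsub>Ind A\<^esub>}"
  have S: "?S = {i. F.nop i (n - i) (Phi t) \<noteq> 0}"
    using V.\<Phi>_eq_0[of "nprod A Minus _ Plus _ \<odot>\<^bsub>Ind A\<^esub> t"] Phi_nprod[OF t] by auto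
  obtain K where K: "\<And>a n. K \<le> n \<Longrightarrow> fpsi a n (Phi t) = 0" using F.smooth by blast
  have "F.nop i (n - i) (Phi t) = 0" if "i \<notin> {n - K<..<K}" for i
    using F.nop_zero[of K "Phi t" i "n - i"] K that by force
  then have fin: "finite ?S"
    unfolding S by (intro finite_subset[OF _ finite_greaterThanLessThan_int[of "n - K" K]]) blast
  note sm = Phi_smult[OF sc_closed t]
  let ?f = "\<lambda>i. nprod A Minus i Plus (n - i) \<odot>\<^bsub>Ind A\<^esub> t"
  have fs: "finsum (Ind A) ?f ?S \<in> carrier (Ind A)" "Phi (finsum (Ind A) ?f ?S) = (\<Sum>i\<in>?S. F.nop i (n - i) (Phi t))"
    unfolding finsum_Ind using V.\<Phi>_finsum[OF fin, of ?f] Phi_nprod[OF t] by simp_all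
  show "vir A n t \<in> carrier (Ind A)"
    unfolding vir_def by (intro Phi_add(1) sm fs)
  have "Phi (vir A n t) = (\<Sum>i\<in>?S. F.nop i (n - i) (Phi t)) + fscale (F.vc n) (Phi t)"
    unfolding vir_def Phi_add(2)[OF fs(1) sm(1)] fs(2) sm(2) act_simps(7) vir_const ..
  then show "Phi (vir A n t) = F.Vir n (Phi t)"
    by (simp add: F.Vir_def Sum_any.expand_set S)
qed

lemma simple_Ind: "simple_module (SF A) (Ind A)"
  unfolding simple_module_def
proof (intro conjI allI impI)
  have "fvac \<in> Phi ` carrier (Ind A)" using Phi_bij by (simp add: bij_betw_def)
  then show "carrier (Ind A) \<noteq> {\<zero>\<^bsub>Ind A\<^esub>}" using Phi_zero F.vac_nz by auto
  fix U assume U: "subgroup U (add_monoid (Ind A)) \<and> (\<forall>r\<in>carrier (SF A). \<forall>u\<in>U. r \<odot>\<^bsub>Ind A\<^esub> u \<in> U)"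
  then have sub: "U \<subseteq> carrier (Ind A)" and zero: "\<zero>\<^bsub>Ind A\<^esub> \<in> U"
    and add: "\<And>s t. s \<in> U \<Longrightarrow> t \<in> U \<Longrightarrow> s \<oplus>\<^bsub>Ind A\<^esub> t \<in> U"
    using subgroup.subset subgroup.one_closed subgroup.m_closed by fastforce+
  have *: "act r v \<in> Phi ` U" if "r \<in> carrier (SF A)" "v \<in> Phi ` U" for r v
  proof -
    obtain u where u: "u \<in> U" "v = Phi u" using \<open>v \<in> Phi ` U\<close> by blast
    then have "act r v = Phi (r \<odot>\<^bsub>Ind A\<^esub> u)" using that(1) sub Phi_smult(2) by (simp add: subset_iff)
    then show ?thesis using U u(1) that(1) by blast
  qed
  \<comment> \<open>The additive group \<open>U\<close> is a complex subspace because the scalars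
    lie in the algebra.\<close>
  have S: "fock.subspace (Phi ` U)"
  proof (rule fock.subspaceI)
    show "0 \<in> Phi ` U" using zero Phi_zero by (metis imageI)
    show "x + y \<in> Phi ` U" if "x \<in> Phi ` U" "y \<in> Phi ` U" for x y
      using that add sub Phi_add(2) by (auto simp: subset_iff simp flip: Phi_add(2))
    show "fscale c x \<in> Phi ` U" if "x \<in> Phi ` U" for c x
      using *[OF sc_closed that] by (simp add: act_simps)
  qed
  show "U = {\<zero>\<^bsub>Ind A\<^esub>} \<or> U = carrier (Ind A)"
  proof (cases "U = {\<zero>\<^bsub>Ind A\<^esub>}")
    case False
    with zero obtain u where "u \<in> U" "u \<noteq> \<zero>\<^bsub>Ind A\<^esub>" by blast
    then have "Phi u \<in> Phi ` U" "Phi u \<noteq> 0" using sub V.\<Phi>_eq_0 by auto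
    then have "Phi ` U = UNIV"
      using F.simple[OF S, of "Phi u"] *[OF psi_closed] by (simp add: act_simps)
    then show ?thesis using sub V.image_mem_iff[of U] by auto
  qed simp
qed

text \<open>Stated so as to cover the summands as well as the whole module; \<open>- 1 / 6\<close>
  is \<open>c / 12\<close> for \<open>c = -2\<close>.\<close>

lemma virasoro_embedded:
  assumes "embedded_module fscale V Phi" "carrier V \<subseteq> carrier (Ind A)"
    and "\<And>n t. t \<in> carrier V \<Longrightarrow> vir A n t \<in> carrier V"
  shows "virasoro_module (-2) V (vir A)"
proof (rule embedded_module.virasoro_moduleI[OF assms(1)])
  show "Phi (vir A n t) = F.Vir n (Phi t)" if "t \<in> carrier V" for n t
    using that assms(2) Phi_vir(2) by blast
  have *: "(if m + n = 0 then - (of_int (m ^ 3 - m) / 6) else 0) =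
      (if m + n = 0 then - 2 / 12 * of_int (m ^ 3 - m) else (0 :: complex))" for m n :: int
    by (rule if_cong) (simp_all only: field_simps, simp_all)
  show "F.Vir m (F.Vir n v) - F.Vir n (F.Vir m v) = fscale (of_int (m - n)) (F.Vir (m + n) v)
      + fscale (if m + n = 0 then - 2 / 12 * of_int (m ^ 3 - m) else 0) v" for m n v
    by (rule F.virasoro[of m n v, unfolded *])
qed (rule assms(3) F.lin_Vir, assumption?)+

lemma whittaker_sum:
  "\<exists>w W. vir_direct_sum (Ind_complex A) (vir A) W
     \<and> (\<forall>k :: int. whittaker_module (-2) ((Ind_complex A)\<lparr>carrier := W k\<rparr>) (vir A)
              (\<xi> * (of_int k + \<epsilon>)) (\<xi>\<^sup>2 / 2) (w k))"
proof -
  from F.whittaker_decomposition show ?thesis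
  proof (elim exE conjE, goal_cases)
    case (1 w W)
    have w: "w k \<in> W k" "w k \<noteq> 0" "F.Vir 1 (w k) = fscale (\<xi> * (of_int k + \<epsilon>)) (w k)"
        "F.Vir 2 (w k) = fscale (\<xi>\<^sup>2 / 2) (w k)" "n \<ge> 3 \<Longrightarrow> F.Vir n (w k) = 0" for k n
      using 1(1) by simp_all
    have W: "fock.subspace (W k)" "v \<in> W k \<Longrightarrow> F.Vir n v \<in> W k" for k :: int and n v
      using 1(2) by simp_all
    have min: "fock.subspace U \<Longrightarrow> (\<forall>n. \<forall>v\<in>U. F.Vir n v \<in> U) \<Longrightarrow> w k \<in> U \<Longrightarrow> W k \<subseteq> U" for k U
      using 1(3) by simp
    note sum = 1(4)[rule_format]
    define W' where "W' k = {t \<in> carrier (Ind A). Phi t \<in> W k}" for k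
    define Psi where "Psi = inv_into (carrier (Ind A)) Phi"
    have Psi: "Psi v \<in> carrier (Ind A)" "Phi (Psi v) = v" for v
      using Phi_bij inv_into_into[of v Phi "carrier (Ind A)"] by (auto simp: Psi_def bij_betw_def f_inv_into_f)
    have Psi_Phi: "Psi (Phi t) = t" if "t \<in> carrier (Ind A)" for t
      using V.\<Phi>_eqI[of "Psi (Phi t)" t] that Psi by simp
    have vir_W': "vir A n t \<in> W' k" if "t \<in> W' k" for n t k
      using that Phi_vir W(2) by (auto simp: W'_def)
    have Phi_W': "Phi ` W' k = W k" for k
      using Psi by (force simp: W'_def intro: image_eqI[of _ _ "Psi _"])
    have W'_sub: "W' k \<subseteq> carrier (Ind A)" for k by (auto simp: W'_def)
    have restr: "embedded_module fscale ((Ind_complex A)\<lparr>carrier := W' k\<rparr>) Phi" for k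
      using V.restrict[OF W(1)[of k]] by (simp add: W'_def)
    have "vir_direct_sum (Ind_complex A) (vir A) W'"
      unfolding vir_direct_sum_def
    proof (intro conjI allI ballI)
      fix k show "vir_submodule (Ind_complex A) (vir A) (W' k)"
        unfolding vir_submodule_def V.submodule_iff using W(1) Phi_W' vir_W' W'_sub by simp
    next
      fix t assume "t \<in> carrier (Ind_complex A)"
      then have t: "t \<in> carrier (Ind A)" by simp
      obtain u where u: "\<And>k. u k \<in> W k" "finite {k. u k \<noteq> 0}" "Phi t = (\<Sum>k | u k \<noteq> 0. u k)"
        and uniq: "\<And>u'. (\<And>k. u' k \<in> W k) \<Longrightarrow> finite {k. u' k \<noteq> 0} \<Longrightarrow> Phi t = (\<Sum>k | u' k \<noteq> 0. u' k) \<Longrightarrow> u' = u"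
        using sum[of "Phi t"] by (elim ex1E conjE) blast
      let ?P = "\<lambda>u'. (\<forall>k. u' k \<in> W' k) \<and> finite {k. u' k \<noteq> \<zero>\<^bsub>Ind_complex A\<^esub>} \<and>
          t = finsum (Ind_complex A) u' {k. u' k \<noteq> \<zero>\<^bsub>Ind_complex A\<^esub>}"
      have "?P (\<lambda>k. Psi (u k))"
      proof -
        have *: "{k. Psi (u k) \<noteq> \<zero>\<^bsub>Ind_complex A\<^esub>} = {k. u k \<noteq> 0}"
          using V.\<Phi>_eq_0[of "Psi _"] Psi by auto
        show ?thesis unfolding *
        proof (intro conjI allI)
          show "t = finsum (Ind_complex A) (\<lambda>k. Psi (u k)) {k. u k \<noteq> 0}"
            using t V.\<Phi>_finsum[OF u(2), of "\<lambda>k. Psi (u k)"] Psi u(3) by (intro V.\<Phi>_eqI) simp_all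
        qed (use Psi u in \<open>auto simp: W'_def\<close>)
      qed
      moreover have "u' = (\<lambda>k. Psi (u k))" if "?P u'" for u'
      proof -
        have c: "u' k \<in> carrier (Ind A)" and m: "Phi (u' k) \<in> W k" for k using that by (auto simp: W'_def)
        have *: "{k. u' k \<noteq> \<zero>\<^bsub>Ind_complex A\<^esub>} = {k. Phi (u' k) \<noteq> 0}"
          using V.\<Phi>_eq_0 c by auto
        have "(\<lambda>k. Phi (u' k)) = u"
          using that m V.\<Phi>_finsum(2)[of "{k. Phi (u' k) \<noteq> 0}" u'] c unfolding * by (intro uniq) auto
        then show ?thesis using Psi_Phi[OF c] by auto
      qed
      ultimately show "\<exists>!u'. ?P u'" by (rule ex1I)
    qed
    moreover have "whittaker_module (-2) ((Ind_complex A)\<lparr>carrier := W' k\<rparr>) (vir A)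
        (\<xi> * (of_int k + \<epsilon>)) (\<xi>\<^sup>2 / 2) (Psi (w k))" for k
      unfolding whittaker_module_def
    proof (intro conjI)
      interpret V': embedded_module fscale "(Ind_complex A)\<lparr>carrier := W' k\<rparr>" Phi by (rule restr)
      show "virasoro_module (-2) ((Ind_complex A)\<lparr>carrier := W' k\<rparr>) (vir A)"
        using W'_sub vir_W' by (intro virasoro_embedded restr) auto
      have eqI: "s = t" if "s \<in> carrier (Ind A)" "t \<in> carrier (Ind A)" "Phi s = Phi t" for s t
        using V.\<Phi>_eqI[of s t] that by simp
      note cl = Phi_vir[OF Psi(1)] Phi_smult[OF sc_closed Psi(1)] Psi act_simps(7) w Phi_zero Ind_zero_closed
      have "Psi (w k) \<noteq> \<zero>\<^bsub>Ind A\<^esub>" using Psi(2)[of "w k"] w(2)[of k] Phi_zero by metis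
      moreover have "vir A 1 (Psi (w k)) = sc A (\<xi> * (of_int k + \<epsilon>)) \<odot>\<^bsub>Ind A\<^esub> Psi (w k)"
        "vir A 2 (Psi (w k)) = sc A (\<xi>\<^sup>2 / 2) \<odot>\<^bsub>Ind A\<^esub> Psi (w k)" "\<forall>n\<ge>3. vir A n (Psi (w k)) = \<zero>\<^bsub>Ind A\<^esub>"
        by (intro allI impI eqI; simp only: cl)+
      ultimately show "whittaker_vector ((Ind_complex A)\<lparr>carrier := W' k\<rparr>) (vir A)
          (\<xi> * (of_int k + \<epsilon>)) (\<xi>\<^sup>2 / 2) (Psi (w k))"
        unfolding whittaker_vector_def using Psi w(1) by (simp add: W'_def)
      \<comment> \<open>A stable subspace of the summand is also stable in the whole Fock space,
        where \<open>W k\<close> is the least one containing \<open>w k\<close>.\<close>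
      have "W' k \<subseteq> U" if "vir_submodule ((Ind_complex A)\<lparr>carrier := W' k\<rparr>) (vir A) U" "Psi (w k) \<in> U" for U
      proof -
        have U: "U \<subseteq> W' k" "fock.subspace (Phi ` U)" "\<And>n u. u \<in> U \<Longrightarrow> vir A n u \<in> U"
          using that(1) by (auto simp: vir_submodule_def V'.submodule_iff)
        have c: "U \<subseteq> carrier (Ind A)" using U(1) W'_sub by blast
        have "F.Vir n v \<in> Phi ` U" if "v \<in> Phi ` U" for n v
          using that c U(3) by (auto simp flip: Phi_vir(2))
        moreover have "w k \<in> Phi ` U" using Psi(2)[of "w k"] that(2) by (metis imageI)
        ultimately have "W k \<subseteq> Phi ` U" using min U(2) by blast
        then show ?thesis using V.image_mem_iff[of U] c by (auto simp: W'_def)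
      qed
      moreover have "vir_submodule ((Ind_complex A)\<lparr>carrier := W' k\<rparr>) (vir A) (W' k)"
        using V'.image_subspace vir_W' by (simp add: vir_submodule_def V'.submodule_iff)
      moreover have "Psi (w k) \<in> W' k" using Psi w(1) by (simp add: W'_def)
      ultimately show "\<Inter>{U. vir_submodule ((Ind_complex A)\<lparr>carrier := W' k\<rparr>) (vir A) U \<and> Psi (w k) \<in> U}
          = carrier ((Ind_complex A)\<lparr>carrier := W' k\<rparr>)"
        by auto
    qed
    ultimately show ?thesis by (intro exI[of _ "\<lambda>k. Psi (w k)"] exI[of _ W'] conjI allI)
  qed
qed

end

theorem theorem5p6:
  fixes A :: "int \<Rightarrow> mat_pm" and \<xi> \<epsilon> \<tau>p \<tau>m :: complex
  assumes "\<And>k. k > 1 \<Longrightarrow> A k = 0"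
    and "A 1 = mat_pm \<xi> 0 0 (- \<xi>)" and "\<xi> \<noteq> 0"
    and "A 0 = mat_pm \<epsilon> \<tau>m (- \<tau>p) (- \<epsilon>)"
    and "\<And>k. k < 0 \<Longrightarrow> trace (A k) = 0"
  shows "simple_module (SF A) (Ind A)
    \<and> virasoro_module (-2) (Ind_complex A) (vir A)
    \<and> (\<exists>(w :: int \<Rightarrow> ind) (W :: int \<Rightarrow> ind set).
         vir_direct_sum (Ind_complex A) (vir A) W
         \<and> (\<forall>k. whittaker_module (-2) ((Ind_complex A)\<lparr>carrier := W k\<rparr>) (vir A)
                  (\<xi> * (of_int k + \<epsilon>)) (\<xi>\<^sup>2 / 2) (w k)))"
proof -
  interpret irregular_connection A \<xi> \<epsilon> \<tau>p \<tau>m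
    using assms by unfold_locales
  have "virasoro_module (-2) (Ind_complex A) (vir A)"
    by (rule virasoro_embedded[OF embedded]) (simp_all add: Phi_vir)
  then show ?thesis using simple_Ind whittaker_sum by blast
qed

end
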